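(* For $W\in\mathcal A$ and $\varphi\in\mathcal I$ consider the following properties of the pair $(W,\varphi)$: (P2) $R^{\varphi,W}(\beta W)=\beta$ for all $\beta>0$. (P3) Every $g\in\ell^\infty(X)\cap\mathcal F_\varphi$ with $g\le 0$ and $\varphi^{-1}(\mathcal L g)+Wg=0$ satisfies $g=0$. (P4) Every $g\in\ell^\infty(X)\cap\mathcal F_\varphi$ with $\varphi^{-1}(\mathcal L g)+Wg\ge 0$ satisfies $g\ge 0$. (P5) Every $g\in\ell^\infty(X)\cap\mathcal F_\varphi$ with $g\le 0$ and $\varphi^{-1}(\mathcal L g)+Wg\ge 0$ satisfies $g=0$. (P6) Every $f\in\ell^\infty(X)$ with $f\ge 0$ and $-\mathcal L f=\varphi(Wf)$ satisfies $f=0$. Then the assertion (i) the graph $b$ over $(X,m)$ is stochastically complete and, for each $k\in\{2,3,4,5,6\}$, each of the following four assertions are all equivalent to one another: - there exist $W\in\mathcal A\cap\ell^\infty(X)$ and $\varphi\in\mathcal I$ such that (P$k$) holds for $(W,\varphi)$; - there exists $W\in\mathcal A\cap\ell^\infty(X)$ such that for every $\varphi\in\mathcal I$ property (P$k$) holds for $(W,\varphi)$; - for every $W\in\mathcal A$ there exists $\varphi\in\mathcal I$ such that (P$k$) holds for $(W,\varphi)$; - for every $W\in\mathcal A$ and every $\varphi\in\mathcal I$ property (P$k$) holds for $(W,\varphi)$.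
   Context: Let $X \neq \emptyset$ be a countable set, $C(X)$ the real-valued functions on $X$, $C_c(X)$ those of finite support, $\ell^\infty(X)$ the bounded ones. Let $m\colon X \to (0,\infty)$, viewed as a measure on $X$, with $\ell^2(X,m)$ the corresponding real Lebesgue space. Let $b$ be a weighted graph over $X$: a symmetric function $b\colon X\times X \to [0,\infty)$ with $b(x,x)=0$ and $\deg(x) := \sum_{y\in X} b(x,y) < \infty$ for all $x \in X$. (In)equalities between functions are pointwise on $X$. Formal Laplacian: $\mathcal F = \{f \in C(X) : \sum_{y} b(x,y)|f(y)| < \infty \text{ for all } x\in X\}$ (which contains $\ell^\infty(X)$), and $\mathcal L f(x) = \frac{1}{m(x)}\sum_{y\in X} b(x,y)(f(x)-f(y))$ for $f \in \mathcal F$. Energy: $\mathcal Q(f) = \frac12\sum_{x,y\in X} b(x,y)(f(x)-f(y))^2 \in [0,\infty]$ for $f\in C(X)$, $\mathcal D = \{f : \mathcal Q(f)<\infty\}$, and $\mathcal D_0$ is the set of $f \in \mathcal D$ for which there is a sequence $(f_n)$ in $C_c(X)$ with $f_n \to f$ pointwise and $\mathcal Q(f-f_n)\to 0$. Stochastic completeness: let $Q$ be the restriction of $\mathcal Q$ to $D(Q)=\mathcal D_0\cap\ell^2(X,m)$; it is a regular Dirichlet form (in particular a closed quadratic form) on $\ell^2(X,m)$. Let $L$ be the associated nonnegative self-adjoint operator on $\ell^2(X,m)$ and $(e^{-tL})_{t>0}$ its (positivity preserving) semigroup. For $0\le f\in C(X)$ set $e^{-tL}f(x)=\sup\{e^{-tL}g(x)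 : g\in\ell^2(X,m),\ 0\le g\le f\}$. The graph $b$ over $(X,m)$ is stochastically complete if $e^{-tL}1=1$ for all $t>0$. Classes: $\mathcal I$ is the set of all strictly increasing continuous $\varphi\colon\mathbb R\to\mathbb R$ with $\varphi(0)=0$; $\mathcal A=\{W\colon X\to[0,\infty) : \inf_{x\in X}W(x)>0\}$. For $\varphi\in\mathcal I$, $\varphi^{-1}$ is defined on the open interval $\mathrm{ran}\,\varphi$, and $\mathcal F_\varphi = \{f\in\mathcal F : \mathcal L f(x)\in \mathrm{ran}\,\varphi \text{ for all } x\in X\}$. Dirichlet resolvent for $\varphi\in\mathcal I$, $W\in\mathcal A$: let $\Phi(s)=\int_0^s 2\varphi(t)\,dt$. For $f\in C_c(X)$ let $\kappa_f(u)=\sum_{x\in X}\Phi(f(x)-W(x)u(x))\frac{m(x)}{W(x)} \in [0,\infty]$, $D(\mathcal E_f)=\{u\in\mathcal D_0 : \kappa_f(u)<\infty\}$ and $\mathcal E_f(u)=\mathcal Q(u)+\kappa_f(u)$ for $u\in D(\mathcal E_f)$. The functional $\mathcal E_f$ has a unique minimizer on $D(\mathcal E_f)$, denoted $R^{\varphi,W}f$. For $0\le f\in C(X)$ the extended Dirichlet resolvent $R^{\varphi,W}f\colon X\to[0,\infty]$ is $R^{\varphi,W}f(x)=\sup\{R^{\varphi,W}g(x) : g\in C_c(X),\ 0\le g\le f\}$ (for $f \in C_c(X)$ the two definitions agree). *)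

theory Defs
  imports "HOL-Analysis.Analysis"
begin

text \<open>
  The countable vertex set X is the universe of a type of class \<open>countable\<close>; it may be finite or
  infinite. A function on X is a function on the whole type.
\<close>

definition weighted_graph :: "('a::countable \<Rightarrow> 'a \<Rightarrow> real) \<Rightarrow> bool" where
  "weighted_graph b \<longleftrightarrow>
     (\<forall>x y. 0 \<le> b x y) \<and> (\<forall>x y. b x y = b y x) \<and> (\<forall>x. b x x = 0) \<and>
     (\<forall>x. (\<lambda>y. b x y) summable_on UNIV)"

definition fin_supp :: "('a \<Rightarrow> real) set" where
  "fin_supp = {f. finite {x. f x \<noteq> 0}}"

definition linf :: "('a \<Rightarrow> real) set" where
  "linf = {f. bounded (range f)}"


section \<open>Formal Laplacian and energy\<close>

definition lap_dom :: "('a::countable \<Rightarrow> 'a \<Rightarrow> real) \<Rightarrow> ('a \<Rightarrow> real) set" where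
  "lap_dom b = {f. \<forall>x. (\<lambda>y. b x y * \<bar>f y\<bar>) summable_on UNIV}"

definition laplacian ::
    "('a::countable \<Rightarrow> 'a \<Rightarrow> real) \<Rightarrow> ('a \<Rightarrow> real) \<Rightarrow> ('a \<Rightarrow> real) \<Rightarrow> 'a \<Rightarrow> real" where
  "laplacian b m f x = (1 / m x) * (\<Sum>\<^sub>\<infinity>y. b x y * (f x - f y))"

definition energy :: "('a::countable \<Rightarrow> 'a \<Rightarrow> real) \<Rightarrow> ('a \<Rightarrow> real) \<Rightarrow> ennreal" where
  "energy b f = (\<Sum>\<^sub>\<infinity>(x, y). ennreal (b x y * (f x - f y)\<^sup>2)) / 2"

definition finite_energy :: "('a::countable \<Rightarrow> 'a \<Rightarrow> real) \<Rightarrow> ('a \<Rightarrow> real) set" where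
  "finite_energy b = {f. energy b f < \<infinity>}"

definition energy0 :: "('a::countable \<Rightarrow> 'a \<Rightarrow> real) \<Rightarrow> ('a \<Rightarrow> real) set" where
  "energy0 b = {f \<in> finite_energy b. \<exists>F. (\<forall>n. F n \<in> fin_supp) \<and>
     (\<forall>x. (\<lambda>n. F n x) \<longlonglongrightarrow> f x) \<and> (\<lambda>n. energy b (\<lambda>x. f x - F n x)) \<longlonglongrightarrow> 0}"


section \<open>The Dirichlet form on the weighted square-summable functions and its semigroup\<close>

text \<open>Since the measure has full support, its square-integrable functions are genuine functions.\<close>

definition l2 :: "('a::countable \<Rightarrow> real) \<Rightarrow> ('a \<Rightarrow> real) set" where
  "l2 m = {f. (\<lambda>x. (f x)\<^sup>2 * m x) summable_on UNIV}"

definition l2_inner :: "('a::countable \<Rightarrow> real) \<Rightarrow> ('a \<Rightarrow> real) \<Rightarrow> ('a \<Rightarrow> real) \<Rightarrow> real" where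
  "l2_inner m f g = (\<Sum>\<^sub>\<infinity>x. f x * g x * m x)"

definition l2_norm :: "('a::countable \<Rightarrow> real) \<Rightarrow> ('a \<Rightarrow> real) \<Rightarrow> real" where
  "l2_norm m f = sqrt (l2_inner m f f)"

definition form_dom ::
    "('a::countable \<Rightarrow> 'a \<Rightarrow> real) \<Rightarrow> ('a \<Rightarrow> real) \<Rightarrow> ('a \<Rightarrow> real) set" where
  "form_dom b m = energy0 b \<inter> l2 m"

text \<open>Polarization of \<open>energy\<close>; used for functions of finite energy only.\<close>

definition energy_form ::
    "('a::countable \<Rightarrow> 'a \<Rightarrow> real) \<Rightarrow> ('a \<Rightarrow> real) \<Rightarrow> ('a \<Rightarrow> real) \<Rightarrow> real" where
  "energy_form b f g = (\<Sum>\<^sub>\<infinity>(x, y). b x y * (f x - f y) * (g x - g y)) / 2"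

text \<open>
  Graph of the self-adjoint operator L associated with the closed form:
  \<open>form_operator b m f g\<close> says that f is in D(L) and L f = g.
\<close>

definition form_operator ::
    "('a::countable \<Rightarrow> 'a \<Rightarrow> real) \<Rightarrow> ('a \<Rightarrow> real) \<Rightarrow> ('a \<Rightarrow> real) \<Rightarrow> ('a \<Rightarrow> real) \<Rightarrow> bool" where
  "form_operator b m f g \<longleftrightarrow> f \<in> form_dom b m \<and> g \<in> l2 m \<and>
     (\<forall>h\<in>form_dom b m. energy_form b f h = l2_inner m g h)"

text \<open>Strongly continuous semigroups of bounded operators; only the restriction of
  \<open>T t\<close>, \<open>t \<ge> 0\<close>, to \<open>l2 m\<close> is relevant.\<close>

definition c0_semigroup ::
    "('a::countable \<Rightarrow> real) \<Rightarrow> (real \<Rightarrow> ('a \<Rightarrow> real) \<Rightarrow> 'a \<Rightarrow> real) \<Rightarrow> bool" where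
  "c0_semigroup m T \<longleftrightarrow>
     (\<forall>t\<ge>0. \<forall>f\<in>l2 m. T t f \<in> l2 m) \<and>
     (\<forall>t\<ge>0. \<forall>f\<in>l2 m. \<forall>g\<in>l2 m. T t (\<lambda>x. f x + g x) = (\<lambda>x. T t f x + T t g x)) \<and>
     (\<forall>t\<ge>0. \<forall>f\<in>l2 m. \<forall>c. T t (\<lambda>x. c * f x) = (\<lambda>x. c * T t f x)) \<and>
     (\<forall>t\<ge>0. \<exists>C. \<forall>f\<in>l2 m. l2_norm m (T t f) \<le> C * l2_norm m f) \<and>
     (\<forall>f\<in>l2 m. T 0 f = f) \<and>
     (\<forall>s\<ge>0. \<forall>t\<ge>0. \<forall>f\<in>l2 m. T (s + t) f = T s (T t f)) \<and>
     (\<forall>f\<in>l2 m. ((\<lambda>t. l2_norm m (\<lambda>x. T t f x - f x)) \<longlongrightarrow> 0) (at_right 0))"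

text \<open>Graph of the infinitesimal generator.\<close>

definition generator ::
    "('a::countable \<Rightarrow> real) \<Rightarrow> (real \<Rightarrow> ('a \<Rightarrow> real) \<Rightarrow> 'a \<Rightarrow> real) \<Rightarrow>
     ('a \<Rightarrow> real) \<Rightarrow> ('a \<Rightarrow> real) \<Rightarrow> bool" where
  "generator m T f g \<longleftrightarrow> f \<in> l2 m \<and> g \<in> l2 m \<and>
     ((\<lambda>t. l2_norm m (\<lambda>x. (T t f x - f x) / t - g x)) \<longlongrightarrow> 0) (at_right 0)"

text \<open>
  \<open>heat_semigroup b m t\<close> is the operator exp(-tL): the strongly continuous semigroup with
  generator -L. A semigroup is determined by its generator, so for \<open>t \<ge> 0\<close> and arguments in \<open>l2 m\<close>
  the value does not depend on the choice.
\<close>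

definition heat_semigroup ::
    "('a::countable \<Rightarrow> 'a \<Rightarrow> real) \<Rightarrow> ('a \<Rightarrow> real) \<Rightarrow> real \<Rightarrow> ('a \<Rightarrow> real) \<Rightarrow> 'a \<Rightarrow> real" where
  "heat_semigroup b m = (SOME T. c0_semigroup m T \<and>
     (\<forall>f g. generator m T f (\<lambda>x. - g x) \<longleftrightarrow> form_operator b m f g))"

definition heat_semigroup_ext ::
    "('a::countable \<Rightarrow> 'a \<Rightarrow> real) \<Rightarrow> ('a \<Rightarrow> real) \<Rightarrow> real \<Rightarrow> ('a \<Rightarrow> real) \<Rightarrow> 'a \<Rightarrow> ereal" where
  "heat_semigroup_ext b m t f x =
     (SUP g\<in>{g \<in> l2 m. \<forall>y. 0 \<le> g y \<and> g y \<le> f y}. ereal (heat_semigroup b m t g x))"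

definition stochastically_complete ::
    "('a::countable \<Rightarrow> 'a \<Rightarrow> real) \<Rightarrow> ('a \<Rightarrow> real) \<Rightarrow> bool" where
  "stochastically_complete b m \<longleftrightarrow> (\<forall>t>0. \<forall>x. heat_semigroup_ext b m t (\<lambda>_. 1) x = 1)"


section \<open>Nonlinear resolvents\<close>

definition nonlinearities :: "(real \<Rightarrow> real) set" where
  "nonlinearities = {\<phi>. strict_mono \<phi> \<and> continuous_on UNIV \<phi> \<and> \<phi> 0 = 0}"

definition weights :: "('a::countable \<Rightarrow> real) set" where
  "weights = {W. (\<forall>x. 0 \<le> W x) \<and> 0 < (INF x. W x)}"

definition lap_dom_range ::
    "('a::countable \<Rightarrow> 'a \<Rightarrow> real) \<Rightarrow> ('a \<Rightarrow> real) \<Rightarrow> (real \<Rightarrow> real) \<Rightarrow> ('a \<Rightarrow> real) set" where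
  "lap_dom_range b m \<phi> = {f \<in> lap_dom b. \<forall>x. laplacian b m f x \<in> range \<phi>}"

text \<open>The interval integral is oriented, so this is also correct for negative \<open>s\<close>.\<close>

definition primitive :: "(real \<Rightarrow> real) \<Rightarrow> real \<Rightarrow> real" where
  "primitive \<phi> s = (LBINT t=0..s. 2 * \<phi> t)"

definition kappa ::
    "('a::countable \<Rightarrow> real) \<Rightarrow> (real \<Rightarrow> real) \<Rightarrow> ('a \<Rightarrow> real) \<Rightarrow> ('a \<Rightarrow> real) \<Rightarrow> ('a \<Rightarrow> real) \<Rightarrow> ennreal" where
  "kappa m \<phi> W f u = (\<Sum>\<^sub>\<infinity>x. ennreal (primitive \<phi> (f x - W x * u x) * (m x / W x)))"

definition functional_dom ::
    "('a::countable \<Rightarrow> 'a \<Rightarrow> real) \<Rightarrow> ('a \<Rightarrow> real) \<Rightarrow> (real \<Rightarrow> real) \<Rightarrow> ('a \<Rightarrow> real) \<Rightarrow>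
     ('a \<Rightarrow> real) \<Rightarrow> ('a \<Rightarrow> real) set" where
  "functional_dom b m \<phi> W f = {u \<in> energy0 b. kappa m \<phi> W f u < \<infinity>}"

definition functional ::
    "('a::countable \<Rightarrow> 'a \<Rightarrow> real) \<Rightarrow> ('a \<Rightarrow> real) \<Rightarrow> (real \<Rightarrow> real) \<Rightarrow> ('a \<Rightarrow> real) \<Rightarrow>
     ('a \<Rightarrow> real) \<Rightarrow> ('a \<Rightarrow> real) \<Rightarrow> ennreal" where
  "functional b m \<phi> W f u = energy b u + kappa m \<phi> W f u"

text \<open>Meaningful for finitely supported \<open>f\<close>, where the minimizer exists and is unique.\<close>

definition resolvent ::
    "('a::countable \<Rightarrow> 'a \<Rightarrow> real) \<Rightarrow> ('a \<Rightarrow> real) \<Rightarrow> (real \<Rightarrow> real) \<Rightarrow> ('a \<Rightarrow> real) \<Rightarrow>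
     ('a \<Rightarrow> real) \<Rightarrow> 'a \<Rightarrow> real" where
  "resolvent b m \<phi> W f =
     (THE u. is_arg_min (functional b m \<phi> W f) (\<lambda>v. v \<in> functional_dom b m \<phi> W f) u)"

definition resolvent_ext ::
    "('a::countable \<Rightarrow> 'a \<Rightarrow> real) \<Rightarrow> ('a \<Rightarrow> real) \<Rightarrow> (real \<Rightarrow> real) \<Rightarrow> ('a \<Rightarrow> real) \<Rightarrow>
     ('a \<Rightarrow> real) \<Rightarrow> 'a \<Rightarrow> ereal" where
  "resolvent_ext b m \<phi> W f x =
     (SUP g\<in>{g \<in> fin_supp. \<forall>y. 0 \<le> g y \<and> g y \<le> f y}. ereal (resolvent b m \<phi> W g x))"


section \<open>Properties of a pair of a weight and a nonlinearity\<close>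

text \<open>
  Below, \<open>inv \<phi>\<close> is applied only to values in \<open>range \<phi>\<close>, where it is the inverse
  function of the strictly increasing \<open>\<phi>\<close>.
\<close>

definition resolvent_conservative ::
    "('a::countable \<Rightarrow> 'a \<Rightarrow> real) \<Rightarrow> ('a \<Rightarrow> real) \<Rightarrow> ('a \<Rightarrow> real) \<Rightarrow> (real \<Rightarrow> real) \<Rightarrow> bool" where
  "resolvent_conservative b m W \<phi> \<longleftrightarrow>
     (\<forall>\<beta>>0. \<forall>x. resolvent_ext b m \<phi> W (\<lambda>y. \<beta> * W y) x = ereal \<beta>)"

definition nonpos_solutions_trivial ::
    "('a::countable \<Rightarrow> 'a \<Rightarrow> real) \<Rightarrow> ('a \<Rightarrow> real) \<Rightarrow> ('a \<Rightarrow> real) \<Rightarrow> (real \<Rightarrow> real) \<Rightarrow> bool" where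
  "nonpos_solutions_trivial b m W \<phi> \<longleftrightarrow>
     (\<forall>g \<in> linf \<inter> lap_dom_range b m \<phi>.
        (\<forall>x. g x \<le> 0) \<and> (\<forall>x. inv \<phi> (laplacian b m g x) + W x * g x = 0)
        \<longrightarrow> (\<forall>x. g x = 0))"

definition supersolutions_nonneg ::
    "('a::countable \<Rightarrow> 'a \<Rightarrow> real) \<Rightarrow> ('a \<Rightarrow> real) \<Rightarrow> ('a \<Rightarrow> real) \<Rightarrow> (real \<Rightarrow> real) \<Rightarrow> bool" where
  "supersolutions_nonneg b m W \<phi> \<longleftrightarrow>
     (\<forall>g \<in> linf \<inter> lap_dom_range b m \<phi>.
        (\<forall>x. inv \<phi> (laplacian b m g x) + W x * g x \<ge> 0) \<longrightarrow> (\<forall>x. g x \<ge> 0))"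

definition nonpos_supersolutions_trivial ::
    "('a::countable \<Rightarrow> 'a \<Rightarrow> real) \<Rightarrow> ('a \<Rightarrow> real) \<Rightarrow> ('a \<Rightarrow> real) \<Rightarrow> (real \<Rightarrow> real) \<Rightarrow> bool" where
  "nonpos_supersolutions_trivial b m W \<phi> \<longleftrightarrow>
     (\<forall>g \<in> linf \<inter> lap_dom_range b m \<phi>.
        (\<forall>x. g x \<le> 0) \<and> (\<forall>x. inv \<phi> (laplacian b m g x) + W x * g x \<ge> 0)
        \<longrightarrow> (\<forall>x. g x = 0))"

definition nonneg_solutions_trivial ::
    "('a::countable \<Rightarrow> 'a \<Rightarrow> real) \<Rightarrow> ('a \<Rightarrow> real) \<Rightarrow> ('a \<Rightarrow> real) \<Rightarrow> (real \<Rightarrow> real) \<Rightarrow> bool" where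
  "nonneg_solutions_trivial b m W \<phi> \<longleftrightarrow>
     (\<forall>f \<in> linf.
        (\<forall>x. f x \<ge> 0) \<and> (\<forall>x. - laplacian b m f x = \<phi> (W x * f x))
        \<longrightarrow> (\<forall>x. f x = 0))"

end

theory Submission
  imports Defs
begin

text \<open>
  The equation \<open>L u = \<phi> (g - W u)\<close> balances \<open>\<Sum>y. b x y * u y\<close> against a strictly increasing function
  of \<open>u x\<close>, so Perron's method gives a least nonnegative (super)solution \<open>N g\<close>. It is increasing in
  \<open>g\<close> and compatible with increasing limits. On a finite set convexity makes it the minimizer of the
  resolvent functional; exhausting the graph, the parallelogram identity gives convergence in energy.
  Hence \<open>R (\<beta> W) = N (\<beta> W)\<close>, while \<open>\<beta> - N (\<beta> W)\<close> is the largest solution of \<open>- L f = \<phi> (W f)\<close> below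
  \<open>\<beta>\<close>. So (P2) and (P6) coincide. Truncating bounded functions just below their supremum turns
  nonlinear subsolutions into subsolutions of \<open>- L h = h\<close> and conversely, which compares (P3)-(P6) for
  all \<open>W\<close> and \<open>\<phi>\<close> with the linear Liouville property.

  For \<open>\<phi> = id\<close> and constant \<open>W\<close> the minimizers are the resolvents of the form operator, and the
  Hille-Yosida theorem produces the heat semigroup from them. It preserves the interval from 0 to 1,
  and integrating \<open>exp (- s) * T s 1\<close> over \<open>s\<close> shows that it conserves 1 iff the resolvent
  does, that is, iff \<open>N 1 = 1\<close>.
\<close>

text \<open>The nonlinearity obeys no growth condition and \<open>\<beta> * W\<close> need not be
  admissible for the functional, so minimization is confined to data for which the zero function is
  admissible. Least supersolutions carry the rest: they need only one supersolution to exist, and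
  their monotonicity in data and domain is immediate.

  Independence of \<open>\<phi>\<close> comes from working just below a supremum, where
  \<open>m * h\<close> is comparable to a constant multiple of \<open>m\<close> and
  \<open>\<phi> (W * f)\<close> is controlled by a single value of \<open>\<phi>\<close>. A positive
  lower bound of \<open>W\<close> serves the passage from the linear to the nonlinear side, an upper
  bound the passage back.

  The definitions fix the heat semigroup by a choice among all strongly continuous semigroups with
  the right generator. Constructing one is therefore not enough: it must be compared with an
  arbitrary competitor, for which no uniform bound near time 0 is given. This is why a Baire
  argument and a telescoping estimate appear.

  The resolvents of the form operator are taken from the nonlinear minimizers, so the form needs no
  separate solution theory.\<close>

lemma
  fixes f :: "'a \<Rightarrow> real"
  assumes nn: "\<And>x. 0 \<le> f x" and C: "\<And>F. finite F \<Longrightarrow> sum f F \<le> C"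
  shows nonneg_bounded_summable: "f summable_on UNIV" and nonneg_bounded_infsum: "infsum f UNIV \<le> C"
proof -
  show s: "f summable_on UNIV"
    by (rule nonneg_bdd_above_summable_on) (use assms in \<open>auto intro!: bdd_aboveI[where M = C]\<close>)
  show "infsum f UNIV \<le> C"
    by (rule infsum_le_finite_sums[OF s]) (use C in auto)
qed

lemma ennreal_infsum:
  fixes f :: "'a \<Rightarrow> real"
  assumes "f summable_on UNIV" "\<And>x. 0 \<le> f x"
  shows "(\<Sum>\<^sub>\<infinity>x. ennreal (f x)) = ennreal (infsum f UNIV)"
proof -
  have "ennreal (infsum f UNIV) = (SUP F\<in>{F. finite F \<and> F \<subseteq> UNIV}. ennreal (sum f F))"
    by (rule infsum_nonneg_is_SUPREMUM_ennreal) (use assms in auto)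
  also have "\<dots> = (SUP F\<in>{F. finite F \<and> F \<subseteq> UNIV}. sum (\<lambda>x. ennreal (f x)) F)"
    by (intro SUP_cong) (use assms in \<open>auto simp: sum_ennreal\<close>)
  also have "\<dots> = (\<Sum>\<^sub>\<infinity>x. ennreal (f x))"
    by (rule nonneg_infsum_complete[symmetric]) auto
  finally show ?thesis by simp
qed

lemma ennreal_infsum_finite_summable:
  fixes f :: "'a \<Rightarrow> real"
  assumes fin: "(\<Sum>\<^sub>\<infinity>x. ennreal (f x)) < \<infinity>" and nn: "\<And>x. 0 \<le> f x"
  shows "f summable_on UNIV"
proof (rule nonneg_bounded_summable)
  fix F :: "'a set" assume F: "finite F"
  have "ennreal (sum f F) = sum (\<lambda>x. ennreal (f x)) F" using nn by (simp add: sum_ennreal)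
  also have "\<dots> \<le> (\<Sum>\<^sub>\<infinity>x. ennreal (f x))"
    unfolding nonneg_infsum_complete[of UNIV "\<lambda>x. ennreal (f x)", simplified]
    by (rule SUP_upper) (use F in auto)
  finally have "ennreal (sum f F) \<le> (\<Sum>\<^sub>\<infinity>x. ennreal (f x))" .
  then show "sum f F \<le> enn2real (\<Sum>\<^sub>\<infinity>x. ennreal (f x))"
    using fin nn by (metis enn2real_ennreal enn2real_mono infinity_ennreal_def sum_nonneg)
qed (use nn in auto)

text \<open>Fatou's lemma for a summable limit: a finite set carries all but \<open>e/2\<close> of
  the limit sum, and the sums over that set converge.\<close>

lemma infsum_eventually_ge:
  fixes f :: "'a \<Rightarrow> real" and F :: "nat \<Rightarrow> 'a \<Rightarrow> real"
  assumes f: "f summable_on UNIV" and F: "\<And>n. F n summable_on UNIV" and nn: "\<And>n x. 0 \<le> F n x"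
    and lim: "\<And>x. (\<lambda>n. F n x) \<longlonglongrightarrow> f x" and e: "0 < e"
  shows "eventually (\<lambda>n. infsum (F n) UNIV \<ge> infsum f UNIV - e) sequentially"
proof -
  obtain A where A: "finite A" "dist (sum f A) (infsum f UNIV) \<le> e/2"
    using infsum_finite_approximation[OF f, of "e/2"] e by auto
  have "(\<lambda>n. sum (F n) A) \<longlonglongrightarrow> sum f A" by (intro tendsto_sum lim)
  then have "eventually (\<lambda>n. dist (sum (F n) A) (sum f A) < e/2) sequentially"
    by (rule tendstoD) (use e in auto)
  then show ?thesis
  proof (rule eventually_mono)
    fix n assume n: "dist (sum (F n) A) (sum f A) < e/2"
    have "sum (F n) A \<le> infsum (F n) UNIV"
      by (rule finite_sum_le_infsum) (use F A nn in auto)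
    then show "infsum (F n) UNIV \<ge> infsum f UNIV - e"
      using n A(2) unfolding dist_real_def by linarith
  qed
qed

text \<open>Fatou's lemma in the form that also produces summability of the limit: the bound
  survives the limit on every finite set.\<close>

lemma infsum_limit_le:
  fixes f :: "'a \<Rightarrow> real" and F :: "nat \<Rightarrow> 'a \<Rightarrow> real"
  assumes F: "\<And>n. F n summable_on UNIV" and nn: "\<And>n x. 0 \<le> F n x"
    and lim: "\<And>x. (\<lambda>n. F n x) \<longlonglongrightarrow> f x"
    and C: "eventually (\<lambda>n. infsum (F n) UNIV \<le> C) sequentially"
  shows "f summable_on UNIV" "infsum f UNIV \<le> C"
proof -
  have nnf: "0 \<le> f x" for x by (rule LIMSEQ_le_const[OF lim]) (use nn in auto)
  have "sum f A \<le> C" if A: "finite A" for A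
  proof (rule tendsto_upperbound)
    show "(\<lambda>n. sum (F n) A) \<longlonglongrightarrow> sum f A" by (intro tendsto_sum lim)
    show "eventually (\<lambda>n. sum (F n) A \<le> C) sequentially"
      using C
    proof (rule eventually_mono)
      fix n assume n: "infsum (F n) UNIV \<le> C"
      have "sum (F n) A \<le> infsum (F n) UNIV"
        by (rule finite_sum_le_infsum) (use F A nn in auto)
      then show "sum (F n) A \<le> C" using n by simp
    qed
  qed auto
  then show "f summable_on UNIV" "infsum f UNIV \<le> C"
    using nnf nonneg_bounded_summable nonneg_bounded_infsum by blast+
qed

text \<open>Initial segments of the enumeration. On a finite type they are eventually everything, so
  finite and infinite graphs need no separate treatment.\<close>

definition exhaust :: "nat \<Rightarrow> 'a::countable set" where
  "exhaust n = {x. to_nat x < n}"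

lemma finite_exhaust [simp]: "finite (exhaust n)"
proof -
  have "exhaust n \<subseteq> to_nat -` {..<n}" by (auto simp: exhaust_def)
  moreover have "finite (to_nat -` {..<n} :: 'a set)" by (rule finite_vimageI) auto
  ultimately show ?thesis by (rule finite_subset)
qed

lemma exhaust_mono: "i \<le> j \<Longrightarrow> exhaust i \<subseteq> exhaust j"
  by (auto simp: exhaust_def)

lemma eventually_in_exhaust: "eventually (\<lambda>n. x \<in> exhaust n) sequentially"
  unfolding exhaust_def using eventually_gt_at_top[of "to_nat x"] by auto

section \<open>Least supersolutions\<close>

locale wgraph =
  fixes b :: "'a::countable \<Rightarrow> 'a \<Rightarrow> real" and m :: "'a \<Rightarrow> real"
  assumes graph: "weighted_graph b" and measure_pos: "\<forall>x. 0 < m x"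
begin

lemma b_nonneg [simp]: "0 \<le> b x y" and b_sym: "b x y = b y x" and b_diag [simp]: "b x x = 0"
  and b_summable: "b x summable_on UNIV"
  using graph by (auto simp: weighted_graph_def)

lemma m_pos [simp]: "0 < m x" using measure_pos by auto

lemma m_nonneg [simp]: "0 \<le> m x" and m_nonzero [simp]: "m x \<noteq> 0"
  using m_pos[of x] by linarith+

definition deg :: "'a \<Rightarrow> real" where "deg x = infsum (b x) UNIV"

lemma deg_nonneg [simp]: "0 \<le> deg x"
  unfolding deg_def by (rule infsum_nonneg) auto

lemma sum_b_le_deg: "finite F \<Longrightarrow> sum (b x) F \<le> deg x"
  unfolding deg_def by (rule finite_sum_le_infsum[OF b_summable]) auto

lemma summable_b_bounded:
  assumes "\<And>y. \<bar>f y\<bar> \<le> C"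
  shows "(\<lambda>y. b x y * f y) summable_on UNIV"
proof (rule iffD2[OF summable_on_iff_abs_summable_on_real], rule Infinite_Sum.abs_summable_on_comparison_test)
  show "(\<lambda>y. norm (b x y * C)) summable_on UNIV"
    using summable_on_cmult_left[OF b_summable[of x], of C]
    by (subst (asm) summable_on_iff_abs_summable_on_real) simp
  show "norm (b x y * f y) \<le> norm (b x y * C)" for y
    using assms[of y] by (auto simp: abs_mult intro!: mult_left_mono)
qed

lemma linfD: assumes "f \<in> linf" obtains C where "0 < C" "\<And>y. \<bar>f y\<bar> \<le> C"
  using assms unfolding linf_def by (auto simp: bounded_pos)

lemma linfI: assumes "\<And>y. \<bar>f y\<bar> \<le> C" shows "f \<in> linf"
  unfolding linf_def by (auto intro!: boundedI[where B = C] simp: assms)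

lemma summable_b_linf: "f \<in> linf \<Longrightarrow> (\<lambda>y. b x y * f y) summable_on UNIV"
  using linfD summable_b_bounded by metis

lemma linf_lap_dom: assumes "f \<in> linf" shows "f \<in> lap_dom b"
proof -
  obtain C where C: "\<And>y. \<bar>f y\<bar> \<le> C" using assms linfD by metis
  have "(\<lambda>y. b x y * \<bar>f y\<bar>) summable_on UNIV" for x
    by (rule summable_b_bounded[where C = C]) (use C in auto)
  then show ?thesis by (auto simp: lap_dom_def)
qed

lemma laplacian_summable:
  assumes "(\<lambda>y. b x y * f y) summable_on UNIV"
  shows "m x * laplacian b m f x = deg x * f x - (\<Sum>\<^sub>\<infinity>y. b x y * f y)"
proof -
  have "(\<Sum>\<^sub>\<infinity>y. b x y * (f x - f y)) = (\<Sum>\<^sub>\<infinity>y. b x y * f x + - (b x y * f y))"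
    by (simp add: algebra_simps)
  also have "\<dots> = (\<Sum>\<^sub>\<infinity>y. b x y * f x) + (\<Sum>\<^sub>\<infinity>y. - (b x y * f y))"
    by (intro infsum_add summable_on_cmult_left b_summable) (simp add: summable_on_uminus assms)
  also have "\<dots> = deg x * f x - (\<Sum>\<^sub>\<infinity>y. b x y * f y)"
    by (simp add: infsum_uminus deg_def infsum_cmult_left[OF b_summable])
  finally show ?thesis by (simp add: laplacian_def)
qed

lemmas laplacian_linf = laplacian_summable[OF summable_b_linf]

end

locale nonlin = wgraph b m for b :: "'a::countable \<Rightarrow> 'a \<Rightarrow> real" and m +
  fixes \<phi> :: "real \<Rightarrow> real" and W :: "'a \<Rightarrow> real"
  assumes phi: "\<phi> \<in> nonlinearities" and W: "W \<in> weights"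
begin

lemma phi_mono_iff: "\<phi> s \<le> \<phi> t \<longleftrightarrow> s \<le> t" and phi_strict: "s < t \<Longrightarrow> \<phi> s < \<phi> t"
  and phi_0 [simp]: "\<phi> 0 = 0" and phi_inj: "inj \<phi>"
  using phi by (auto simp: nonlinearities_def strict_mono_less_eq strict_mono_less strict_mono_imp_inj_on)

lemma phi_cont: "continuous_on A \<phi>"
  using phi continuous_on_subset by (auto simp: nonlinearities_def)

lemma W_lower: obtains c where "0 < c" "\<And>x. c \<le> W x"
proof
  show "0 < (INF x. W x)" using W by (auto simp: weights_def)
  show "(INF x. W x) \<le> W x" for x
    by (rule cINF_lower) (use W in \<open>auto simp: weights_def intro!: bdd_belowI[where m = 0]\<close>)
qed

lemma W_pos [simp]: "0 < W x"
  using W_lower by (metis less_le_trans)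

lemma W_nonneg [simp]: "0 \<le> W x" and W_nonzero [simp]: "W x \<noteq> 0"
  using W_pos[of x] by linarith+

text \<open>The equation \<open>L u = \<phi> (g - W u)\<close> at \<open>x\<close> reads
  \<open>(\<Sum>y. b x y * u y) = balance g x (u x)\<close>, with a strictly increasing right-hand side.\<close>

definition balance :: "('a \<Rightarrow> real) \<Rightarrow> 'a \<Rightarrow> real \<Rightarrow> real" where
  "balance g x t = deg x * t - m x * \<phi> (g x - W x * t)"

lemma balance_strict: assumes "s < t" shows "balance g x s < balance g x t"
proof -
  have "g x - W x * t < g x - W x * s" using assms by simp
  then have "m x * \<phi> (g x - W x * t) < m x * \<phi> (g x - W x * s)" using phi_strict by simp
  moreover have "deg x * s \<le> deg x * t" using assms by (intro mult_left_mono) auto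
  ultimately show ?thesis unfolding balance_def by linarith
qed

lemma balance_cont: "continuous_on A (balance g x)"
  unfolding balance_def by (intro continuous_intros continuous_on_compose2[OF phi_cont[of UNIV]]) auto

lemma balance_antimono: "g x \<le> g' x \<Longrightarrow> balance g' x t \<le> balance g x t"
  unfolding balance_def using phi_mono_iff by (simp add: mult_left_mono)

text \<open>Bounding all finite partial sums makes summability part of the definition.\<close>

definition supersol :: "('a \<Rightarrow> real) \<Rightarrow> 'a set \<Rightarrow> ('a \<Rightarrow> real) \<Rightarrow> bool" where
  "supersol g K v \<longleftrightarrow> (\<forall>x. 0 \<le> v x) \<and>
     (\<forall>x\<in>K. \<forall>F. finite F \<longrightarrow> (\<Sum>y\<in>F. b x y * v y) \<le> balance g x (v x))"

text \<open>A real infimum, informative only when some supersolution exists. Hence the recurring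
  hypothesis \<open>supersol g K v\<close> with an otherwise arbitrary \<open>v\<close>.\<close>

definition lsol :: "('a \<Rightarrow> real) \<Rightarrow> 'a set \<Rightarrow> 'a \<Rightarrow> real" where
  "lsol g K x = (INF v\<in>Collect (supersol g K). v x)"

lemma lsol_le: assumes "supersol g K v" shows "lsol g K x \<le> v x"
  unfolding lsol_def
  by (rule cINF_lower) (use assms in \<open>auto simp: supersol_def intro!: bdd_belowI[where m = 0]\<close>)

lemma lsol_ge: assumes "supersol g K v" "\<And>v. supersol g K v \<Longrightarrow> t \<le> v x" shows "t \<le> lsol g K x"
  unfolding lsol_def by (rule cINF_greatest) (use assms in auto)

lemma lsol_nonneg: assumes "supersol g K v" shows "0 \<le> lsol g K x"
  by (rule lsol_ge[OF assms]) (auto simp: supersol_def)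

lemma supersol_antimono:
  assumes "supersol g' K' v" "K \<subseteq> K'" "\<And>x. x \<in> K \<Longrightarrow> g x \<le> g' x" shows "supersol g K v"
  unfolding supersol_def
proof (intro conjI allI ballI impI)
  fix x F assume "x \<in> K" "finite (F :: 'a set)"
  then show "(\<Sum>y\<in>F. b x y * v y) \<le> balance g x (v x)"
    using assms balance_antimono[of g x g' "v x"] unfolding supersol_def by (meson order_trans subsetD)
qed (use assms in \<open>auto simp: supersol_def\<close>)

lemma lsol_mono:
  assumes "supersol g' K' v" "K \<subseteq> K'" "\<And>x. x \<in> K \<Longrightarrow> g x \<le> g' x"
  shows "lsol g K x \<le> lsol g' K' x"
  by (rule lsol_ge[OF assms(1)]) (metis assms(2,3) lsol_le supersol_antimono)

text \<open>For a constant the neighbour sum is at most \<open>deg x * c\<close>, so only the sign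
  of \<open>\<phi> (g x - W x * c)\<close> matters.\<close>

lemma supersol_const:
  assumes "0 \<le> c" "\<And>x. x \<in> K \<Longrightarrow> g x \<le> W x * c" shows "supersol g K (\<lambda>_. c)"
  unfolding supersol_def
proof (intro conjI allI ballI impI)
  fix x F assume x: "x \<in> K" and F: "finite (F :: 'a set)"
  have "(\<Sum>y\<in>F. b x y * c) = sum (b x) F * c" by (simp add: sum_distrib_right)
  also have "\<dots> \<le> deg x * c" using sum_b_le_deg[OF F] assms by (intro mult_right_mono) auto
  also have "\<dots> \<le> balance g x c"
    using assms(2)[OF x] phi_mono_iff[of "g x - W x * c" 0]
    by (auto simp: balance_def mult_le_0_iff)
  finally show "(\<Sum>y\<in>F. b x y * c) \<le> balance g x c" .
qed (use assms in auto)

text \<open>The left side of the inequality is increasing in the function, while the right side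
  depends only on the value at \<open>x\<close>. Some supersolution comes arbitrarily close to the
  infimum at that one point, and continuity of \<open>balance\<close> finishes.\<close>

lemma supersol_lsol:
  assumes v: "supersol g K v" shows "supersol g K (lsol g K)"
  unfolding supersol_def
proof (intro conjI allI ballI impI)
  show "0 \<le> lsol g K x" for x by (rule lsol_nonneg[OF v])
  fix x F assume x: "x \<in> K" and F: "finite (F :: 'a set)"
  let ?S = "\<Sum>y\<in>F. b x y * lsol g K y"
  have le: "?S \<le> balance g x (w x)" if w: "supersol g K w" for w
  proof -
    have "?S \<le> (\<Sum>y\<in>F. b x y * w y)" by (intro sum_mono mult_left_mono lsol_le w) auto
    also have "\<dots> \<le> balance g x (w x)" using w x F by (auto simp: supersol_def)
    finally show ?thesis .
  qed
  show "?S \<le> balance g x (lsol g K x)"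
  proof (rule ccontr)
    assume "\<not> ?thesis"
    then have "eventually (\<lambda>t. balance g x t < ?S) (nhds (lsol g K x))"
      using balance_cont[of UNIV g x] by (intro order_tendstoD(2)[where y = "balance g x (lsol g K x)"])
        (auto simp: continuous_on_eq_continuous_at isCont_def tendsto_at_iff_tendsto_nhds)
    then obtain d where d: "d > 0" "\<And>t. dist t (lsol g K x) < d \<Longrightarrow> balance g x t < ?S"
      by (auto simp: eventually_nhds_metric)
    have "\<exists>w\<in>Collect (supersol g K). w x < lsol g K x + d"
      unfolding lsol_def[of g K x]
      by (rule cINF_less_iff[THEN iffD1])
        (use v d in \<open>auto simp: supersol_def intro!: bdd_belowI[where m = 0] simp flip: lsol_def\<close>)
    then obtain w where w: "supersol g K w" "w x < lsol g K x + d" by auto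
    have "dist (w x) (lsol g K x) < d" using w lsol_le[OF w(1), of x] by (auto simp: dist_real_def)
    then show False using d(2) le[OF w(1)] by force
  qed
qed

text \<open>No inequality is imposed outside \<open>K\<close>, so lowering a supersolution to 0
  there only relaxes the inequalities inside \<open>K\<close>.\<close>

lemma lsol_outside: assumes v: "supersol g K v" "x \<notin> K" shows "lsol g K x = 0"
proof -
  have "supersol g K (v(x := 0))"
    unfolding supersol_def
  proof (intro conjI allI ballI impI)
    fix z F assume z: "z \<in> K" and F: "finite (F :: 'a set)"
    have "(\<Sum>y\<in>F. b z y * (v(x := 0)) y) \<le> (\<Sum>y\<in>F. b z y * v y)"
      using v by (intro sum_mono mult_left_mono) (auto simp: supersol_def)
    also have "\<dots> \<le> balance g z (v z)" using v z F by (auto simp: supersol_def)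
    finally show "(\<Sum>y\<in>F. b z y * (v(x := 0)) y) \<le> balance g z ((v(x := 0)) z)"
      using z assms(2) by auto
  qed (use v in \<open>auto simp: supersol_def\<close>)
  from lsol_le[OF this, of x] lsol_nonneg[OF v(1), of x] show ?thesis by simp
qed

text \<open>Perron's lowering argument: if the inequality were strict at \<open>x\<close>, the value
  at \<open>x\<close> could be decreased until equality holds. This only helps the other vertices
  and contradicts leastness.\<close>

lemma lsol_solves:
  assumes v: "supersol g K v" and x: "x \<in> K" and g: "0 \<le> g x"
  shows "(\<lambda>y. b x y * lsol g K y) summable_on UNIV"
    "(\<Sum>\<^sub>\<infinity>y. b x y * lsol g K y) = balance g x (lsol g K x)"
proof -
  let ?u = "lsol g K" let ?S = "\<Sum>\<^sub>\<infinity>y. b x y * lsol g K y"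
  note u = supersol_lsol[OF v]
  have nn: "0 \<le> b z y * ?u y" for z y using lsol_nonneg[OF v] by simp
  have le: "(\<Sum>y\<in>F. b x y * ?u y) \<le> balance g x (?u x)" if "finite F" for F
    using u x that by (auto simp: supersol_def)
  show s: "(\<lambda>y. b x y * ?u y) summable_on UNIV" by (rule nonneg_bounded_summable[OF nn le])
  have S: "?S \<le> balance g x (?u x)" by (rule nonneg_bounded_infsum[OF nn le])
  show "?S = balance g x (?u x)"
  proof (rule ccontr)
    assume "?S \<noteq> balance g x (?u x)"
    with S have less: "?S < balance g x (?u x)" by simp
    have S0: "0 \<le> ?S" by (rule infsum_nonneg) (use nn in auto)
    \<comment> \<open>Here \<open>0 \<le> g x\<close> is needed: it gives the left endpoint for the
      intermediate value theorem, so the lowered value stays nonnegative.\<close>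
    have "balance g x 0 \<le> 0" using g phi_mono_iff[of 0 "g x"] by (auto simp: balance_def)
    then obtain t where t: "0 \<le> t" "t \<le> ?u x" "balance g x t = ?S"
      using IVT'[of "balance g x" 0 ?S "?u x"] balance_cont S0 less lsol_nonneg[OF v, of x] by force
    have "supersol g K (?u(x := t))"
      unfolding supersol_def
    proof (intro conjI allI ballI impI)
      show "0 \<le> (?u(x := t)) y" for y using t lsol_nonneg[OF v] by auto
      fix z F assume z: "z \<in> K" and F: "finite (F :: 'a set)"
      have 1: "(\<Sum>y\<in>F. b z y * (?u(x := t)) y) \<le> (\<Sum>y\<in>F. b z y * ?u y)"
        using t by (intro sum_mono mult_left_mono) auto
      show "(\<Sum>y\<in>F. b z y * (?u(x := t)) y) \<le> balance g z ((?u(x := t)) z)"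
      proof (cases "z = x")
        case True
        have "(\<Sum>y\<in>F. b x y * ?u y) \<le> ?S" by (rule finite_sum_le_infsum[OF s F]) (use nn in auto)
        then show ?thesis using 1 True t by auto
      next
        case False
        have "(\<Sum>y\<in>F. b z y * ?u y) \<le> balance g z (?u z)" using u z F by (auto simp: supersol_def)
        then show ?thesis using 1 False by auto
      qed
    qed
    from lsol_le[OF this, of x] t less show False by auto
  qed
qed

text \<open>The least solutions increase, their limit is a supersolution of the limiting problem by
  continuity of \<open>balance\<close>, and monotonicity puts it below \<open>lsol g' UNIV\<close>.
  One statement serves two exhaustions: growing sets with fixed data, and growing data on the whole
  graph. Pointwise boundedness is assumed because no common supersolution is given; the second
  conclusion provides one.\<close>

lemma lsol_seq_limit:
  assumes K: "incseq K" "(\<Union>n. K n) = UNIV"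
    and g: "\<And>x. incseq (\<lambda>n. g n x)" "\<And>x. eventually (\<lambda>n. g n x = g' x) sequentially"
    and v: "\<And>n. supersol (g n) (K n) (v n)"
    and bdd: "\<And>x. bdd_above (range (\<lambda>n. lsol (g n) (K n) x))"
  shows "(\<lambda>n. lsol (g n) (K n) x) \<longlonglongrightarrow> lsol g' UNIV x" "supersol g' UNIV (lsol g' UNIV)"
    "lsol (g n) (K n) x \<le> lsol g' UNIV x"
proof -
  let ?u = "\<lambda>n x. lsol (g n) (K n) x"
  define w where "w x = (SUP n. ?u n x)" for x
  have inc: "incseq (\<lambda>n. ?u n x)" for x
    by (rule incseq_SucI, rule lsol_mono[OF v])
      (use K g in \<open>auto simp: incseq_Suc_iff\<close>)
  have lim: "(\<lambda>n. ?u n x) \<longlonglongrightarrow> w x" for x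
    unfolding w_def by (rule LIMSEQ_incseq_SUP[OF bdd inc])
  have gle: "g n x \<le> g' x" for n x
  proof -
    obtain N where "\<And>k. k \<ge> N \<Longrightarrow> g k x = g' x" using g(2)[of x] by (auto simp: eventually_sequentially)
    then show ?thesis using g(1)[of x] by (metis incseq_def nle_le)
  qed
  have w: "supersol g' UNIV w"
    unfolding supersol_def
  proof (intro conjI allI ballI impI)
    show "0 \<le> w x" for x by (rule LIMSEQ_le_const[OF lim]) (use lsol_nonneg[OF v] in auto)
    fix x F assume F: "finite (F :: 'a set)"
    have "isCont (balance g' x) (w x)"
      using balance_cont[of UNIV g' x] by (auto simp: continuous_on_eq_continuous_at)
    then have R: "(\<lambda>n. balance g' x (?u n x)) \<longlonglongrightarrow> balance g' x (w x)"
      using lim[of x] by (rule isCont_tendsto_compose)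
    have L: "(\<lambda>n. \<Sum>y\<in>F. b x y * ?u n y) \<longlonglongrightarrow> (\<Sum>y\<in>F. b x y * w y)"
      by (intro tendsto_intros lim)
    obtain N where N: "x \<in> K N" using K by auto
    have "eventually (\<lambda>n. x \<in> K n) sequentially"
      unfolding eventually_sequentially using K(1) N by (auto simp: incseq_def)
    then have "eventually (\<lambda>n. (\<Sum>y\<in>F. b x y * ?u n y) \<le> balance g' x (?u n x)) sequentially"
      using g(2)[of x]
    proof eventually_elim
      case (elim n)
      then have "(\<Sum>y\<in>F. b x y * ?u n y) \<le> balance (g n) x (?u n x)"
        using supersol_lsol[OF v[of n]] F by (auto simp: supersol_def)
      then show ?case using elim by (simp add: balance_def)
    qed
    then show "(\<Sum>y\<in>F. b x y * w y) \<le> balance g' x (w x)"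
      by (rule tendsto_le[OF _ R L, rotated]) simp
  qed
  have ule: "?u n x \<le> lsol g' UNIV x" for n x
    by (rule lsol_mono[OF w]) (use gle in auto)
  have "w x \<le> lsol g' UNIV x" for x
    by (rule LIMSEQ_le_const2[OF lim]) (use ule in auto)
  then have "w = lsol g' UNIV" using lsol_le[OF w] by (intro ext antisym) auto
  then show "(\<lambda>n. ?u n x) \<longlonglongrightarrow> lsol g' UNIV x" "supersol g' UNIV (lsol g' UNIV)"
    using lim w by auto
  show "?u n x \<le> lsol g' UNIV x" by (rule ule)
qed

end

section \<open>The Banach algebra of bounded operators\<close>

text \<open>Bounded operators with composition as product, so that \<open>exp\<close> is the
  operator exponential. The class \<open>perfect_space\<close> excludes the zero space, in which
  \<open>1 = 0\<close>.\<close>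

typedef (overloaded) 'b bop = "UNIV :: ('b::{real_normed_vector, perfect_space} \<Rightarrow>\<^sub>L 'b) set"
  morphisms blinfun_of_bop Bop by simp

setup_lifting type_definition_bop

lift_definition bapp :: "'b::{real_normed_vector, perfect_space} bop \<Rightarrow> 'b \<Rightarrow> 'b" is blinfun_apply .

instantiation bop :: ("{real_normed_vector, perfect_space}") real_normed_algebra_1
begin

lift_definition zero_bop :: "'a bop" is 0 .
lift_definition one_bop :: "'a bop" is id_blinfun .
lift_definition plus_bop :: "'a bop \<Rightarrow> 'a bop \<Rightarrow> 'a bop" is "(+)" .
lift_definition minus_bop :: "'a bop \<Rightarrow> 'a bop \<Rightarrow> 'a bop" is "(-)" .
lift_definition uminus_bop :: "'a bop \<Rightarrow> 'a bop" is uminus .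
lift_definition times_bop :: "'a bop \<Rightarrow> 'a bop \<Rightarrow> 'a bop" is "(o\<^sub>L)" .
lift_definition scaleR_bop :: "real \<Rightarrow> 'a bop \<Rightarrow> 'a bop" is scaleR .
lift_definition norm_bop :: "'a bop \<Rightarrow> real" is norm .
definition sgn_bop :: "'a bop \<Rightarrow> 'a bop" where "sgn_bop a = inverse (norm a) *\<^sub>R a"
definition dist_bop :: "'a bop \<Rightarrow> 'a bop \<Rightarrow> real" where "dist_bop a b = norm (a - b)"
definition uniformity_bop :: "('a bop \<times> 'a bop) filter" where
  "uniformity_bop = (INF e\<in>{0 <..}. principal {(x, y). dist x y < e})"
definition open_bop :: "'a bop set \<Rightarrow> bool" where
  "open_bop S = (\<forall>x\<in>S. \<forall>\<^sub>F (x', y) in uniformity. x' = x \<longrightarrow> y \<in> S)"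

instance
proof
  fix a c d :: "'a bop" and r s :: real
  show "a + c + d = a + (c + d)" "a + c = c + a" "0 + a = a" "- a + a = 0" "a - c = a + - c"
    "r *\<^sub>R (a + c) = r *\<^sub>R a + r *\<^sub>R c" "(r + s) *\<^sub>R a = r *\<^sub>R a + s *\<^sub>R a"
    "r *\<^sub>R s *\<^sub>R a = (r * s) *\<^sub>R a" "1 *\<^sub>R a = a"
    by (transfer; simp add: algebra_simps)+
  show "(norm a = 0) = (a = 0)" "norm (a + c) \<le> norm a + norm c" "norm (r *\<^sub>R a) = \<bar>r\<bar> * norm a"
    "norm (a * c) \<le> norm a * norm c" "norm (1 :: 'a bop) = 1"
    by (transfer; simp add: norm_triangle_ineq norm_blinfun_compose)+
  show "a * c * d = a * (c * d)" "1 * a = a" "a * 1 = a"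
    "(a + c) * d = a * d + c * d" "a * (c + d) = a * c + a * d"
    "r *\<^sub>R a * c = r *\<^sub>R (a * c)" "a * r *\<^sub>R c = r *\<^sub>R (a * c)"
    by (transfer; auto intro!: blinfun_eqI simp: blinfun.bilinear_simps)+
  have "norm (1 :: 'a bop) \<noteq> norm (0 :: 'a bop)" by (transfer, simp)
  then show "(0 :: 'a bop) \<noteq> 1" by metis
qed (rule sgn_bop_def dist_bop_def uniformity_bop_def open_bop_def)+

end

instance bop :: ("{banach, perfect_space}") banach
proof
  fix X :: "nat \<Rightarrow> 'a bop"
  assume "Cauchy X"
  then have "Cauchy (\<lambda>n. blinfun_of_bop (X n))"
    unfolding Cauchy_def dist_norm by transfer
  then obtain L where "(\<lambda>n. blinfun_of_bop (X n)) \<longlonglongrightarrow> L"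
    using Cauchy_convergent convergent_def by blast
  then have "X \<longlonglongrightarrow> Bop L"
    unfolding tendsto_iff dist_norm norm_bop.rep_eq minus_bop.rep_eq by (simp add: Bop_inverse)
  then show "convergent X" by (rule convergentI)
qed

lemma bapp_simps [simp]:
  "bapp 0 x = 0" "bapp 1 x = x" "bapp (A + B) x = bapp A x + bapp B x"
  "bapp (A - B) x = bapp A x - bapp B x" "bapp (- A) x = - bapp A x"
  "bapp (A * B) x = bapp A (bapp B x)" "bapp (r *\<^sub>R A) x = r *\<^sub>R bapp A x"
  by (transfer; simp add: blinfun.bilinear_simps)+

lemma bounded_bilinear_bapp: "bounded_bilinear bapp"
proof (unfold_locales)
  show "\<exists>K. \<forall>a (x::'a). norm (bapp a x) \<le> norm a * norm x * K"
    by (rule exI[where x = 1], transfer) (use norm_blinfun in auto)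
qed (transfer; simp add: blinfun.bilinear_simps)+

lemmas bapp_bounded_linear_left = bounded_bilinear.bounded_linear_left[OF bounded_bilinear_bapp]
lemmas bapp_right_simps = bounded_bilinear.add_right[OF bounded_bilinear_bapp]
  bounded_bilinear.diff_right[OF bounded_bilinear_bapp]
  bounded_bilinear.scaleR_right[OF bounded_bilinear_bapp]

lemma norm_bapp: "norm (bapp A x) \<le> norm A * norm x"
  by transfer (rule norm_blinfun)

lemma bop_eqI: "(\<And>x. bapp A x = bapp B x) \<Longrightarrow> A = B"
  by transfer (rule blinfun_eqI)

lemma bapp_Bop: "bounded_linear f \<Longrightarrow> bapp (Bop (Blinfun f)) = f"
  by (simp add: bapp.rep_eq Bop_inverse bounded_linear_Blinfun_apply)

lemma norm_bop_le: "0 \<le> C \<Longrightarrow> (\<And>x. norm (bapp A x) \<le> C * norm x) \<Longrightarrow> norm A \<le> C"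
  by transfer (rule norm_blinfun_bound)

lemma exp_dissipative_split:
  fixes J :: "'b::{banach, perfect_space} bop"
  shows "exp (s *\<^sub>R (J - 1)) = exp (s *\<^sub>R J) * of_real (exp (- s))"
proof -
  have "exp (s *\<^sub>R (J - 1)) = exp (s *\<^sub>R J + of_real (- s))"
    by (simp add: scaleR_diff_right of_real_def)
  also have "\<dots> = exp (s *\<^sub>R J) * of_real (exp (- s))"
    by (subst exp_add_commuting) (simp_all only: exp_of_real, simp add: of_real_def)
  finally show ?thesis .
qed

text \<open>Estimating through the norm of \<open>J - 1\<close> would give exponential growth.
  Splitting off the scalar \<open>exp (- s)\<close> compensates the bound \<open>exp s\<close> for
  the remaining factor exactly.\<close>

lemma norm_exp_dissipative:
  fixes J :: "'b::{banach, perfect_space} bop"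
  assumes J: "norm J \<le> 1" and s: "0 \<le> s"
  shows "norm (exp (s *\<^sub>R (J - 1))) \<le> 1"
proof -
  have "norm (exp (s *\<^sub>R (J - 1))) \<le> norm (exp (s *\<^sub>R J)) * norm (of_real (exp (- s)) :: 'b bop)"
    unfolding exp_dissipative_split by (rule norm_mult_ineq)
  also have "\<dots> \<le> exp (norm (s *\<^sub>R J)) * exp (- s)"
    by (intro mult_mono norm_exp) auto
  also have "\<dots> \<le> exp s * exp (- s)"
    using J s by (simp add: mult_left_le)
  finally show ?thesis by (simp add: exp_minus)
qed

text \<open>The exponential is a Poisson average of the powers of \<open>J\<close>.\<close>

lemma exp_dissipative_functional_bounds:
  fixes J :: "'b::{banach, perfect_space} bop" and h :: "'b \<Rightarrow> real"
  assumes h: "bounded_linear h" and s: "0 \<le> s"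
    and J: "\<And>k. 0 \<le> h (bapp (J ^ k) x)" "\<And>k. h (bapp (J ^ k) x) \<le> 1"
  shows "0 \<le> h (bapp (exp (s *\<^sub>R (J - 1))) x)" "h (bapp (exp (s *\<^sub>R (J - 1))) x) \<le> 1"
proof -
  interpret h: bounded_linear h by (rule h)
  have eq: "h (bapp (exp (s *\<^sub>R (J - 1))) x) = exp (- s) * h (bapp (exp (s *\<^sub>R J)) x)"
    by (simp add: exp_dissipative_split of_real_def bapp_right_simps h.scaleR)
  have "bounded_linear (\<lambda>A. h (bapp A x))"
    by (rule bounded_linear_compose[OF h bapp_bounded_linear_left])
  then have "(\<lambda>n. h (bapp ((s *\<^sub>R J) ^ n /\<^sub>R fact n) x)) sums h (bapp (exp (s *\<^sub>R J)) x)"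
    by (rule bounded_linear.sums[OF _ exp_converges])
  then have sums: "(\<lambda>n. s ^ n / fact n * h (bapp (J ^ n) x)) sums h (bapp (exp (s *\<^sub>R J)) x)"
    by (simp add: h.scaleR scaleR_power divide_inverse mult_ac)
  have es: "(\<lambda>n. s ^ n / fact n) sums exp s"
    using exp_converges[of s] by (simp add: divide_inverse mult_ac)
  have "0 \<le> h (bapp (exp (s *\<^sub>R J)) x)"
    by (rule sums_le[OF _ sums_zero sums]) (use s J in auto)
  moreover have "h (bapp (exp (s *\<^sub>R J)) x) \<le> exp s"
  proof (rule sums_le[OF _ sums es])
    show "s ^ n / fact n * h (bapp (J ^ n) x) \<le> s ^ n / fact n" for n
      using s J(2)[of n] by (intro mult_right_le_one_le[THEN order_trans] order_refl) (use J(1) in auto)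
  qed
  ultimately show "0 \<le> h (bapp (exp (s *\<^sub>R (J - 1))) x)" "h (bapp (exp (s *\<^sub>R (J - 1))) x) \<le> 1"
    unfolding eq by (simp_all add: exp_minus field_simps)
qed

lemma exp_commute:
  fixes A B :: "'b::{real_normed_algebra_1, banach}"
  assumes "A * B = B * A" shows "exp A * B = B * exp A"
proof -
  have p: "A ^ n * B = B * A ^ n" for n
    by (induction n) (simp_all add: assms mult.assoc power_commutes, metis assms mult.assoc)
  have "(\<lambda>n. (A ^ n /\<^sub>R fact n) * B) sums (exp A * B)"
    by (rule bounded_linear.sums[OF bounded_linear_mult_left exp_converges])
  moreover have "(\<lambda>n. B * (A ^ n /\<^sub>R fact n)) sums (B * exp A)"
    by (rule bounded_linear.sums[OF bounded_linear_mult_right exp_converges])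
  ultimately show ?thesis using p by (simp add: sums_unique2)
qed

text \<open>Interpolate by \<open>exp (s *\<^sub>R A) * exp ((t - s) *\<^sub>R B)\<close> and
  differentiate in \<open>s\<close>. Commutation moves \<open>A - B\<close> to the far right, so
  only its value at \<open>x\<close> enters; this is essential for approximations that converge
  pointwise but not in operator norm.\<close>

lemma exp_diff_bound:
  fixes A B :: "'b::{banach, perfect_space} bop"
  assumes comm: "A * B = B * A" and t: "0 \<le> t"
    and A: "\<And>s. 0 \<le> s \<Longrightarrow> norm (exp (s *\<^sub>R A)) \<le> 1" and B: "\<And>s. 0 \<le> s \<Longrightarrow> norm (exp (s *\<^sub>R B)) \<le> 1"
  shows "norm (bapp (exp (t *\<^sub>R A)) x - bapp (exp (t *\<^sub>R B)) x) \<le> t * norm (bapp A x - bapp B x)"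
proof (cases "t = 0")
  case False
  with t have t: "0 < t" by simp
  define F where "F s = exp (s *\<^sub>R A) * exp ((t - s) *\<^sub>R B)" for s
  define F' where "F' s = exp (s *\<^sub>R A) * exp ((t - s) *\<^sub>R B) * (A - B)" for s
  have der: "(F has_vector_derivative F' s) (at s)" for s
  proof -
    have 1: "((\<lambda>s. exp ((t - s) *\<^sub>R B)) has_vector_derivative (- 1) *\<^sub>R (exp ((t - s) *\<^sub>R B) * B)) (at s)"
      by (rule vector_diff_chain_at[where f = "\<lambda>s. t - s" and g = "\<lambda>s. exp (s *\<^sub>R B)", unfolded o_def])
        (auto intro!: derivative_eq_intros exp_scaleR_has_vector_derivative_right)
    have "(F has_vector_derivative exp (s *\<^sub>R A) * ((- 1) *\<^sub>R (exp ((t - s) *\<^sub>R B) * B)) +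
        (exp (s *\<^sub>R A) * A) * exp ((t - s) *\<^sub>R B)) (at s)"
      unfolding F_def
      by (rule has_vector_derivative_mult[OF exp_scaleR_has_vector_derivative_right 1])
    moreover have "A * exp ((t - s) *\<^sub>R B) = exp ((t - s) *\<^sub>R B) * A"
      by (rule exp_commute[symmetric]) (simp add: comm)
    ultimately show ?thesis by (simp add: F'_def algebra_simps)
  qed
  have der': "((\<lambda>s. bapp (F s) x) has_vector_derivative bapp (F' s) x) (at s)" for s
    using bounded_linear.has_vector_derivative[OF bapp_bounded_linear_left der] .
  have "norm (bapp (F t) x - bapp (F 0) x) \<le>
      t * norm (bapp A x - bapp B x) - 0 * norm (bapp A x - bapp B x)"
  proof (rule differentiable_bound_general[OF t, where f' = "\<lambda>s. bapp (F' s) x" and \<phi>' = "\<lambda>_. norm (bapp A x - bapp B x)"])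
    show "continuous_on {0..t} (\<lambda>s. bapp (F s) x)"
      by (rule continuous_at_imp_continuous_on) (use der' has_vector_derivative_continuous in blast)
    show "continuous_on {0..t} (\<lambda>s. s * norm (bapp A x - bapp B x))" by (intro continuous_intros)
    fix s assume s: "0 < s" "s < t"
    show "((\<lambda>s. bapp (F s) x) has_vector_derivative bapp (F' s) x) (at s)" by (rule der')
    show "((\<lambda>s. s * norm (bapp A x - bapp B x)) has_vector_derivative norm (bapp A x - bapp B x)) (at s)"
      by (auto intro!: derivative_eq_intros)
    have "norm (bapp (F' s) x) \<le> norm (exp (s *\<^sub>R A)) * (norm (exp ((t - s) *\<^sub>R B)) * norm (bapp (A - B) x))"
      unfolding F'_def bapp_simps by (meson norm_bapp mult_left_mono norm_ge_zero order_trans)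
    also have "\<dots> \<le> 1 * (1 * norm (bapp (A - B) x))"
      using s by (intro mult_mono A B) auto
    finally show "norm (bapp (F' s) x) \<le> norm (bapp A x - bapp B x)" by simp
  qed
  then show ?thesis by (simp add: F_def)
qed simp

section \<open>The Hille-Yosida theorem for contraction semigroups\<close>

text \<open>Boundedness is demanded for each time separately; a bound uniform near 0 is a
  consequence, derived in \<open>c0_sg_locally_bounded\<close>.\<close>

definition c0_sg :: "(real \<Rightarrow> 'b::real_normed_vector \<Rightarrow> 'b) \<Rightarrow> bool" where
  "c0_sg T \<longleftrightarrow> (\<forall>t\<ge>0. bounded_linear (T t)) \<and> (\<forall>x. T 0 x = x) \<and>
     (\<forall>s\<ge>0. \<forall>t\<ge>0. \<forall>x. T (s + t) x = T s (T t x)) \<and>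
     (\<forall>x. ((\<lambda>t. T t x) \<longlongrightarrow> x) (at_right 0))"

definition sg_gen :: "(real \<Rightarrow> 'b::real_normed_vector \<Rightarrow> 'b) \<Rightarrow> ('b \<times> 'b) set" where
  "sg_gen T = {(x, y). ((\<lambda>t. (T t x - x) /\<^sub>R t) \<longlongrightarrow> y) (at_right 0)}"

lemma dense_tendsto:
  fixes F :: "'c \<Rightarrow> 'b::real_normed_vector \<Rightarrow> 'b"
  assumes D: "closure D = UNIV" and lim: "\<And>x. x \<in> D \<Longrightarrow> ((\<lambda>t. F t x) \<longlongrightarrow> x) Fl"
    and con: "eventually (\<lambda>t. \<forall>x y. norm (F t x - F t y) \<le> norm (x - y)) Fl"
  shows "((\<lambda>t. F t z) \<longlongrightarrow> z) Fl"
proof (rule tendstoI)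
  fix e :: real assume e: "0 < e"
  have "z \<in> closure D" using D by simp
  then obtain x where x: "x \<in> D" "dist x z < e/3" using e by (auto simp: closure_approachable dest!: spec[of _ "e/3"])
  have "eventually (\<lambda>t. dist (F t x) x < e/3) Fl" using lim[OF x(1)] e by (intro tendstoD) auto
  then show "eventually (\<lambda>t. dist (F t z) z < e) Fl"
    using con
  proof eventually_elim
    case (elim t)
    have "dist (F t z) (F t x) \<le> dist z x" using elim(2) by (simp add: dist_norm)
    then show ?case
      using x(2) elim(1) dist_triangle[of "F t z" z "F t x"] dist_triangle[of "F t x" z x] dist_commute[of z x] by linarith
  qed
qed

lemma dense_convergent:
  fixes F :: "nat \<Rightarrow> 'b::{banach, perfect_space} bop"
  assumes D: "closure D = UNIV" and con: "\<And>x. x \<in> D \<Longrightarrow> convergent (\<lambda>n. bapp (F n) x)"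
    and F: "\<And>n. norm (F n) \<le> 1"
  shows "convergent (\<lambda>n. bapp (F n) z)"
proof -
  have F': "dist (bapp (F n) x) (bapp (F n) y) \<le> dist x y" for n x y
    using norm_bapp[of "F n" "x - y"] mult_right_mono[OF F[of n], of "norm (x - y)"]
    by (simp add: dist_norm bapp_right_simps)
  have "Cauchy (\<lambda>n. bapp (F n) z)"
  proof (rule metric_CauchyI)
    fix e :: real assume e: "0 < e"
    have "z \<in> closure D" using D by simp
    then obtain x where x: "x \<in> D" "dist x z < e/3" using e by (auto simp: closure_approachable dest!: spec[of _ "e/3"])
    obtain N where N: "\<And>i j. i \<ge> N \<Longrightarrow> j \<ge> N \<Longrightarrow> dist (bapp (F i) x) (bapp (F j) x) < e/3"
      using con[OF x(1)] e unfolding Cauchy_convergent_iff[symmetric] by (metis metric_CauchyD zero_less_divide_iff zero_less_numeral)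
    have "dist (bapp (F i) z) (bapp (F j) z) < e" if "i \<ge> N" "j \<ge> N" for i j
      using N[OF that] F'[of i x z] F'[of j x z] x(2)
        dist_triangle[of "bapp (F i) z" "bapp (F j) z" "bapp (F i) x"]
        dist_triangle[of "bapp (F i) x" "bapp (F j) z" "bapp (F j) x"]
        dist_commute[of "bapp (F i) z" "bapp (F i) x"] by linarith
    then show "\<exists>M. \<forall>i\<ge>M. \<forall>j\<ge>M. dist (bapp (F i) z) (bapp (F j) z) < e" by blast
  qed
  then show ?thesis by (simp add: Cauchy_convergent_iff)
qed

text \<open>To first order \<open>T t z\<close> is \<open>(1 + t) *\<^sub>R z\<close>, which would
  have larger norm than \<open>z\<close>. This limits how far the generator of a contraction
  semigroup can extend a given operator.\<close>

lemma contraction_sg_fixed_zero: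
  assumes T: "\<And>t. 0 \<le> t \<Longrightarrow> norm (T t z) \<le> norm z" and gen: "(z, z) \<in> sg_gen T"
  shows "z = 0"
proof -
  have lim: "((\<lambda>t. norm ((T t z - z) /\<^sub>R t - z)) \<longlongrightarrow> 0) (at_right 0)"
    using gen unfolding sg_gen_def by (auto simp: LIM_zero_iff tendsto_norm_zero_iff)
  have "norm z \<le> 0"
  proof (rule tendsto_lowerbound[OF lim])
    have "norm z \<le> norm ((T t z - z) /\<^sub>R t - z)" if t: "0 < t" for t
    proof -
      have "T t z = t *\<^sub>R ((T t z - z) /\<^sub>R t - z) + (1 + t) *\<^sub>R z"
        using t by (simp add: algebra_simps)
      then have "norm ((1 + t) *\<^sub>R z) = norm (T t z - t *\<^sub>R ((T t z - z) /\<^sub>R t - z))"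
        by (metis add_diff_cancel_left')
      also have "\<dots> \<le> norm (T t z) + t * norm ((T t z - z) /\<^sub>R t - z)"
        using norm_triangle_ineq4[of "T t z" "t *\<^sub>R ((T t z - z) /\<^sub>R t - z)"] t by simp
      also have "\<dots> \<le> norm z + t * norm ((T t z - z) /\<^sub>R t - z)" using T t by simp
      finally have "(1 + t) * norm z \<le> norm z + t * norm ((T t z - z) /\<^sub>R t - z)"
        using t by simp
      then have "t * norm z \<le> t * norm ((T t z - z) /\<^sub>R t - z)" by (simp only: distrib_right)
      then show ?thesis using t by simp
    qed
    then show "eventually (\<lambda>t. norm z \<le> norm ((T t z - z) /\<^sub>R t - z)) (at_right 0)"
      by (auto simp: eventually_at_right_less intro: eventually_mono[OF eventually_at_right_less])
  qed simp
  then show ?thesis by simp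
qed

text \<open>The hypotheses of the Lumer-Phillips theorem for an operator given as a linear relation.
  Dissipativity makes the resolvents single-valued contractions, and \<open>range\<close> makes them
  everywhere defined.\<close>

locale mdissipative =
  fixes A :: "('b::{banach, perfect_space} \<times> 'b) set"
  assumes lin: "subspace A"
    and diss: "\<And>x y l. (x, y) \<in> A \<Longrightarrow> 0 < l \<Longrightarrow> norm x \<le> norm (x - l *\<^sub>R y)"
    and range: "\<And>l f. 0 < l \<Longrightarrow> \<exists>x y. (x, y) \<in> A \<and> x - l *\<^sub>R y = f"
    and dense: "closure (Domain A) = UNIV"
begin

definition res :: "real \<Rightarrow> 'b \<Rightarrow> 'b" where
  "res l f = (THE x. \<exists>y. (x, y) \<in> A \<and> x - l *\<^sub>R y = f)"

lemma A_unique: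
  assumes "(x, y) \<in> A" "(x', y') \<in> A" "0 < l" "x - l *\<^sub>R y = x' - l *\<^sub>R y'" shows "x = x'"
proof -
  have "(x, y) - (x', y') \<in> A" by (intro subspace_diff lin assms)
  then have "norm (x - x') \<le> norm ((x - x') - l *\<^sub>R (y - y'))" using assms(3) by (intro diss) auto
  also have "(x - x') - l *\<^sub>R (y - y') = 0" using assms(4) by (simp add: algebra_simps)
  finally show ?thesis by simp
qed

lemma res_eq: assumes "(x, y) \<in> A" "0 < l" shows "res l (x - l *\<^sub>R y) = x"
  unfolding res_def by (rule the_equality) (use assms A_unique in blast)+

lemma res_in: assumes "0 < l" shows "(res l f, (res l f - f) /\<^sub>R l) \<in> A"
proof -
  obtain x y where x: "(x, y) \<in> A" "x - l *\<^sub>R y = f" using range[OF assms] by blast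
  have r: "res l f = x" using res_eq[OF x(1) assms] x(2) by simp
  have "x - f = l *\<^sub>R y" using x(2) by (simp add: algebra_simps)
  then have "y = (x - f) /\<^sub>R l" using assms by simp
  then show ?thesis using x(1) r by metis
qed

lemma res_bounded_linear: assumes l: "0 < l" shows "bounded_linear (res l)"
proof (rule bounded_linear_intro[where K = 1])
  fix f g r
  have "(res l f, (res l f - f) /\<^sub>R l) + (res l g, (res l g - g) /\<^sub>R l) \<in> A"
    by (intro subspace_add lin res_in l)
  then have "(res l f + res l g, (res l f - f) /\<^sub>R l + (res l g - g) /\<^sub>R l) \<in> A" by simp
  from res_eq[OF this l] show "res l (f + g) = res l f + res l g"
    using l by (simp add: algebra_simps)
  have "r *\<^sub>R (res l f, (res l f - f) /\<^sub>R l) \<in> A"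
    by (intro subspace_scale lin res_in l)
  then have "(r *\<^sub>R res l f, r *\<^sub>R ((res l f - f) /\<^sub>R l)) \<in> A" by simp
  note eq = res_eq[OF this l]
  have "l *\<^sub>R (r *\<^sub>R ((res l f - f) /\<^sub>R l)) = r *\<^sub>R (res l f - f)" using l by simp
  then show "res l (r *\<^sub>R f) = r *\<^sub>R res l f"
    using eq by (simp only: scaleR_diff_right) simp
  show "norm (res l f) \<le> norm f * 1"
    using diss[OF res_in[OF l, of f] l] l by simp
qed

definition J :: "real \<Rightarrow> 'b bop" where "J l = Bop (Blinfun (res l))"

lemma bapp_J: "0 < l \<Longrightarrow> bapp (J l) = res l"
  unfolding J_def by (rule bapp_Bop[OF res_bounded_linear])

lemma norm_res: "0 < l \<Longrightarrow> norm (res l f) \<le> norm f"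
  using diss[OF res_in[of l f], of l] by simp

lemma norm_J: "0 < l \<Longrightarrow> norm (J l) \<le> 1"
  by (rule norm_bop_le) (auto simp: bapp_J norm_res)

text \<open>For \<open>w = res l (res k f)\<close> the image \<open>Aw\<close> is a multiple of a
  difference of two domain elements, so it lies in the domain itself. Hence
  \<open>w - k *\<^sub>R Aw\<close> is in the domain and solves the equation that characterizes
  \<open>res l f\<close>.\<close>

lemma res_commute:
  assumes l: "0 < l" and k: "0 < k" shows "res l (res k f) = res k (res l f)"
proof -
  define u where "u = res k f" define w where "w = res l u"
  define Au where "Au = (u - f) /\<^sub>R k" define Aw where "Aw = (w - u) /\<^sub>R l"
  have u: "(u, Au) \<in> A" unfolding u_def Au_def by (rule res_in[OF k])
  have w: "(w, Aw) \<in> A" unfolding w_def Aw_def by (rule res_in[OF l])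
  have f: "f = u - k *\<^sub>R Au" and u_eq: "u = w - l *\<^sub>R Aw" using l k by (simp_all add: Au_def Aw_def)
  have "(1 / l) *\<^sub>R ((w, Aw) - (u, Au)) \<in> A" by (intro subspace_scale subspace_diff lin u w)
  then have "(Aw, (1 / l) *\<^sub>R (Aw - Au)) \<in> A" by (simp add: Aw_def divide_inverse)
  then have "(w, Aw) - k *\<^sub>R (Aw, (1 / l) *\<^sub>R (Aw - Au)) \<in> A" by (intro subspace_diff subspace_scale lin w)
  then have in_A: "(w - k *\<^sub>R Aw, Aw - (k / l) *\<^sub>R (Aw - Au)) \<in> A" by simp
  have "res l (w - k *\<^sub>R Aw - l *\<^sub>R (Aw - (k / l) *\<^sub>R (Aw - Au))) = w - k *\<^sub>R Aw"
    by (rule res_eq[OF in_A l])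
  moreover have "w - k *\<^sub>R Aw - l *\<^sub>R (Aw - (k / l) *\<^sub>R (Aw - Au)) = f"
    unfolding f u_eq using l by (simp add: algebra_simps u_eq)
  ultimately have "res l f = w - k *\<^sub>R Aw" by simp
  then show ?thesis using res_eq[OF w k] by (simp add: w_def u_def)
qed

text \<open>On the domain \<open>res l x - x\<close> equals \<open>l *\<^sub>R res l y\<close>, of
  norm at most \<open>l * norm y\<close>; contractivity extends the convergence to the
  closure.\<close>

lemma res_tendsto: "((\<lambda>l. res l z) \<longlongrightarrow> z) (at_right 0)"
proof (rule dense_tendsto[OF dense])
  fix x assume "x \<in> Domain A"
  then obtain y where xy: "(x, y) \<in> A" by auto
  have "norm (res l x - x) \<le> l * norm y" if l: "0 < l" for l
  proof -
    have "res l (x - (x - l *\<^sub>R y)) = res l x - x"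
      using linear_diff[OF bounded_linear.linear[OF res_bounded_linear[OF l]]] res_eq[OF xy l] by metis
    then have "res l x - x = res l (l *\<^sub>R y)" by simp
    then show ?thesis using norm_res[OF l, of "l *\<^sub>R y"] l by simp
  qed
  then have "eventually (\<lambda>l. norm (res l x - x) \<le> l * norm y) (at_right 0)"
    by (auto intro: eventually_mono[OF eventually_at_right_less])
  moreover have "((\<lambda>l. l * norm y) \<longlongrightarrow> 0) (at_right 0)"
    by (auto intro!: tendsto_eq_intros)
  ultimately have "((\<lambda>l. res l x - x) \<longlongrightarrow> 0) (at_right 0)" by (rule Lim_null_comparison)
  then show "((\<lambda>l. res l x) \<longlongrightarrow> x) (at_right 0)" by (simp add: LIM_zero_iff)
next
  have "norm (res l x - res l y) \<le> norm (x - y)" if "0 < l" for l x y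
    using norm_res[OF that, of "x - y"] linear_diff[OF bounded_linear.linear[OF res_bounded_linear[OF that]]] by metis
  then show "eventually (\<lambda>l. \<forall>x y. norm (res l x - res l y) \<le> norm (x - y)) (at_right 0)"
    by (auto intro: eventually_mono[OF eventually_at_right_less])
qed

text \<open>The bounded Yosida approximation \<open>(J l - 1) /\<^sub>R l\<close> at
  \<open>l = 1 / Suc n\<close>; the shift keeps the parameter positive for every
  \<open>n\<close>.\<close>

definition yosida :: "nat \<Rightarrow> 'b bop" where
  "yosida n = real (Suc n) *\<^sub>R (J (1 / real (Suc n)) - 1)"

definition ysg :: "nat \<Rightarrow> real \<Rightarrow> 'b \<Rightarrow> 'b" where
  "ysg n t = bapp (exp (t *\<^sub>R yosida n))"

lemma exp_yosida: "exp (t *\<^sub>R yosida n) = exp ((t * real (Suc n)) *\<^sub>R (J (1 / real (Suc n)) - 1))"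
  by (simp add: yosida_def)

lemma norm_exp_yosida: "0 \<le> t \<Longrightarrow> norm (exp (t *\<^sub>R yosida n)) \<le> 1"
  unfolding exp_yosida by (rule norm_exp_dissipative) (auto intro: norm_J)

lemma norm_ysg: "0 \<le> t \<Longrightarrow> norm (ysg n t x) \<le> norm x"
  unfolding ysg_def
  by (rule order_trans[OF norm_bapp]) (use norm_exp_yosida in \<open>auto intro!: mult_left_le_one_le\<close>)

lemma yosida_commute: "yosida i * yosida j = yosida j * yosida i"
proof -
  have "J (1 / real (Suc i)) * J (1 / real (Suc j)) = J (1 / real (Suc j)) * J (1 / real (Suc i))"
    by (rule bop_eqI) (simp add: bapp_J res_commute)
  then show ?thesis by (simp add: yosida_def algebra_simps)
qed

lemma ysg_diff: "0 \<le> t \<Longrightarrow> norm (ysg i t x - ysg j t x) \<le> t * norm (bapp (yosida i) x - bapp (yosida j) x)"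
  unfolding ysg_def by (intro exp_diff_bound yosida_commute norm_exp_yosida)

text \<open>On the domain the approximation is the resolvent applied to the image \<open>y\<close>,
  so the claim reduces to \<open>res_tendsto\<close>.\<close>

lemma yosida_tendsto:
  assumes "(x, y) \<in> A" shows "(\<lambda>n. bapp (yosida n) x) \<longlonglongrightarrow> y"
proof -
  have "bapp (yosida n) x = res (1 / real (Suc n)) y" for n
  proof -
    let ?l = "1 / real (Suc n)"
    have l: "0 < ?l" by simp
    have "res ?l (x - (x - ?l *\<^sub>R y)) = res ?l x - x"
      using linear_diff[OF bounded_linear.linear[OF res_bounded_linear[OF l]]] res_eq[OF assms l] by metis
    then have "res ?l x - x = ?l *\<^sub>R res ?l y"
      using linear_scale[OF bounded_linear.linear[OF res_bounded_linear[OF l]]] by simp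
    then show ?thesis by (simp add: yosida_def bapp_J del: of_nat_Suc)
  qed
  moreover have "filterlim (\<lambda>n. 1 / real (Suc n)) (at_right 0) sequentially"
    unfolding filterlim_at
    using LIMSEQ_inverse_real_of_nat by (auto simp: divide_inverse)
  ultimately show ?thesis using filterlim_compose[OF res_tendsto] by simp
qed

lemma ysg_convergent: assumes "0 \<le> t" shows "convergent (\<lambda>n. ysg n t z)"
  unfolding ysg_def
proof (rule dense_convergent[OF dense])
  fix x assume "x \<in> Domain A"
  then obtain y where xy: "(x, y) \<in> A" by auto
  have C: "Cauchy (\<lambda>n. bapp (yosida n) x)" using yosida_tendsto[OF xy] by (rule LIMSEQ_imp_Cauchy)
  have "Cauchy (\<lambda>n. ysg n t x)"
  proof (rule metric_CauchyI)
    fix e :: real assume e: "0 < e"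
    \<comment> \<open>The tolerance \<open>e / (t + 1)\<close> yields less than \<open>e\<close>
      after multiplication by \<open>t\<close> and stays meaningful for
      \<open>t = 0\<close>.\<close>
    obtain N where N: "\<And>i j. i \<ge> N \<Longrightarrow> j \<ge> N \<Longrightarrow> dist (bapp (yosida i) x) (bapp (yosida j) x) < e / (t + 1)"
      using metric_CauchyD[OF C, of "e / (t + 1)"] e assms by auto
    have "dist (ysg i t x) (ysg j t x) < e" if "i \<ge> N" "j \<ge> N" for i j
    proof -
      have "dist (ysg i t x) (ysg j t x) \<le> t * dist (bapp (yosida i) x) (bapp (yosida j) x)"
        using ysg_diff[OF assms] by (simp add: dist_norm)
      also have "\<dots> \<le> t * (e / (t + 1))" using N[OF that] assms by (intro mult_left_mono) auto
      also have "\<dots> < e" using assms e by (simp add: field_simps)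
      finally show ?thesis .
    qed
    then show "\<exists>M. \<forall>i\<ge>M. \<forall>j\<ge>M. dist (ysg i t x) (ysg j t x) < e" by blast
  qed
  then show "convergent (\<lambda>n. bapp (exp (t *\<^sub>R yosida n)) x)"
    by (simp add: Cauchy_convergent_iff ysg_def)
qed (use norm_exp_yosida assms in auto)

definition sg :: "real \<Rightarrow> 'b \<Rightarrow> 'b" where "sg t x = lim (\<lambda>n. ysg n t x)"

lemma ysg_tendsto: "0 \<le> t \<Longrightarrow> (\<lambda>n. ysg n t x) \<longlonglongrightarrow> sg t x"
  using ysg_convergent convergent_LIMSEQ_iff by (auto simp: sg_def)

lemma norm_sg: "0 \<le> t \<Longrightarrow> norm (sg t x) \<le> norm x"
  by (rule tendsto_upperbound[OF tendsto_norm[OF ysg_tendsto]]) (use norm_ysg in auto)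

lemma sg_bounded_linear: assumes t: "0 \<le> t" shows "bounded_linear (sg t)"
proof (rule bounded_linear_intro[where K = 1])
  fix x y r
  have "(\<lambda>n. ysg n t x + ysg n t y) \<longlonglongrightarrow> sg t x + sg t y" by (intro tendsto_add ysg_tendsto t)
  then show "sg t (x + y) = sg t x + sg t y"
    using LIMSEQ_unique ysg_tendsto[OF t, of "x + y"] by (simp add: ysg_def bapp_right_simps)
  have "(\<lambda>n. r *\<^sub>R ysg n t x) \<longlonglongrightarrow> r *\<^sub>R sg t x" by (intro tendsto_scaleR tendsto_const ysg_tendsto t)
  then show "sg t (r *\<^sub>R x) = r *\<^sub>R sg t x"
    using LIMSEQ_unique ysg_tendsto[OF t, of "r *\<^sub>R x"] by (simp add: ysg_def bapp_right_simps)
  show "norm (sg t x) \<le> norm x * 1" using norm_sg[OF t] by simp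
qed

lemma sg_add: assumes s: "0 \<le> s" and t: "0 \<le> t" shows "sg (s + t) x = sg s (sg t x)"
proof -
  have "ysg n (s + t) x = ysg n s (ysg n t x)" for n
    unfolding ysg_def by (simp add: scaleR_add_left exp_add_commuting)
  then have 1: "(\<lambda>n. ysg n s (ysg n t x)) \<longlonglongrightarrow> sg (s + t) x" using ysg_tendsto[of "s + t" x] s t by simp
  have "(\<lambda>n. ysg n s (ysg n t x - sg t x)) \<longlonglongrightarrow> 0"
  proof (rule Lim_null_comparison)
    show "(\<lambda>n. norm (ysg n t x - sg t x)) \<longlonglongrightarrow> 0"
      using ysg_tendsto[OF t, of x] by (simp add: LIM_zero_iff tendsto_norm_zero_iff)
  qed (use norm_ysg s in auto)
  then have "(\<lambda>n. ysg n s (ysg n t x - sg t x) + ysg n s (sg t x)) \<longlonglongrightarrow> 0 + sg s (sg t x)"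
    by (intro tendsto_add ysg_tendsto s)
  then have "(\<lambda>n. ysg n s (ysg n t x)) \<longlonglongrightarrow> sg s (sg t x)" by (simp add: ysg_def bapp_right_simps)
  then show ?thesis using 1 LIMSEQ_unique by blast
qed

text \<open>This comparison yields the derivative of \<open>sg\<close> at \<open>0\<close> without vector-valued integrals.\<close>

lemma sg_ysg_diff:
  assumes "(x, y) \<in> A" "0 \<le> t" shows "norm (sg t x - ysg n t x) \<le> t * norm (y - bapp (yosida n) x)"
proof (rule tendsto_le[OF trivial_limit_sequentially])
  show "(\<lambda>i. norm (ysg i t x - ysg n t x)) \<longlonglongrightarrow> norm (sg t x - ysg n t x)"
    by (intro tendsto_intros ysg_tendsto assms)
  show "(\<lambda>i. t * norm (bapp (yosida i) x - bapp (yosida n) x)) \<longlonglongrightarrow> t * norm (y - bapp (yosida n) x)"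
    by (intro tendsto_intros yosida_tendsto assms)
qed (use ysg_diff assms in auto)

text \<open>The difference quotients of \<open>sg\<close> and \<open>ysg n\<close> differ by at most
  \<open>norm (y - bapp (yosida n) x)\<close>, uniformly in the time. So \<open>n\<close> can be
  fixed before the time tends to 0, and \<open>ysg n\<close> is differentiable because its generator
  is bounded.\<close>

lemma sg_gen_subset: assumes xy: "(x, y) \<in> A" shows "(x, y) \<in> sg_gen sg"
proof -
  have "((\<lambda>t. (sg t x - x) /\<^sub>R t) \<longlongrightarrow> y) (at_right 0)"
  proof (rule tendstoI)
    fix e :: real assume e: "0 < e"
    have "eventually (\<lambda>n. dist (bapp (yosida n) x) y < e/3) sequentially"
      using yosida_tendsto[OF xy] e by (intro tendstoD) auto
    then obtain n where n: "norm (bapp (yosida n) x - y) < e/3"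
      by (auto simp: eventually_sequentially dist_norm)
    let ?y = "bapp (yosida n) x"
    have "((\<lambda>t. bapp (exp (t *\<^sub>R yosida n)) x) has_vector_derivative bapp (exp (0 *\<^sub>R yosida n) * yosida n) x) (at 0)"
      by (intro bounded_linear.has_vector_derivative[OF bapp_bounded_linear_left] exp_scaleR_has_vector_derivative_right)
    then have "((\<lambda>t. norm (ysg n t x - x - t *\<^sub>R ?y) / norm t) \<longlongrightarrow> 0) (at 0)"
      by (simp add: has_vector_derivative_def has_derivative_at ysg_def)
    moreover have "eventually (\<lambda>t. norm (ysg n t x - x - t *\<^sub>R ?y) / norm t = norm ((ysg n t x - x) /\<^sub>R t - ?y)) (at 0)"
      unfolding eventually_at_filter
    proof (intro always_eventually allI impI)
      fix t :: real assume "t \<noteq> 0"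
      then have "(ysg n t x - x) /\<^sub>R t - ?y = (ysg n t x - x - t *\<^sub>R ?y) /\<^sub>R t"
        by (simp add: scaleR_diff_right)
      then show "norm (ysg n t x - x - t *\<^sub>R ?y) / norm t = norm ((ysg n t x - x) /\<^sub>R t - ?y)"
        by (simp add: divide_inverse mult.commute)
    qed
    ultimately have "((\<lambda>t. norm ((ysg n t x - x) /\<^sub>R t - ?y)) \<longlongrightarrow> 0) (at 0)"
      by (simp add: tendsto_cong)
    then have "((\<lambda>t. (ysg n t x - x) /\<^sub>R t) \<longlongrightarrow> ?y) (at 0)"
      by (simp add: LIM_zero_iff tendsto_norm_zero_iff)
    then have "((\<lambda>t. (ysg n t x - x) /\<^sub>R t) \<longlongrightarrow> bapp (yosida n) x) (at_right 0)"
      by (rule tendsto_within_subset) auto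
    then have "eventually (\<lambda>t. dist ((ysg n t x - x) /\<^sub>R t) (bapp (yosida n) x) < e/3) (at_right 0)"
      using e by (intro tendstoD) auto
    then show "eventually (\<lambda>t. dist ((sg t x - x) /\<^sub>R t) y < e) (at_right 0)"
      using eventually_at_right_less
    proof eventually_elim
      case (elim t)
      have "(sg t x - x) /\<^sub>R t - y = (sg t x - ysg n t x) /\<^sub>R t + ((ysg n t x - x) /\<^sub>R t - bapp (yosida n) x)
          + (bapp (yosida n) x - y)"
        by (simp add: algebra_simps)
      also have "norm \<dots> \<le> norm ((sg t x - ysg n t x) /\<^sub>R t) + norm ((ysg n t x - x) /\<^sub>R t - bapp (yosida n) x)
          + norm (bapp (yosida n) x - y)"
        by (intro norm_triangle_le add_right_mono norm_triangle_ineq)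
      also have "norm ((sg t x - ysg n t x) /\<^sub>R t) \<le> norm (y - bapp (yosida n) x)"
        using sg_ysg_diff[OF xy, of t n] elim(2) unfolding norm_scaleR by (simp add: field_simps)
      finally show ?case using elim(1) n by (simp add: dist_norm norm_minus_commute)
    qed
  qed
  then show ?thesis by (simp add: sg_gen_def)
qed

lemma sg_tendsto: "((\<lambda>t. sg t z) \<longlongrightarrow> z) (at_right 0)"
proof (rule dense_tendsto[OF dense])
  fix x assume "x \<in> Domain A"
  then obtain y where "(x, y) \<in> A" by auto
  then have "((\<lambda>t. t *\<^sub>R ((sg t x - x) /\<^sub>R t)) \<longlongrightarrow> 0 *\<^sub>R y) (at_right 0)"
    using sg_gen_subset by (intro tendsto_scaleR) (auto simp: sg_gen_def)
  moreover have "eventually (\<lambda>t. t *\<^sub>R ((sg t x - x) /\<^sub>R t) = sg t x - x) (at_right 0)"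
    by (auto intro: eventually_mono[OF eventually_at_right_less])
  ultimately have "((\<lambda>t. sg t x - x) \<longlongrightarrow> 0) (at_right 0)" by (simp add: tendsto_cong)
  then show "((\<lambda>t. sg t x) \<longlongrightarrow> x) (at_right 0)" by (simp add: LIM_zero_iff)
next
  have "norm (sg l x - sg l y) \<le> norm (x - y)" if "0 < l" for l x y
    using norm_sg[of l "x - y"] linear_diff[OF bounded_linear.linear[OF sg_bounded_linear[of l]]] that by (metis less_imp_le)
  then show "eventually (\<lambda>l. \<forall>x y. norm (sg l x - sg l y) \<le> norm (x - y)) (at_right 0)"
    by (auto intro: eventually_mono[OF eventually_at_right_less])
qed

lemma c0_sg: "c0_sg sg"
proof -
  have "sg 0 x = x" for x
    using LIMSEQ_unique[OF ysg_tendsto[of 0 x]] by (simp add: ysg_def)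
  then show ?thesis unfolding c0_sg_def using sg_bounded_linear sg_add sg_tendsto by auto
qed

text \<open>The generator extends the relation. For the converse, surjectivity gives
  \<open>(u, v) \<in> A\<close> with \<open>u - v = x - y\<close>; then \<open>x - u\<close> is an
  eigenvector of the generator for the eigenvalue 1 and must vanish.\<close>

lemma sg_gen_sg: "sg_gen sg = A"
proof (intro set_eqI iffI)
  fix p assume "p \<in> sg_gen sg"
  then obtain x y where p: "p = (x, y)" and xy: "(x, y) \<in> sg_gen sg" by (cases p) auto
  obtain u v where uv: "(u, v) \<in> A" "u - 1 *\<^sub>R v = x - y" using range[of 1 "x - y"] by auto
  have "((\<lambda>t. (sg t x - x) /\<^sub>R t - (sg t u - u) /\<^sub>R t) \<longlongrightarrow> y - v) (at_right 0)"
    using xy sg_gen_subset[OF uv(1)] by (intro tendsto_diff) (auto simp: sg_gen_def)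
  moreover have "eventually (\<lambda>t. (sg t x - x) /\<^sub>R t - (sg t u - u) /\<^sub>R t = (sg t (x - u) - (x - u)) /\<^sub>R t) (at_right 0)"
  proof (rule eventually_mono[OF eventually_at_right_less])
    fix t :: real assume "0 < t"
    then have "sg t (x - u) = sg t x - sg t u" using linear_diff[OF bounded_linear.linear[OF sg_bounded_linear]] by simp
    then show "(sg t x - x) /\<^sub>R t - (sg t u - u) /\<^sub>R t = (sg t (x - u) - (x - u)) /\<^sub>R t"
      by (simp only:) (simp add: algebra_simps)
  qed
  ultimately have "((\<lambda>t. (sg t (x - u) - (x - u)) /\<^sub>R t) \<longlongrightarrow> y - v) (at_right 0)"
    by (simp add: tendsto_cong)
  moreover have yv: "y - v = x - u" using uv(2) by (simp add: algebra_simps)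
  ultimately have "(x - u, x - u) \<in> sg_gen sg" by (simp add: sg_gen_def)
  then have "x - u = 0" by (rule contraction_sg_fixed_zero[rotated]) (rule norm_sg)
  then show "p \<in> A" using uv(1) yv p by simp
qed (use sg_gen_subset in auto)

end

section \<open>Uniqueness of the semigroup with a given generator\<close>

text \<open>The closed sets on which all \<open>F n\<close> are bounded by a common integer cover
  the space, so by Baire one of them contains a ball.\<close>

lemma uniform_boundedness:
  fixes F :: "nat \<Rightarrow> 'b::banach \<Rightarrow> 'c::real_normed_vector"
  assumes lin: "\<And>n. bounded_linear (F n)" and bdd: "\<And>x. \<exists>C. \<forall>n. norm (F n x) \<le> C"
  obtains M where "\<And>n x. norm (F n x) \<le> M * norm x"
proof -
  define A where "A k = {x. \<forall>n. norm (F n x) \<le> real k}" for k :: nat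
  have clo: "closed (A k)" for k
  proof -
    have "A k = (\<Inter>n. {x. norm (F n x) \<le> real k})" by (auto simp: A_def)
    moreover have "closed {x. norm (F n x) \<le> real k}" for n
      by (intro closed_Collect_le continuous_intros linear_continuous_on lin)
    ultimately show ?thesis by auto
  qed
  have un: "(\<Union>k. A k) = UNIV"
  proof -
    have "x \<in> (\<Union>k. A k)" for x
    proof -
      obtain C where C: "\<And>n. norm (F n x) \<le> C" using bdd by blast
      obtain k where "C \<le> real k" using real_arch_simple by blast
      then have "x \<in> A k" unfolding A_def using C order_trans by blast
      then show ?thesis by auto
    qed
    then show ?thesis by auto
  qed
  have "\<exists>k. interior (A k) \<noteq> {}"
  proof (rule ccontr)
    assume "\<not> ?thesis"
    then have e: "interior (A k) = {}" for k by auto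
    have "euclidean interior_of \<Union>(range A) = {}"
    proof (rule Baire_category_alt)
      show "completely_metrizable_space (euclidean :: 'b topology) \<or>
          locally_compact_space (euclidean :: 'b topology) \<and> regular_space (euclidean :: 'b topology)"
        using completely_metrizable_space_euclidean by blast
      show "closedin euclidean T \<and> euclidean interior_of T = {}" if "T \<in> range A" for T
        using that clo e by (auto simp: closed_closedin[symmetric])
    qed simp
    then show False using un by simp
  qed
  then obtain k x0 where "x0 \<in> interior (A k)" by auto
  then obtain e where e: "0 < e" "ball x0 e \<subseteq> A k" by (meson mem_interior)
  \<comment> \<open>A displacement of length \<open>e / 2\<close> is the difference of two points of
    the ball, so its image has norm at most \<open>2 * real k\<close>; rescaling gives the factor
    4.\<close>
  have "norm (F n x) \<le> (4 * real k / e) * norm x" for n x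
  proof (cases "x = 0")
    case True then show ?thesis using linear_0[OF bounded_linear.linear[OF lin]] by simp
  next
    case False
    let ?c = "e / 2 / norm x"
    have "x0 + ?c *\<^sub>R x \<in> A k" "x0 \<in> A k"
      using e(1) False by (auto intro!: subsetD[OF e(2)] simp: dist_norm)
    then have "norm (F n (x0 + ?c *\<^sub>R x)) \<le> real k" "norm (F n x0) \<le> real k"
      by (auto simp: A_def)
    moreover have eq: "F n (x0 + ?c *\<^sub>R x) - F n x0 = ?c *\<^sub>R F n x"
      using lin[of n] by (simp add: linear_add linear_scale bounded_linear.linear)
    ultimately have "norm (?c *\<^sub>R F n x) \<le> 2 * real k"
      using norm_triangle_ineq4[of "F n (x0 + ?c *\<^sub>R x)" "F n x0"] unfolding eq by linarith
    then show ?thesis using e(1) False by (simp add: field_simps)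
  qed
  then show thesis by (rule that)
qed

text \<open>Otherwise there are times tending to 0 with operators of unbounded norm, although strong
  continuity bounds their values at each fixed vector, contradicting
  \<open>uniform_boundedness\<close>.\<close>

lemma c0_sg_locally_bounded:
  fixes S :: "real \<Rightarrow> 'b::banach \<Rightarrow> 'b"
  assumes S: "c0_sg S"
  obtains d M where "0 < d" "\<And>t x. 0 \<le> t \<Longrightarrow> t \<le> d \<Longrightarrow> norm (S t x) \<le> M * norm x"
proof (rule ccontr)
  note bound_thesis = that
  assume nthesis: "\<not> thesis"
  have no: "\<exists>t x. 0 \<le> t \<and> t \<le> d \<and> M * norm x < norm (S t x)" if "0 < d" for d M :: real
  proof (rule ccontr)
    assume "\<not> ?thesis"
    then have "norm (S t x) \<le> M * norm x" if "0 \<le> t" "t \<le> d" for t x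
      using that by (auto simp: not_less)
    from bound_thesis[OF \<open>0 < d\<close> this] show False using nthesis by blast
  qed
  have "\<forall>n. \<exists>t x. 0 \<le> t \<and> t \<le> inverse (real (Suc n)) \<and> real n * norm x < norm (S t x)"
    by (intro allI no) auto
  then obtain t x where tx: "\<And>n. 0 \<le> t n" "\<And>n. t n \<le> inverse (real (Suc n))" "\<And>n. real n * norm (x n) < norm (S (t n) (x n))"
    by metis
  have t0: "t \<longlonglongrightarrow> 0"
    by (rule tendsto_sandwich[OF _ _ tendsto_const LIMSEQ_inverse_real_of_nat]) (use tx in auto)
  have bl: "bounded_linear (S (t n))" for n using S tx(1) by (auto simp: c0_sg_def)
  have "(\<lambda>n. S (t n) y) \<longlonglongrightarrow> y" for y
  proof -
    \<comment> \<open>The times \<open>t n\<close> may equal 0, so convergence along them is drawn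
      from continuity within \<open>{0..}\<close>.\<close>
    have "continuous (at 0 within {0..}) (\<lambda>t. S t y)"
    proof -
      have "((\<lambda>t. S t y) \<longlongrightarrow> S 0 y) (at_right 0)" using S by (auto simp: c0_sg_def)
      moreover have "at 0 within {0..} = at_right (0::real)"
        unfolding at_within_def by (rule arg_cong2[where f = inf]) auto
      ultimately show ?thesis by (simp add: continuous_within)
    qed
    then have "(\<lambda>n. S (t n) y) \<longlonglongrightarrow> S 0 y"
      using t0 tx(1) by (intro continuous_within_tendsto_compose'[where S = "{0..}" and f = "\<lambda>t. S t y"]) auto
    then show ?thesis using S by (auto simp: c0_sg_def)
  qed
  then have "\<exists>C. \<forall>n. norm (S (t n) y) \<le> C" for y
    by (meson Bseq_def convergentI convergent_imp_Bseq)
  with bl obtain M where M: "\<And>n y. norm (S (t n) y) \<le> M * norm y"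
    by (rule uniform_boundedness) blast
  obtain n where "M \<le> real n" using real_arch_simple by blast
  then have "M * norm (x n) \<le> real n * norm (x n)" by (intro mult_right_mono) auto
  with M[of n "x n"] tx(3)[of n] show False by linarith
qed

context mdissipative
begin

text \<open>By the semigroup law \<open>S\<close> maps the graph of its generator into itself, so it
  commutes with resolvents, with \<open>ysg\<close> and with \<open>sg\<close>. Both semigroups are
  then compared over \<open>n\<close> equal short steps by telescoping, where only the derivatives
  at time 0 matter. Density extends the equality to all vectors, the semigroup law to all
  times.\<close>

lemma sg_unique:
  assumes S: "c0_sg S" and gen: "sg_gen S = A" and t: "0 \<le> t"
  shows "S t x = sg t x"
proof -
  have bl: "bounded_linear (S t)" if "0 \<le> t" for t using S that by (auto simp: c0_sg_def)
  have add: "S (s + t) x = S s (S t x)" if "0 \<le> s" "0 \<le> t" for s t x using S that by (auto simp: c0_sg_def)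
  have S_A: "(S t x, S t y) \<in> A" if xy: "(x, y) \<in> A" and t: "0 \<le> t" for t x y
  proof -
    have "((\<lambda>h. S t ((S h x - x) /\<^sub>R h)) \<longlongrightarrow> S t y) (at_right 0)"
      by (rule bounded_linear.tendsto[OF bl[OF t]]) (use xy gen in \<open>auto simp: sg_gen_def\<close>)
    moreover have "eventually (\<lambda>h. S t ((S h x - x) /\<^sub>R h) = (S h (S t x) - S t x) /\<^sub>R h) (at_right 0)"
    proof (rule eventually_mono[OF eventually_at_right_less])
      fix h :: real assume h: "0 < h"
      have "S t (S h x) = S h (S t x)" using add[of t h x] add[of h t x] t h by (simp add: add.commute)
      then show "S t ((S h x - x) /\<^sub>R h) = (S h (S t x) - S t x) /\<^sub>R h"
        using bl[OF t] by (simp add: linear_diff linear_scale bounded_linear.linear)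
    qed
    ultimately show ?thesis using gen by (auto simp: sg_gen_def tendsto_cong)
  qed
  have S_res: "res l (S t f) = S t (res l f)" if l: "0 < l" and t: "0 \<le> t" for l t f
  proof -
    note eq = res_eq[OF S_A[OF res_in[OF l, of f] t] l]
    have "S t (res l f) - l *\<^sub>R S t ((res l f - f) /\<^sub>R l) = S t (res l f - l *\<^sub>R ((res l f - f) /\<^sub>R l))"
      using bl[OF t] by (simp only: linear_diff linear_scale bounded_linear.linear)
    also have "res l f - l *\<^sub>R ((res l f - f) /\<^sub>R l) = f" using l by simp
    finally show ?thesis using eq by simp
  qed
  have S_ysg: "ysg n s (S t x) = S t (ysg n s x)" if t: "0 \<le> t" for n s t x
  proof -
    let ?S = "Bop (Blinfun (S t))"
    have S: "bapp ?S = S t" by (rule bapp_Bop[OF bl[OF t]])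
    have "J (1 / real (Suc n)) * ?S = ?S * J (1 / real (Suc n))"
      by (rule bop_eqI) (simp add: bapp_J S S_res[OF _ t] del: of_nat_Suc)
    then have "(s *\<^sub>R yosida n) * ?S = ?S * (s *\<^sub>R yosida n)"
      by (simp add: yosida_def algebra_simps)
    then have "bapp (exp (s *\<^sub>R yosida n) * ?S) x = bapp (?S * exp (s *\<^sub>R yosida n)) x"
      by (simp only: exp_commute)
    then show ?thesis by (simp add: S ysg_def)
  qed
  have S_sg: "sg s (S t x) = S t (sg s x)" if t: "0 \<le> t" and s: "0 \<le> s" for s t x
  proof -
    have "(\<lambda>n. S t (ysg n s x)) \<longlonglongrightarrow> S t (sg s x)"
      by (rule bounded_linear.tendsto[OF bl[OF t] ysg_tendsto[OF s]])
    moreover have "(\<lambda>n. S t (ysg n s x)) \<longlonglongrightarrow> sg s (S t x)"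
      using ysg_tendsto[OF s, of "S t x"] S_ysg[OF t] by simp
    ultimately show ?thesis using LIMSEQ_unique by blast
  qed
  obtain d M where d: "0 < d" "\<And>t x. 0 \<le> t \<Longrightarrow> t \<le> d \<Longrightarrow> norm (S t x) \<le> M * norm x"
    using c0_sg_locally_bounded[OF S] by metis
  \<comment> \<open>Every step costs a single factor \<open>M\<close>, since \<open>sg\<close>
    contracts and \<open>S\<close> is applied only at times up to \<open>d\<close>. The bound is
    therefore linear in \<open>k\<close> and not a power of \<open>M\<close>.\<close>
  have tele: "norm (S (real k * h) x - sg (real k * h) x) \<le> real k * M * norm (S h x - sg h x)"
    if h: "0 \<le> h" and k: "real k * h \<le> d" for k h x
    using k
  proof (induction k)
    case 0
    show ?case using S c0_sg by (simp add: c0_sg_def)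
  next
    case (Suc k)
    have kh: "0 \<le> real k * h" "real k * h \<le> d" using Suc.prems h by (auto simp: algebra_simps)
    have s: "real (Suc k) * h = real k * h + h" "real (Suc k) * h = h + real k * h" by (simp_all add: algebra_simps)
    have "S (real (Suc k) * h) x - sg (real (Suc k) * h) x =
        S (real k * h) (S h x) - sg h (sg (real k * h) x)"
      using add[OF kh(1) h] sg_add[OF h kh(1)] s by metis
    also have "\<dots> = S (real k * h) (S h x - sg h x) + sg h (S (real k * h) x - sg (real k * h) x)"
      using bl[OF kh(1)] sg_bounded_linear[OF h] S_sg[OF kh(1) h]
      by (simp add: linear_diff bounded_linear.linear)
    finally have "norm (S (real (Suc k) * h) x - sg (real (Suc k) * h) x) \<le>
        norm (S (real k * h) (S h x - sg h x)) + norm (sg h (S (real k * h) x - sg (real k * h) x))"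
      using norm_triangle_ineq by metis
    also have "\<dots> \<le> M * norm (S h x - sg h x) + norm (S (real k * h) x - sg (real k * h) x)"
      by (intro add_mono d kh norm_sg h)
    also have "\<dots> \<le> M * norm (S h x - sg h x) + real k * M * norm (S h x - sg h x)"
      using Suc.IH kh by auto
    finally show ?case by (simp add: algebra_simps)
  qed
  have dom: "S t x = sg t x" if t: "0 < t" "t \<le> d" and x: "x \<in> Domain A" for t x
  proof -
    obtain y where xy: "(x, y) \<in> A" using x by auto
    let ?D = "\<lambda>h. (S h x - x) /\<^sub>R h - (sg h x - x) /\<^sub>R h"
    have D: "(?D \<longlongrightarrow> y - y) (at_right 0)"
      using xy gen sg_gen_subset[OF xy] by (intro tendsto_diff) (auto simp: sg_gen_def)
    \<comment> \<open>With mesh \<open>t / Suc n\<close> the number of steps times the mesh stays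
      \<open>t\<close>, while the difference of the two quotients tends to
      \<open>y - y\<close>.\<close>
    have fl: "filterlim (\<lambda>n. t * inverse (real (Suc n))) (at_right 0) sequentially"
      unfolding filterlim_at using tendsto_mult[OF tendsto_const[of t] LIMSEQ_inverse_real_of_nat] t
      by (auto simp del: of_nat_Suc)
    have "(\<lambda>n. t * M * norm (?D (t * inverse (real (Suc n))))) \<longlonglongrightarrow> t * M * norm (y - y)"
      by (intro tendsto_intros filterlim_compose[OF D fl])
    moreover have "norm (S t x - sg t x) \<le> t * M * norm (?D (t * inverse (real (Suc n))))" for n
    proof -
      define h where "h = t * inverse (real (Suc n))"
      have h: "0 < h" using t by (simp add: h_def)
      have th: "real (Suc n) * h = t" by (simp add: h_def del: of_nat_Suc)
      have "norm (S t x - sg t x) \<le> real (Suc n) * M * norm (S h x - sg h x)"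
        using tele[of h "Suc n" x] h t unfolding th by simp
      also have "S h x - sg h x = h *\<^sub>R ?D h"
        using h by (simp add: scaleR_diff_right)
      also have "real (Suc n) * M * norm (h *\<^sub>R ?D h) = (real (Suc n) * h) * M * norm (?D h)"
        using h by simp
      finally show ?thesis unfolding th by (simp only: h_def)
    qed
    ultimately have "norm (S t x - sg t x) \<le> t * M * norm (y - y)"
      by (intro LIMSEQ_le_const) auto
    then show ?thesis by simp
  qed
  have small: "S t x = sg t x" if t: "0 \<le> t" "t \<le> d" for t x
  proof (cases "t = 0")
    case True then show ?thesis using S c0_sg by (simp add: c0_sg_def)
  next
    case False
    have "closed {x. S t x = sg t x}"
      using linear_continuous_on[OF bl] linear_continuous_on[OF sg_bounded_linear] t
      by (intro closed_Collect_eq) auto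
    moreover have "Domain A \<subseteq> {x. S t x = sg t x}" using dom[of t] t False by force
    ultimately show ?thesis using dense closure_minimal by (metis (mono_tags, lifting) UNIV_I mem_Collect_eq subsetD)
  qed
  obtain n where n: "t / d \<le> real n" using real_arch_simple by blast
  define h where "h = t / real (Suc n)"
  have h: "0 \<le> h" "h \<le> d"
  proof -
    show "0 \<le> h" using t by (simp add: h_def)
    have "t \<le> real n * d" using n d(1) by (simp add: field_simps)
    also have "\<dots> \<le> real (Suc n) * d" using d(1) by simp
    finally show "h \<le> d" by (simp add: h_def field_simps)
  qed
  have "S (real k * h) x = sg (real k * h) x" for k
  proof (induction k)
    case 0 show ?case using S c0_sg by (simp add: c0_sg_def)
  next
    case (Suc k)
    have s: "real (Suc k) * h = h + real k * h" by (simp add: algebra_simps)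
    show ?case unfolding s using add[of h "real k * h" x] sg_add[of h "real k * h" x] small[OF h] Suc h by simp
  qed
  from this[of "Suc n"] show ?thesis by (simp add: h_def del: of_nat_Suc)
qed

end

section \<open>The Hilbert space of square-summable functions\<close>

lemma summable_mult_square:
  fixes f g :: "'a \<Rightarrow> real"
  assumes "(\<lambda>x. (f x)\<^sup>2) summable_on S" "(\<lambda>x. (g x)\<^sup>2) summable_on S"
  shows "(\<lambda>x. f x * g x) summable_on S"
proof (rule iffD2[OF summable_on_iff_abs_summable_on_real], rule Infinite_Sum.abs_summable_on_comparison_test)
  show "(\<lambda>x. norm ((f x)\<^sup>2 + (g x)\<^sup>2)) summable_on S"
    using summable_on_add[OF assms] by simp
  show "norm (f x * g x) \<le> norm ((f x)\<^sup>2 + (g x)\<^sup>2)" for x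
    using sum_squares_bound[of "\<bar>f x\<bar>" "\<bar>g x\<bar>"] zero_le_power2[of "f x"] zero_le_power2[of "g x"]
      mult_nonneg_nonneg[OF abs_ge_zero[of "f x"] abs_ge_zero[of "g x"]]
    by (simp add: abs_mult del: mult_nonneg_nonneg)
qed

lemma summable_square_add:
  fixes f g :: "'a \<Rightarrow> real"
  assumes "(\<lambda>x. (f x)\<^sup>2) summable_on S" "(\<lambda>x. (g x)\<^sup>2) summable_on S"
  shows "(\<lambda>x. (f x + g x)\<^sup>2) summable_on S"
proof -
  have "(\<lambda>x. (f x)\<^sup>2 + (g x)\<^sup>2 + 2 * (f x * g x)) summable_on S"
    by (intro summable_on_add summable_on_cmult_right summable_mult_square assms)
  then show ?thesis by (simp add: power2_sum algebra_simps)
qed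

text \<open>Square summability for the counting measure: a type cannot depend on \<open>m\<close>,
  so the weight is introduced later by the isometry \<open>emb\<close>.\<close>

typedef 'a ell2 = "{f :: 'a \<Rightarrow> real. (\<lambda>x. (f x)\<^sup>2) summable_on UNIV}"
  morphisms coord Ell2 by (rule exI[where x = "\<lambda>_. 0"]) simp

setup_lifting type_definition_ell2

lemma coord_summable: "(\<lambda>x. (coord v x)\<^sup>2) summable_on UNIV"
  using coord[of v] by simp

instantiation ell2 :: (type) real_inner
begin

lift_definition zero_ell2 :: "'a ell2" is "\<lambda>_. 0" by simp
lift_definition plus_ell2 :: "'a ell2 \<Rightarrow> 'a ell2 \<Rightarrow> 'a ell2" is "\<lambda>f g x. f x + g x"
  by (rule summable_square_add)
lift_definition uminus_ell2 :: "'a ell2 \<Rightarrow> 'a ell2" is "\<lambda>f x. - f x" by simp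
lift_definition minus_ell2 :: "'a ell2 \<Rightarrow> 'a ell2 \<Rightarrow> 'a ell2" is "\<lambda>f g x. f x - g x"
  using summable_square_add[where g = "\<lambda>x. - g x" for g] by simp
lift_definition scaleR_ell2 :: "real \<Rightarrow> 'a ell2 \<Rightarrow> 'a ell2" is "\<lambda>r f x. r * f x"
  by (simp add: power_mult_distrib summable_on_cmult_right)
lift_definition inner_ell2 :: "'a ell2 \<Rightarrow> 'a ell2 \<Rightarrow> real" is "\<lambda>f g. infsum (\<lambda>x. f x * g x) UNIV" .
definition norm_ell2 :: "'a ell2 \<Rightarrow> real" where "norm_ell2 v = sqrt (inner v v)"
definition sgn_ell2 :: "'a ell2 \<Rightarrow> 'a ell2" where "sgn_ell2 a = inverse (norm a) *\<^sub>R a"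
definition dist_ell2 :: "'a ell2 \<Rightarrow> 'a ell2 \<Rightarrow> real" where "dist_ell2 a b = norm (a - b)"
definition uniformity_ell2 :: "('a ell2 \<times> 'a ell2) filter" where
  "uniformity_ell2 = (INF e\<in>{0 <..}. principal {(x, y). dist x y < e})"
definition open_ell2 :: "'a ell2 set \<Rightarrow> bool" where
  "open_ell2 S = (\<forall>x\<in>S. \<forall>\<^sub>F (x', y) in uniformity. x' = x \<longrightarrow> y \<in> S)"

instance
proof
  fix a c d :: "'a ell2" and r s :: real
  show "a + c + d = a + (c + d)" "a + c = c + a" "0 + a = a" "- a + a = 0" "a - c = a + - c"
    "r *\<^sub>R (a + c) = r *\<^sub>R a + r *\<^sub>R c" "(r + s) *\<^sub>R a = r *\<^sub>R a + s *\<^sub>R a"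
    "r *\<^sub>R s *\<^sub>R a = (r * s) *\<^sub>R a" "1 *\<^sub>R a = a"
    by (transfer; simp add: algebra_simps)+
  show "inner a c = inner c a" by transfer (simp add: mult.commute)
  show "inner (a + c) d = inner a d + inner c d"
    by transfer (simp add: distrib_right infsum_add summable_mult_square)
  show "inner (r *\<^sub>R a) c = r * inner a c"
    by transfer (simp add: mult.assoc infsum_cmult_right')
  show "0 \<le> inner a a" by transfer (auto intro!: infsum_nonneg)
  show "(inner a a = 0) = (a = 0)"
  proof (transfer, intro iffI)
    fix f :: "'a \<Rightarrow> real"
    assume f: "(\<lambda>x. (f x)\<^sup>2) summable_on UNIV" "(\<Sum>\<^sub>\<infinity>x. f x * f x) = 0"
    show "f = (\<lambda>_. 0)"
    proof
      fix x
      have "f x * f x = 0"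
        by (rule nonneg_infsum_le_0D[where A = UNIV and f = "\<lambda>x. f x * f x"])
          (use f in \<open>auto simp: power2_eq_square\<close>)
      then show "f x = 0" by simp
    qed
  qed simp
qed (rule sgn_ell2_def dist_ell2_def uniformity_ell2_def open_ell2_def norm_ell2_def)+

end

lemma coord_simps [simp]:
  "coord 0 x = 0" "coord (v + w) x = coord v x + coord w x" "coord (v - w) x = coord v x - coord w x"
  "coord (- v) x = - coord v x" "coord (r *\<^sub>R v) x = r * coord v x"
  by (transfer; simp)+

lemma norm_ell2_square: "(norm v)\<^sup>2 = (\<Sum>\<^sub>\<infinity>x. (coord v x)\<^sup>2)"
  unfolding power2_norm_eq_inner by transfer (simp add: power2_eq_square)

lemma coord_le_norm: "\<bar>coord v x\<bar> \<le> norm v"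
proof -
  have "(coord v x)\<^sup>2 \<le> (norm v)\<^sup>2"
    unfolding norm_ell2_square
    using finite_sum_le_infsum[OF coord_summable, of "{x}" v] by simp
  then show ?thesis by (simp add: abs_le_square_iff[symmetric])
qed

lemma bounded_linear_coord: "bounded_linear (\<lambda>v. coord v x)"
  by (rule bounded_linear_intro[where K = 1]) (auto simp: coord_le_norm)

instance ell2 :: (type) banach
proof
  fix X :: "nat \<Rightarrow> 'a ell2"
  assume X: "Cauchy X"
  define f where "f x = lim (\<lambda>n. coord (X n) x)" for x
  have lim: "(\<lambda>n. coord (X n) x) \<longlonglongrightarrow> f x" for x
    unfolding f_def convergent_LIMSEQ_iff[symmetric] Cauchy_convergent_iff[symmetric]
    by (rule bounded_linear.Cauchy[OF bounded_linear_coord X])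
  \<comment> \<open>Fatou's lemma in the second index: the Cauchy estimate for
    \<open>X n - X k\<close> passes to the coordinatewise limit as \<open>k\<close> grows.\<close>
  have bound: "(\<lambda>x. (coord (X n) x - f x)\<^sup>2) summable_on UNIV \<and> (\<Sum>\<^sub>\<infinity>x. (coord (X n) x - f x)\<^sup>2) \<le> e\<^sup>2"
    if N: "\<And>i j. i \<ge> N \<Longrightarrow> j \<ge> N \<Longrightarrow> norm (X i - X j) < e" and n: "n \<ge> N" for N n e
  proof -
    have ev: "eventually (\<lambda>k. (\<Sum>\<^sub>\<infinity>x. (coord (X n - X k) x)\<^sup>2) \<le> e\<^sup>2) sequentially"
      unfolding norm_ell2_square[symmetric] eventually_sequentially
      using N n by (intro exI[of _ N] allI impI power_mono norm_ge_zero less_imp_le) auto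
    have lm: "(\<lambda>k. (coord (X n - X k) x)\<^sup>2) \<longlonglongrightarrow> (coord (X n) x - f x)\<^sup>2" for x
      by (auto intro!: tendsto_intros lim)
    show ?thesis
      using infsum_limit_le[where F = "\<lambda>k x. (coord (X n - X k) x)\<^sup>2", OF coord_summable zero_le_power2 lm ev]
      by (rule conjI)
  qed
  obtain N where N: "\<And>i j. i \<ge> N \<Longrightarrow> j \<ge> N \<Longrightarrow> norm (X i - X j) < 1"
    using CauchyD[OF X, of 1] by auto
  have "(\<lambda>x. (coord (X N) x + - (coord (X N) x - f x))\<^sup>2) summable_on UNIV"
    using bound[OF N, of N] by (intro summable_square_add coord_summable) (auto simp: power2_commute)
  then have f: "coord (Ell2 f) = f" by (intro Ell2_inverse) simp
  have "X \<longlonglongrightarrow> Ell2 f"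
  proof (rule metric_LIMSEQ_I)
    fix e :: real assume e: "0 < e"
    obtain N where N: "\<And>i j. i \<ge> N \<Longrightarrow> j \<ge> N \<Longrightarrow> norm (X i - X j) < e / 2"
      using CauchyD[OF X, of "e / 2"] e by auto
    have "dist (X n) (Ell2 f) < e" if n: "n \<ge> N" for n
    proof -
      have "(norm (X n - Ell2 f))\<^sup>2 \<le> (e/2)\<^sup>2"
        using bound[OF N n] by (simp add: norm_ell2_square f)
      then have "norm (X n - Ell2 f) \<le> e/2" using e by (simp add: power2_le_iff_abs_le)
      then show ?thesis using e by (simp add: dist_norm)
    qed
    then show "\<exists>N. \<forall>n\<ge>N. dist (X n) (Ell2 f) < e" by blast
  qed
  then show "convergent X" by (rule convergentI)
qed

instance ell2 :: (type) perfect_space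
proof
  fix v :: "'a ell2"
  \<comment> \<open>Any unit vector shows that the space is nonzero; \<open>undefined\<close> merely
    names some point of the index type.\<close>
  define w :: "'a ell2" where "w = Ell2 (\<lambda>x. if x = undefined then 1 else 0)"
  have "(\<lambda>x::'a. (if x = undefined then 1 else 0 :: real)\<^sup>2) summable_on UNIV"
    by (rule finite_nonzero_values_imp_summable_on) simp
  then have "coord w undefined = 1" unfolding w_def by (subst Ell2_inverse) auto
  then have w: "w \<noteq> 0" by auto
  show "\<not> open {v}"
  proof
    assume "open {v}"
    then obtain e where e: "0 < e" "ball v e \<subseteq> {v}" by (auto simp: open_contains_ball)
    have "v + (e / 2 / norm w) *\<^sub>R w \<in> ball v e" using e w by (simp add: dist_norm)
    then have "(e / 2 / norm w) *\<^sub>R w = 0" using e by auto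
    then show False using e w by simp
  qed
qed

section \<open>The energy\<close>

text \<open>Young's inequality with a parameter. A factor \<open>1 + e\<close> close to 1 on the
  main term keeps the energy of a perturbed function close to the original energy.\<close>

lemma square_add_weighted_le:
  fixes a c e :: real
  assumes "0 < e" shows "(a + c)\<^sup>2 \<le> (1 + e) * a\<^sup>2 + (1 + 1 / e) * c\<^sup>2"
proof -
  have "0 \<le> (sqrt e * a - c / sqrt e)\<^sup>2" by simp
  also have "\<dots> = e * a\<^sup>2 + c\<^sup>2 / e - 2 * a * c"
    using assms by (simp add: power2_diff power_mult_distrib power_divide)
  finally show ?thesis by (simp add: power2_sum algebra_simps)
qed

text \<open>Rearrangement: if \<open>a\<close>, \<open>c\<close> and \<open>s\<close>,
  \<open>t\<close> are ordered oppositely, pairing smaller with smaller and larger with larger does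
  not increase the squared distances; otherwise equality holds.\<close>

lemma min_max_square_le:
  fixes a c s t :: real
  shows "(min a c - min s t)\<^sup>2 + (max a c - max s t)\<^sup>2 \<le> (a - s)\<^sup>2 + (c - t)\<^sup>2"
proof -
  have swap: "(c - s)\<^sup>2 + (a - t)\<^sup>2 \<le> (a - s)\<^sup>2 + (c - t)\<^sup>2" if "(c - a) * (s - t) \<ge> 0"
    using that by (simp add: power2_eq_square algebra_simps)
  show ?thesis
    using mult_nonneg_nonneg[of "c - a" "s - t"] mult_nonpos_nonpos[of "c - a" "s - t"] swap swap[unfolded add.commute[of "(c - s)\<^sup>2"]]
    by (cases "a \<le> c"; cases "s \<le> t") (auto simp: min_def max_def)
qed

lemma fin_supp_add: "f \<in> fin_supp \<Longrightarrow> g \<in> fin_supp \<Longrightarrow> (\<lambda>x. f x + g x) \<in> fin_supp"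
  unfolding fin_supp_def mem_Collect_eq
  by (rule finite_subset[of _ "{x. f x \<noteq> 0} \<union> {x. g x \<noteq> 0}"]) auto

lemma fin_supp_cmult: "f \<in> fin_supp \<Longrightarrow> (\<lambda>x. c * f x) \<in> fin_supp"
  unfolding fin_supp_def mem_Collect_eq
  by (rule finite_subset[of _ "{x. f x \<noteq> 0}"]) auto

lemma fin_supp_summable: "f \<in> fin_supp \<Longrightarrow> f summable_on UNIV"
  unfolding fin_supp_def by (rule finite_nonzero_values_imp_summable_on) auto

lemma fin_supp_linf: "f \<in> fin_supp \<Longrightarrow> f \<in> linf"
proof -
  assume "f \<in> fin_supp"
  then have "finite (f ` {x. f x \<noteq> 0} \<union> {0})" by (auto simp: fin_supp_def)
  then have "finite (range f)" by (rule finite_subset[rotated]) auto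
  then show ?thesis by (simp add: linf_def finite_imp_bounded)
qed

lemma fin_suppI: "finite K \<Longrightarrow> (\<And>x. x \<notin> K \<Longrightarrow> f x = 0) \<Longrightarrow> f \<in> fin_supp"
  unfolding fin_supp_def mem_Collect_eq by (rule finite_subset[of _ K]) auto

context wgraph
begin

definition edge :: "('a \<Rightarrow> real) \<Rightarrow> 'a \<times> 'a \<Rightarrow> real" where
  "edge f = (\<lambda>(x, y). b x y * (f x - f y)\<^sup>2)"

definition fin_en :: "('a \<Rightarrow> real) \<Rightarrow> bool" where "fin_en f \<longleftrightarrow> edge f summable_on UNIV"

text \<open>Real-valued counterpart of \<open>energy\<close>. For a non-summable
  \<open>edge f\<close> the value defaults to 0, which is why \<open>fin_en\<close> accompanies
  it.\<close>

definition en :: "('a \<Rightarrow> real) \<Rightarrow> real" where "en f = infsum (edge f) UNIV / 2"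

lemma edge_nonneg [simp]: "0 \<le> edge f p"
  by (auto simp: edge_def split: prod.split)

lemma en_nonneg [simp]: "0 \<le> en f"
  unfolding en_def by (auto intro: infsum_nonneg)

lemma energy_edge: "energy b f = (\<Sum>\<^sub>\<infinity>p. ennreal (edge f p)) / 2"
  unfolding energy_def edge_def by (simp add: case_prod_unfold)

lemma energy_en: assumes "fin_en f" shows "energy b f = ennreal (en f)"
proof -
  have "energy b f = ennreal (infsum (edge f) UNIV) / ennreal 2"
    unfolding energy_edge using assms by (simp add: ennreal_infsum fin_en_def)
  also have "\<dots> = ennreal (infsum (edge f) UNIV / 2)"
    by (rule divide_ennreal) (auto intro: infsum_nonneg)
  finally show ?thesis by (simp add: en_def)
qed

lemma finite_energy_iff: "f \<in> finite_energy b \<longleftrightarrow> fin_en f"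
proof
  assume "f \<in> finite_energy b"
  then have "(\<Sum>\<^sub>\<infinity>p. ennreal (edge f p)) / 2 < \<infinity>" by (simp add: finite_energy_def energy_edge)
  then have "(\<Sum>\<^sub>\<infinity>p. ennreal (edge f p)) < \<infinity>"
    using less_top[of "\<Sum>\<^sub>\<infinity>p. ennreal (edge f p)"]
    by (cases "(\<Sum>\<^sub>\<infinity>p. ennreal (edge f p)) = top") (simp_all add: ennreal_divide_eq_top_iff ennreal_top_divide)
  then show "fin_en f" unfolding fin_en_def by (rule ennreal_infsum_finite_summable) simp
qed (simp add: finite_energy_def energy_en)

lemma fin_en_le:
  assumes "\<And>p. edge f p \<le> F p" "F summable_on UNIV"
  shows "fin_en f" "en f \<le> infsum F UNIV / 2"
proof -
  show f: "fin_en f" unfolding fin_en_def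
    by (rule summable_on_comparison_test[OF assms(2)]) (use assms(1) in auto)
  show "en f \<le> infsum F UNIV / 2" unfolding en_def
    using infsum_mono[of "edge f" UNIV F] f assms by (simp add: fin_en_def)
qed

lemma en_add_weighted:
  assumes f: "fin_en f" and g: "fin_en g" and e: "0 < e"
  shows "fin_en (\<lambda>x. f x + g x)" "en (\<lambda>x. f x + g x) \<le> (1 + e) * en f + (1 + 1 / e) * en g"
proof -
  let ?F = "\<lambda>p. (1 + e) * edge f p + (1 + 1 / e) * edge g p"
  have s: "?F summable_on UNIV"
    by (intro summable_on_add summable_on_cmult_right) (use f g in \<open>auto simp: fin_en_def\<close>)
  have le: "edge (\<lambda>x. f x + g x) p \<le> ?F p" for p
  proof (cases p)
    case (Pair x y)
    have "b x y * ((f x - f y) + (g x - g y))\<^sup>2 \<le> b x y * ((1 + e) * (f x - f y)\<^sup>2 + (1 + 1 / e) * (g x - g y)\<^sup>2)"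
      by (intro mult_left_mono square_add_weighted_le e) auto
    then show ?thesis by (simp add: edge_def Pair algebra_simps)
  qed
  show "fin_en (\<lambda>x. f x + g x)" by (rule fin_en_le(1)[OF le s])
  have "infsum ?F UNIV = (1 + e) * infsum (edge f) UNIV + (1 + 1 / e) * infsum (edge g) UNIV"
    using f g by (subst infsum_add) (auto intro!: summable_on_cmult_right simp: fin_en_def infsum_cmult_right)
  then show "en (\<lambda>x. f x + g x) \<le> (1 + e) * en f + (1 + 1 / e) * en g"
    using fin_en_le(2)[OF le s] by (simp add: en_def add_divide_distrib)
qed

lemmas fin_en_add = en_add_weighted(1)[OF _ _ zero_less_one]

lemma en_cmult: "en (\<lambda>x. c * f x) = c\<^sup>2 * en f" and fin_en_cmult: "fin_en f \<Longrightarrow> fin_en (\<lambda>x. c * f x)"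
proof -
  have e: "edge (\<lambda>x. c * f x) = (\<lambda>p. c\<^sup>2 * edge f p)"
    by (auto simp: edge_def fun_eq_iff power_mult_distrib[symmetric] right_diff_distrib)
  show "en (\<lambda>x. c * f x) = c\<^sup>2 * en f" unfolding en_def e by (simp add: infsum_cmult_right')
  show "fin_en f \<Longrightarrow> fin_en (\<lambda>x. c * f x)" unfolding fin_en_def e by (rule summable_on_cmult_right)
qed

lemma fin_en_diff: assumes "fin_en f" "fin_en g" shows "fin_en (\<lambda>x. f x - g x)"
  using fin_en_add[OF assms(1) fin_en_cmult[OF assms(2), of "-1"]] by simp

lemma en_diff_commute: "en (\<lambda>x. f x - g x) = en (\<lambda>x. g x - f x)"
  using en_cmult[of "-1" "\<lambda>x. g x - f x"] by simp

lemma edge_tendsto: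
  assumes "\<And>x. (\<lambda>n. F n x) \<longlonglongrightarrow> f x" shows "(\<lambda>n. edge (F n) p) \<longlonglongrightarrow> edge f p"
  unfolding edge_def case_prod_unfold by (intro tendsto_intros assms)

lemma en_limit_le:
  assumes "\<And>n. fin_en (F n)" "\<And>x. (\<lambda>n. F n x) \<longlonglongrightarrow> f x" "eventually (\<lambda>n. en (F n) \<le> C) sequentially"
  shows "fin_en f" "en f \<le> C"
proof -
  have "eventually (\<lambda>n. infsum (edge (F n)) UNIV \<le> 2 * C) sequentially"
    using assms(3) by (simp add: en_def mult.commute)
  from infsum_limit_le[of "\<lambda>n. edge (F n)", OF _ edge_nonneg edge_tendsto[OF assms(2)] this] assms(1)
  show "fin_en f" "en f \<le> C" by (auto simp: fin_en_def en_def)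
qed

lemma en_eventually_ge:
  assumes "fin_en f" "\<And>n. fin_en (F n)" "\<And>x. (\<lambda>n. F n x) \<longlonglongrightarrow> f x" "0 < e"
  shows "eventually (\<lambda>n. en (F n) \<ge> en f - e) sequentially"
  using infsum_eventually_ge[of "edge f" "\<lambda>n. edge (F n)" "2 * e"] assms edge_tendsto[of F f]
  by (auto simp: fin_en_def en_def elim!: eventually_mono)

text \<open>Submodularity of the energy. The joint inequality is what matters: it turns a lower
  bound for the energy of the maximum into an upper bound for that of the minimum.\<close>

lemma en_min_max:
  assumes f: "fin_en f" and g: "fin_en g"
  shows "fin_en (\<lambda>x. min (f x) (g x))" "fin_en (\<lambda>x. max (f x) (g x))"
    "en (\<lambda>x. min (f x) (g x)) + en (\<lambda>x. max (f x) (g x)) \<le> en f + en g"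
proof -
  let ?mi = "\<lambda>x. min (f x) (g x)" and ?ma = "\<lambda>x. max (f x) (g x)" and ?F = "\<lambda>p. edge f p + edge g p"
  have le: "edge ?mi p + edge ?ma p \<le> ?F p" for p
  proof (cases p)
    case (Pair x y)
    show ?thesis
      using mult_left_mono[OF min_max_square_le[of "f x" "g x" "f y" "g y"] b_nonneg[of x y]]
      by (simp add: edge_def Pair distrib_left)
  qed
  have s: "?F summable_on UNIV" using f g by (auto intro: summable_on_add simp: fin_en_def)
  have le': "edge ?mi p \<le> ?F p" "edge ?ma p \<le> ?F p" for p
    using le[of p] edge_nonneg[of ?mi p] edge_nonneg[of ?ma p] by linarith+
  show fm: "fin_en ?mi" "fin_en ?ma" by (rule fin_en_le(1)[OF le'(1) s], rule fin_en_le(1)[OF le'(2) s])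
  have "infsum (\<lambda>p. edge ?mi p + edge ?ma p) UNIV \<le> infsum ?F UNIV"
    using f g fm le by (intro infsum_mono summable_on_add) (auto simp: fin_en_def)
  then show "en ?mi + en ?ma \<le> en f + en g"
    using f g fm by (simp add: infsum_add fin_en_def en_def)
qed

lemma en_pos_part:
  assumes f: "fin_en f" shows "fin_en (\<lambda>x. max (f x) 0)" "en (\<lambda>x. max (f x) 0) \<le> en f"
proof -
  have le: "edge (\<lambda>x. max (f x) 0) p \<le> edge f p" for p
  proof (cases p)
    case (Pair x y)
    have "\<bar>max (f x) 0 - max (f y) 0\<bar> \<le> \<bar>f x - f y\<bar>" by (auto simp: max_def)
    then have "(max (f x) 0 - max (f y) 0)\<^sup>2 \<le> (f x - f y)\<^sup>2" by (simp add: abs_le_square_iff)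
    then show ?thesis by (simp add: edge_def Pair mult_left_mono)
  qed
  show "fin_en (\<lambda>x. max (f x) 0)" "en (\<lambda>x. max (f x) 0) \<le> en f"
    using fin_en_le[OF le] f by (auto simp: fin_en_def en_def)
qed

definition edge2 :: "('a \<Rightarrow> real) \<Rightarrow> ('a \<Rightarrow> real) \<Rightarrow> 'a \<times> 'a \<Rightarrow> real" where
  "edge2 f g = (\<lambda>(x, y). b x y * (f x - f y) * (g x - g y))"

lemma edge2_summable: assumes "fin_en f" "fin_en g" shows "edge2 f g summable_on UNIV"
proof -
  have "(\<lambda>p. (sqrt (b (fst p) (snd p)) * (f (fst p) - f (snd p))) * (sqrt (b (fst p) (snd p)) * (g (fst p) - g (snd p)))) summable_on UNIV"
    by (rule summable_mult_square)
      (use assms in \<open>simp_all add: fin_en_def edge_def case_prod_unfold power_mult_distrib\<close>)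
  moreover have "(\<lambda>p. (sqrt (b (fst p) (snd p)) * (f (fst p) - f (snd p))) * (sqrt (b (fst p) (snd p)) * (g (fst p) - g (snd p)))) = edge2 f g"
    by (rule ext) (simp add: edge2_def case_prod_unfold mult.assoc mult.left_commute flip: mult.assoc[of "sqrt _" "sqrt _"])
  ultimately show ?thesis by simp
qed

lemma energy_form_edge2: "energy_form b f g = infsum (edge2 f g) UNIV / 2"
  by (simp add: energy_form_def edge2_def)

lemma energy_form_self: "energy_form b f f = en f"
  by (simp add: energy_form_edge2 en_def edge2_def edge_def power2_eq_square mult.assoc)

lemma energy_form_commute: "energy_form b f g = energy_form b g f"
  by (simp add: energy_form_edge2 edge2_def mult_ac)

lemma energy_form_add:
  assumes "fin_en f" "fin_en g" "fin_en h"
  shows "energy_form b (\<lambda>x. f x + g x) h = energy_form b f h + energy_form b g h"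
proof -
  have "edge2 (\<lambda>x. f x + g x) h = (\<lambda>p. edge2 f h p + edge2 g h p)"
    by (auto simp: edge2_def fun_eq_iff algebra_simps)
  then show ?thesis
    using assms by (simp add: energy_form_edge2 infsum_add edge2_summable add_divide_distrib)
qed

lemma energy_form_cmult: "energy_form b (\<lambda>x. c * f x) h = c * energy_form b f h"
proof -
  have "edge2 (\<lambda>x. c * f x) h = (\<lambda>p. c * edge2 f h p)"
    by (auto simp: edge2_def fun_eq_iff algebra_simps)
  then show ?thesis by (simp add: energy_form_edge2 infsum_cmult_right')
qed

lemma en_add:
  assumes f: "fin_en f" and g: "fin_en g"
  shows "en (\<lambda>x. f x + g x) = en f + 2 * energy_form b f g + en g"
proof -
  have h: "fin_en (\<lambda>x. f x + g x)" by (rule fin_en_add[OF f g])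
  have "en (\<lambda>x. f x + g x) = energy_form b f (\<lambda>x. f x + g x) + energy_form b g (\<lambda>x. f x + g x)"
    unfolding energy_form_self[symmetric] by (rule energy_form_add[OF f g h])
  also have "\<dots> = energy_form b (\<lambda>x. f x + g x) f + energy_form b (\<lambda>x. f x + g x) g"
    by (simp only: energy_form_commute)
  finally show ?thesis
    using energy_form_add[OF f g f] energy_form_add[OF f g g]
    by (simp add: energy_form_self energy_form_commute[of g f])
qed

lemma en_parallelogram:
  assumes f: "fin_en f" and g: "fin_en g"
  shows "en (\<lambda>x. (f x + g x) / 2) = (en f + en g) / 2 - en (\<lambda>x. f x - g x) / 4"
proof -
  have "en (\<lambda>x. f x - g x) = en f - 2 * energy_form b f g + en g"
    using en_add[OF f fin_en_cmult[OF g, of "-1"]] energy_form_cmult[of "-1" g f] en_cmult[of "-1" g]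
    by (simp add: energy_form_commute)
  moreover have "en (\<lambda>x. (f x + g x) / 2) = (en f + 2 * energy_form b f g + en g) / 4"
    using en_cmult[of "1/2" "\<lambda>x. f x + g x"] en_add[OF f g] by (simp add: power2_eq_square)
  ultimately show ?thesis by (simp add: field_simps)
qed

lemma fin_supp_summable_pairs:
  assumes h: "h \<in> fin_supp" and nn: "\<And>x. 0 \<le> h x"
  shows "(\<lambda>(x, y). b x y * h x) summable_on UNIV"
proof -
  have "(\<lambda>(x, y). b x y * h x) summable_on UNIV \<times> UNIV"
  proof (rule summable_on_SigmaI)
    show "((\<lambda>y. case (x, y) of (x, y) \<Rightarrow> b x y * h x) has_sum deg x * h x) UNIV" for x
      unfolding deg_def prod.case by (intro has_sum_cmult_left has_sum_infsum b_summable)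
    show "(\<lambda>x. deg x * h x) summable_on UNIV"
      using h by (intro fin_supp_summable) (auto simp: fin_supp_def elim!: finite_subset[rotated])
  qed (use nn in auto)
  then show ?thesis by simp
qed

lemma summable_pairs_swap:
  assumes "(\<lambda>(x, y). f x y) summable_on (UNIV :: ('a \<times> 'a) set)"
  shows "(\<lambda>(x, y). f y x) summable_on (UNIV :: ('a \<times> 'a) set)"
  using summable_on_swap[of "\<lambda>(x, y). f x y" UNIV UNIV] assms by (simp add: case_prod_unfold prod.swap_def)

lemma fin_supp_fin_en: assumes "f \<in> fin_supp" shows "fin_en f"
proof (rule fin_en_le(1))
  have sq: "(\<lambda>x. (f x)\<^sup>2) \<in> fin_supp" using assms by (simp add: fin_supp_def)
  have 1: "(\<lambda>(x, y). b x y * (f x)\<^sup>2) summable_on UNIV"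
    by (rule fin_supp_summable_pairs[OF sq]) simp
  have 2: "(\<lambda>(x, y). b x y * (f y)\<^sup>2) summable_on UNIV"
    using summable_pairs_swap[OF 1] by (simp add: b_sym)
  show "(\<lambda>p. 2 * ((case p of (x, y) \<Rightarrow> b x y * (f x)\<^sup>2) + (case p of (x, y) \<Rightarrow> b x y * (f y)\<^sup>2))) summable_on UNIV"
    by (intro summable_on_cmult_right summable_on_add 1 2)
  fix p :: "'a \<times> 'a"
  obtain x y where p: "p = (x, y)" by (cases p)
  have "(f x - f y)\<^sup>2 \<le> 2 * ((f x)\<^sup>2 + (f y)\<^sup>2)"
    using sum_squares_bound[of "f x" "- f y"] by (simp add: power2_diff)
  then have "b x y * (f x - f y)\<^sup>2 \<le> b x y * (2 * ((f x)\<^sup>2 + (f y)\<^sup>2))" by (rule mult_left_mono) simp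
  then show "edge f p \<le> 2 * ((case p of (x, y) \<Rightarrow> b x y * (f x)\<^sup>2) + (case p of (x, y) \<Rightarrow> b x y * (f y)\<^sup>2))"
    by (simp add: edge_def p algebra_simps)
qed

text \<open>Boundedness of \<open>u\<close> and finite support of \<open>h\<close> make the two
  halves of \<open>h x - h y\<close> separately summable, and exchanging the endpoints of an edge
  maps one half to the negative of the other.\<close>

lemma green_formula:
  assumes u: "u \<in> linf" and h: "h \<in> fin_supp"
  shows "energy_form b u h = (\<Sum>\<^sub>\<infinity>x. h x * (deg x * u x - (\<Sum>\<^sub>\<infinity>y. b x y * u y)))"
proof -
  obtain C where C: "0 < C" "\<And>x. \<bar>u x\<bar> \<le> C" using linfD[OF u] by blast
  let ?G = "\<lambda>(x, y). b x y * (u x - u y) * h x"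
  have G: "?G summable_on UNIV"
  proof (rule iffD2[OF summable_on_iff_abs_summable_on_real], rule Infinite_Sum.abs_summable_on_comparison_test)
    have "(\<lambda>(x, y). b x y * (2 * C * \<bar>h x\<bar>)) summable_on UNIV"
      by (rule fin_supp_summable_pairs) (use h C in \<open>auto simp: fin_supp_def elim!: finite_subset[rotated]\<close>)
    then show "(\<lambda>p. norm (case p of (x, y) \<Rightarrow> b x y * (2 * C * \<bar>h x\<bar>))) summable_on UNIV"
      using C by (simp add: case_prod_unfold abs_mult)
    fix p :: "'a \<times> 'a"
    obtain x y where p: "p = (x, y)" by (cases p)
    have "b x y * \<bar>u x - u y\<bar> * \<bar>h x\<bar> \<le> b x y * (2 * C) * \<bar>h x\<bar>"
      using C(2)[of x] C(2)[of y] by (intro mult_right_mono mult_left_mono) auto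
    then show "norm (?G p) \<le> norm (case p of (x, y) \<Rightarrow> b x y * (2 * C * \<bar>h x\<bar>))"
      using C by (simp add: p abs_mult mult_ac)
  qed
  have G': "(\<lambda>(x, y). b x y * (u x - u y) * h y) summable_on UNIV"
  proof -
    have "(\<lambda>(x, y). b x y * (u x - u y) * h y) = (\<lambda>p. - (case p of (x, y) \<Rightarrow> b y x * (u y - u x) * h y))"
      by (auto simp: fun_eq_iff b_sym algebra_simps)
    then show ?thesis using summable_pairs_swap[OF G] by (simp only: summable_on_uminus)
  qed
  have G'eq: "infsum (\<lambda>(x, y). b x y * (u x - u y) * h y) UNIV = - infsum ?G UNIV"
  proof -
    have "infsum (\<lambda>(x, y). b x y * (u x - u y) * h y) UNIV = infsum (\<lambda>p. - ?G p) UNIV"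
      by (rule infsum_reindex_bij_witness[where i = prod.swap and j = prod.swap])
        (auto simp: b_sym algebra_simps)
    then show ?thesis by (simp add: infsum_uminus)
  qed
  have "edge2 u h = (\<lambda>p. ?G p + - (case p of (x, y) \<Rightarrow> b x y * (u x - u y) * h y))"
    by (auto simp: edge2_def fun_eq_iff algebra_simps)
  then have "infsum (edge2 u h) UNIV = infsum ?G UNIV + - infsum (\<lambda>(x, y). b x y * (u x - u y) * h y) UNIV"
    using G G' by (simp only: infsum_add summable_on_uminus infsum_uminus)
  then have "energy_form b u h = infsum ?G UNIV" by (simp add: energy_form_edge2 G'eq)
  also have "\<dots> = (\<Sum>\<^sub>\<infinity>x. \<Sum>\<^sub>\<infinity>y. b x y * (u x - u y) * h x)"
    using infsum_Sigma_banach[of ?G UNIV "\<lambda>_. UNIV"] G by simp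
  also have "\<dots> = (\<Sum>\<^sub>\<infinity>x. h x * (deg x * u x - (\<Sum>\<^sub>\<infinity>y. b x y * u y)))"
    unfolding laplacian_linf[OF u, symmetric]
    by (simp add: laplacian_def infsum_cmult_right' mult.commute)
  finally show ?thesis .
qed

subsection \<open>The closure of the finitely supported functions\<close>

lemma energy0_iff:
  "f \<in> energy0 b \<longleftrightarrow> fin_en f \<and> (\<exists>F. (\<forall>n. F n \<in> fin_supp) \<and> (\<forall>x. (\<lambda>n. F n x) \<longlonglongrightarrow> f x) \<and>
     (\<lambda>n. en (\<lambda>x. f x - F n x)) \<longlonglongrightarrow> 0)" (is "_ \<longleftrightarrow> fin_en f \<and> ?R")
proof -
  have "(\<lambda>n. energy b (\<lambda>x. f x - F n x)) \<longlonglongrightarrow> 0 \<longleftrightarrow> (\<lambda>n. en (\<lambda>x. f x - F n x)) \<longlonglongrightarrow> 0"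
    if "fin_en f" "\<forall>n. F n \<in> fin_supp" for F
  proof -
    have "energy b (\<lambda>x. f x - F n x) = ennreal (en (\<lambda>x. f x - F n x))" for n
      by (rule energy_en[OF fin_en_diff[OF that(1) fin_supp_fin_en]]) (use that in auto)
    then show ?thesis using tendsto_ennreal_iff[of "\<lambda>n. en (\<lambda>x. f x - F n x)" sequentially 0] by simp
  qed
  then show ?thesis unfolding energy0_def finite_energy_iff mem_Collect_eq by blast
qed

lemma energy0_fin_en: "f \<in> energy0 b \<Longrightarrow> fin_en f" by (simp add: energy0_iff)

lemma fin_supp_energy0: assumes "f \<in> fin_supp" shows "f \<in> energy0 b"
proof -
  have "en (\<lambda>x. 0) = 0" using en_cmult[of 0 "\<lambda>x. 0"] by simp
  then show ?thesis
    unfolding energy0_iff using assms fin_supp_fin_en[OF assms] by (intro conjI exI[of _ "\<lambda>_. f"]) simp_all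
qed

lemma energy0_add:
  assumes f: "f \<in> energy0 b" and g: "g \<in> energy0 b" shows "(\<lambda>x. f x + g x) \<in> energy0 b"
proof -
  obtain F where F: "\<And>n. F n \<in> fin_supp" "\<And>x. (\<lambda>n. F n x) \<longlonglongrightarrow> f x" "(\<lambda>n. en (\<lambda>x. f x - F n x)) \<longlonglongrightarrow> 0"
    using f unfolding energy0_iff by blast
  obtain G where G: "\<And>n. G n \<in> fin_supp" "\<And>x. (\<lambda>n. G n x) \<longlonglongrightarrow> g x" "(\<lambda>n. en (\<lambda>x. g x - G n x)) \<longlonglongrightarrow> 0"
    using g unfolding energy0_iff by blast
  have fg: "fin_en f" "fin_en g" by (rule energy0_fin_en[OF f], rule energy0_fin_en[OF g])
  have "(\<lambda>n. en (\<lambda>x. (f x + g x) - (F n x + G n x))) \<longlonglongrightarrow> 0"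
  proof (rule tendsto_sandwich[OF _ _ tendsto_const])
    show "eventually (\<lambda>n. en (\<lambda>x. (f x + g x) - (F n x + G n x)) \<le>
        2 * en (\<lambda>x. f x - F n x) + 2 * en (\<lambda>x. g x - G n x)) sequentially"
      using en_add_weighted(2)[OF fin_en_diff[OF fg(1) fin_supp_fin_en[OF F(1)]] fin_en_diff[OF fg(2) fin_supp_fin_en[OF G(1)]] zero_less_one]
      by (intro always_eventually allI) (simp add: algebra_simps)
    show "(\<lambda>n. 2 * en (\<lambda>x. f x - F n x) + 2 * en (\<lambda>x. g x - G n x)) \<longlonglongrightarrow> 0"
      using tendsto_add[OF tendsto_mult[OF tendsto_const[of 2] F(3)] tendsto_mult[OF tendsto_const[of 2] G(3)]] by simp
  qed simp
  then show ?thesis unfolding energy0_iff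
    using fin_en_add[OF fg] F G
    by (intro conjI exI[of _ "\<lambda>n x. F n x + G n x"]) (simp_all add: fin_supp_add tendsto_add)
qed

lemma energy0_cmult:
  assumes f: "f \<in> energy0 b" shows "(\<lambda>x. c * f x) \<in> energy0 b"
proof -
  obtain F where F: "\<And>n. F n \<in> fin_supp" "\<And>x. (\<lambda>n. F n x) \<longlonglongrightarrow> f x" "(\<lambda>n. en (\<lambda>x. f x - F n x)) \<longlonglongrightarrow> 0"
    using f unfolding energy0_iff by blast
  have "(\<lambda>n. en (\<lambda>x. c * f x - c * F n x)) \<longlonglongrightarrow> 0"
    using tendsto_mult[OF tendsto_const[of "c\<^sup>2"] F(3)] by (simp add: en_cmult flip: right_diff_distrib)
  then show ?thesis unfolding energy0_iff
    using fin_en_cmult[OF energy0_fin_en[OF f]] F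
    by (intro conjI exI[of _ "\<lambda>n x. c * F n x"]) (simp_all add: fin_supp_cmult tendsto_mult)
qed

text \<open>Lower semicontinuity of the energy, applied to \<open>F j - F i\<close> as
  \<open>j\<close> grows, turns the Cauchy condition into convergence in energy to the pointwise
  limit.\<close>

lemma energy0_limit:
  assumes F: "\<And>n. F n \<in> fin_supp" and lim: "\<And>x. (\<lambda>n. F n x) \<longlonglongrightarrow> f x"
    and C: "\<And>e. 0 < e \<Longrightarrow> \<exists>N. \<forall>i\<ge>N. \<forall>j\<ge>N. en (\<lambda>x. F j x - F i x) \<le> e"
  shows "f \<in> energy0 b"
proof -
  have fe: "fin_en (F n)" for n by (rule fin_supp_fin_en[OF F])
  have bd: "fin_en (\<lambda>x. f x - F i x) \<and> en (\<lambda>x. f x - F i x) \<le> e"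
    if "\<forall>j\<ge>N. en (\<lambda>x. F j x - F i x) \<le> e" for i N e
  proof -
    have ev: "eventually (\<lambda>j. en (\<lambda>x. F j x - F i x) \<le> e) sequentially"
      using that by (auto simp: eventually_sequentially)
    note L = en_limit_le[OF fin_en_diff[OF fe fe] tendsto_diff[OF lim tendsto_const] ev]
    then show ?thesis by blast
  qed
  obtain N where "\<forall>i\<ge>N. \<forall>j\<ge>N. en (\<lambda>x. F j x - F i x) \<le> 1" using C[of 1] by auto
  then have "fin_en (\<lambda>x. f x - F N x)" using bd by blast
  then have "fin_en (\<lambda>x. (f x - F N x) + F N x)" by (rule fin_en_add[OF _ fe])
  then have f: "fin_en f" by simp
  have "(\<lambda>n. en (\<lambda>x. f x - F n x)) \<longlonglongrightarrow> 0"
  proof (rule LIMSEQ_I)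
    fix r :: real assume r: "0 < r"
    obtain N where "\<forall>i\<ge>N. \<forall>j\<ge>N. en (\<lambda>x. F j x - F i x) \<le> r / 2" using C[of "r/2"] r by auto
    then have "\<forall>i\<ge>N. en (\<lambda>x. f x - F i x) \<le> r / 2" using bd by blast
    then show "\<exists>N. \<forall>n\<ge>N. norm (en (\<lambda>x. f x - F n x) - 0) < r" using r by (auto intro!: exI[of _ N])
  qed
  then show ?thesis unfolding energy0_iff using f F lim by blast
qed

end

section \<open>Minimizers of the resolvent functional\<close>

context nonlin
begin

section \<open>Convexity and monotonicity of the primitive\<close>

abbreviation \<Phi> :: "real \<Rightarrow> real" where "\<Phi> \<equiv> primitive \<phi>"

lemma prim_0 [simp]: "\<Phi> 0 = 0"
  by (simp add: primitive_def zero_ereal_def[symmetric])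

lemma prim_deriv: "(\<Phi> has_real_derivative 2 * \<phi> x) (at x)"
proof -
  \<comment> \<open>An interval that contains 0 and has \<open>x\<close> in its interior, so that
    the derivative within it is the full derivative.\<close>
  let ?a = "- \<bar>x\<bar> - 1" and ?b = "\<bar>x\<bar> + 1"
  have "((\<lambda>u. LBINT t=ereal 0..ereal u. 2 * \<phi> t) has_vector_derivative 2 * \<phi> x) (at x within {?a..?b})"
    by (rule interval_integral_FTC2) (auto intro!: continuous_intros phi_cont)
  moreover have "at x within {?a..?b} = at x" by (rule at_within_Icc_at) auto
  ultimately show ?thesis
    by (simp add: primitive_def[abs_def] has_real_derivative_iff_has_vector_derivative zero_ereal_def)
qed

lemma prim_tangent_less:
  assumes "s \<noteq> t" shows "\<Phi> s + 2 * \<phi> s * (t - s) < \<Phi> t"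
proof (cases "s < t")
  case True
  obtain z where z: "s < z" "\<Phi> t - \<Phi> s = (t - s) * (2 * \<phi> z)"
    using MVT2[OF True, of \<Phi> "\<lambda>x. 2 * \<phi> x"] prim_deriv by auto
  have "(t - s) * (2 * \<phi> s) < (t - s) * (2 * \<phi> z)"
    using True phi_strict[OF z(1)] by (intro mult_strict_left_mono) auto
  then show ?thesis using z(2) by (simp add: algebra_simps)
next
  case False
  then have ts: "t < s" using assms by simp
  obtain z where z: "z < s" "\<Phi> s - \<Phi> t = (s - t) * (2 * \<phi> z)"
    using MVT2[OF ts, of \<Phi> "\<lambda>x. 2 * \<phi> x"] prim_deriv by auto
  have "(s - t) * (2 * \<phi> z) < (s - t) * (2 * \<phi> s)"
    using ts phi_strict[OF z(1)] by (intro mult_strict_left_mono) auto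
  then show ?thesis using z(2) by (simp add: algebra_simps)
qed

lemma prim_tangent: "\<Phi> s + 2 * \<phi> s * (t - s) \<le> \<Phi> t"
  using prim_tangent_less[of s t] by (cases "s = t") auto

lemma prim_nonneg [simp]: "0 \<le> \<Phi> s"
  using prim_tangent[of 0 s] by simp

lemma prim_cont: "isCont \<Phi> x" using prim_deriv DERIV_isCont by blast

lemma prim_midpoint_less: assumes "s \<noteq> t" shows "\<Phi> ((s + t) / 2) < (\<Phi> s + \<Phi> t) / 2"
proof -
  let ?c = "(s + t) / 2"
  have "\<Phi> ?c + 2 * \<phi> ?c * (s - ?c) < \<Phi> s" "\<Phi> ?c + 2 * \<phi> ?c * (t - ?c) < \<Phi> t"
    using assms by (auto intro!: prim_tangent_less)
  moreover have "s - ?c = - ((t - s) / 2)" "t - ?c = (t - s) / 2" by (simp_all add: field_simps)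
  ultimately show ?thesis by simp
qed

lemma prim_midpoint: "\<Phi> ((s + t) / 2) \<le> (\<Phi> s + \<Phi> t) / 2"
  using prim_midpoint_less[of s t] by (cases "s = t") auto

lemma phi_nonneg: "0 \<le> s \<Longrightarrow> 0 \<le> \<phi> s" and phi_nonpos: "s \<le> 0 \<Longrightarrow> \<phi> s \<le> 0"
  using phi_mono_iff[of 0 s] phi_mono_iff[of s 0] by auto

lemma prim_mono: assumes "0 \<le> s" "s \<le> t" shows "\<Phi> s \<le> \<Phi> t"
  using prim_tangent[of s t] mult_nonneg_nonneg[OF phi_nonneg[OF assms(1)], of "t - s"] assms by simp

lemma prim_antimono: assumes "t \<le> 0" "s \<le> t" shows "\<Phi> t \<le> \<Phi> s"
  using prim_tangent[of t s] mult_nonpos_nonpos[OF phi_nonpos[OF assms(1)], of "s - t"] assms by simp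

text \<open>The primitive decreases up to 0 and increases afterwards. The sum, rather than the
  maximum, is on the right because it yields a summable dominating function.\<close>

lemma prim_between: assumes "s \<le> t" "t \<le> r" shows "\<Phi> t \<le> \<Phi> s + \<Phi> r"
proof (cases "0 \<le> t")
  case True
  then show ?thesis using prim_mono[OF True assms(2)] by (simp add: add_increasing)
next
  case False
  then show ?thesis using prim_antimono[OF _ assms(1)] by (simp add: add_increasing2)
qed

section \<open>The potential part of the functional with real values\<close>

definition kterm :: "('a \<Rightarrow> real) \<Rightarrow> ('a \<Rightarrow> real) \<Rightarrow> 'a \<Rightarrow> real" where
  "kterm g v x = \<Phi> (g x - W x * v x) * (m x / W x)"

definition fin_kap :: "('a \<Rightarrow> real) \<Rightarrow> ('a \<Rightarrow> real) \<Rightarrow> bool" where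
  "fin_kap g v \<longleftrightarrow> kterm g v summable_on UNIV"

definition kap :: "('a \<Rightarrow> real) \<Rightarrow> ('a \<Rightarrow> real) \<Rightarrow> real" where
  "kap g v = infsum (kterm g v) UNIV"

lemma kterm_nonneg [simp]: "0 \<le> kterm g v x" by (simp add: kterm_def)

lemma kap_nonneg [simp]: "0 \<le> kap g v" unfolding kap_def by (rule infsum_nonneg) simp

lemma kappa_kap: "fin_kap g v \<Longrightarrow> kappa m \<phi> W g v = ennreal (kap g v)"
  unfolding kappa_def kterm_def[symmetric] kap_def fin_kap_def by (rule ennreal_infsum) auto

lemma kappa_finite_iff: "kappa m \<phi> W g v < \<infinity> \<longleftrightarrow> fin_kap g v"
proof
  assume "kappa m \<phi> W g v < \<infinity>"
  then show "fin_kap g v"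
    unfolding kappa_def kterm_def[symmetric] fin_kap_def by (rule ennreal_infsum_finite_summable) simp
qed (simp add: kappa_kap)

lemma kterm_tendsto:
  assumes "(\<lambda>n. F n x) \<longlonglongrightarrow> v x" shows "(\<lambda>n. kterm g (F n) x) \<longlonglongrightarrow> kterm g v x"
  unfolding kterm_def
  by (intro tendsto_intros isCont_tendsto_compose[OF prim_cont] assms)

text \<open>Changing the argument at finitely many vertices changes only finitely many terms of the
  sum.\<close>

lemma fin_kap_fin_supp:
  assumes g: "fin_kap g (\<lambda>_. 0)" and v: "v \<in> fin_supp" shows "fin_kap g v"
proof -
  have "(\<lambda>x. kterm g v x - kterm g (\<lambda>_. 0) x) \<in> fin_supp"
    using v by (auto simp: fin_supp_def kterm_def elim!: finite_subset[rotated])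
  then have "(\<lambda>x. (kterm g v x - kterm g (\<lambda>_. 0) x) + kterm g (\<lambda>_. 0) x) summable_on UNIV"
    using g by (intro summable_on_add) (simp_all add: fin_kap_def fin_supp_summable)
  then show ?thesis by (simp add: fin_kap_def)
qed

text \<open>Convexity termwise; one vertex with \<open>u x \<noteq> v x\<close> makes the whole sum
  strictly smaller.\<close>

lemma kap_midpoint:
  assumes u: "fin_kap g u" and v: "fin_kap g v"
  shows "fin_kap g (\<lambda>x. (u x + v x) / 2)" "kap g (\<lambda>x. (u x + v x) / 2) \<le> (kap g u + kap g v) / 2"
    "u \<noteq> v \<Longrightarrow> kap g (\<lambda>x. (u x + v x) / 2) < (kap g u + kap g v) / 2"
proof -
  let ?w = "\<lambda>x. (u x + v x) / 2"
  let ?A = "\<lambda>x. (1/2) * (kterm g u x + kterm g v x)"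
  have mid: "g x - W x * ?w x = ((g x - W x * u x) + (g x - W x * v x)) / 2" for x
    by (simp add: field_simps)
  have half: "(p + q) / 2 * c = (1/2) * (p * c + q * c)" for p q c :: real by (simp add: field_simps)
  have le: "kterm g ?w x \<le> ?A x" for x
  proof -
    have "kterm g ?w x \<le> (\<Phi> (g x - W x * u x) + \<Phi> (g x - W x * v x)) / 2 * (m x / W x)"
      unfolding kterm_def mid by (intro mult_right_mono prim_midpoint) simp
    then show ?thesis by (simp only: kterm_def half)
  qed
  have less: "kterm g ?w x < ?A x" if "u x \<noteq> v x" for x
  proof -
    have "g x - W x * u x \<noteq> g x - W x * v x" using that by simp
    then have "kterm g ?w x < (\<Phi> (g x - W x * u x) + \<Phi> (g x - W x * v x)) / 2 * (m x / W x)"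
      unfolding kterm_def mid by (intro mult_strict_right_mono prim_midpoint_less) simp_all
    then show ?thesis by (simp only: kterm_def half)
  qed
  have A: "?A summable_on UNIV"
    using u v by (intro summable_on_cmult_right summable_on_add) (auto simp: fin_kap_def)
  have Aeq: "infsum ?A UNIV = (kap g u + kap g v) / 2"
    using u v by (subst infsum_cmult_right') (simp add: infsum_add fin_kap_def kap_def)
  show w: "fin_kap g ?w" unfolding fin_kap_def by (rule summable_on_comparison_test[OF A le]) simp
  show wle: "kap g ?w \<le> (kap g u + kap g v) / 2"
  proof -
    have "kap g ?w \<le> infsum ?A UNIV"
      unfolding kap_def using w A le by (intro infsum_mono) (auto simp: fin_kap_def)
    then show ?thesis by (simp only: Aeq)
  qed
  assume "u \<noteq> v"
  then obtain x where x: "u x \<noteq> v x" by auto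
  have "infsum (kterm g ?w) UNIV < infsum ?A UNIV"
    using has_sum_strict_mono[OF has_sum_infsum[OF w[unfolded fin_kap_def]] has_sum_infsum[OF A] le UNIV_I less[OF x]] .
  then show "kap g ?w < (kap g u + kap g v) / 2" by (simp only: Aeq kap_def)
qed

lemma kap_limit:
  assumes F: "\<And>n. fin_kap g (F n)" "\<And>n. fin_en (F n)" and lim: "\<And>x. (\<lambda>n. F n x) \<longlonglongrightarrow> v x"
    and C: "eventually (\<lambda>n. en (F n) + kap g (F n) \<le> C) sequentially"
  shows "fin_en v" "fin_kap g v" "en v + kap g v \<le> C"
proof -
  have C1: "eventually (\<lambda>n. en (F n) \<le> C) sequentially"
    using C by (rule eventually_mono) (use kap_nonneg in \<open>smt (verit)\<close>)
  have C2: "eventually (\<lambda>n. kap g (F n) \<le> C) sequentially"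
    using C by (rule eventually_mono) (use en_nonneg in \<open>smt (verit)\<close>)
  show en: "fin_en v" by (rule en_limit_le(1)[OF F(2) lim C1])
  have kt: "(\<lambda>n. kterm g (F n) x) \<longlonglongrightarrow> kterm g v x" for x by (rule kterm_tendsto[OF lim])
  show ka: "fin_kap g v"
    unfolding fin_kap_def
    by (rule infsum_limit_le(1)[of "\<lambda>n. kterm g (F n)", OF _ _ kt C2[unfolded kap_def]])
      (use F(1) in \<open>auto simp: fin_kap_def\<close>)
  show "en v + kap g v \<le> C"
  proof (rule field_le_epsilon)
    fix e :: real assume e: "0 < e"
    have 1: "eventually (\<lambda>n. en (F n) \<ge> en v - e/2) sequentially"
      by (rule en_eventually_ge[OF en F(2) lim]) (use e in auto)
    have 2: "eventually (\<lambda>n. kap g (F n) \<ge> kap g v - e/2) sequentially"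
      unfolding kap_def
      by (rule infsum_eventually_ge) (use e ka F kt in \<open>auto simp: fin_kap_def\<close>)
    have "eventually (\<lambda>n. en v + kap g v \<le> C + e) sequentially"
      using C 1 2 by eventually_elim linarith
    then show "en v + kap g v \<le> C + e" by simp
  qed
qed

text \<open>The tangent at \<open>-1\<close> has negative slope, which bounds sublevel sets from
  below. With \<open>s = g x - W x * u x\<close> this is an upper bound for \<open>u x\<close>, the
  only one missing for nonnegative \<open>u\<close>.\<close>

lemma prim_sublevel_bound:
  assumes "\<Phi> s \<le> D" shows "- (D / (- 2 * \<phi> (-1))) - 1 \<le> s"
proof -
  have p: "0 < - 2 * \<phi> (-1)" using phi_strict[of "-1" 0] by simp
  have "2 * \<phi> (-1) * (s + 1) \<le> D" using prim_tangent[of "-1" s] prim_nonneg[of "-1"] assms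
    by (simp only: diff_minus_eq_add)
  then have "- (s + 1) * (- 2 * \<phi> (-1)) \<le> D" by (simp add: algebra_simps)
  then have "- (s + 1) \<le> D / (- 2 * \<phi> (-1))" using p by (simp only: pos_le_divide_eq)
  then show ?thesis by linarith
qed

section \<open>Minimality of least solutions, on finite sets and in the limit\<close>

lemma supersol_finite:
  assumes "finite K" obtains c where "supersol g K (\<lambda>_. c)"
proof
  \<comment> \<open>Any constant above all \<open>g x / W x\<close> works; the sum is one that needs
    no case distinction for empty \<open>K\<close>.\<close>
  show "supersol g K (\<lambda>_. \<Sum>x\<in>K. \<bar>g x\<bar> / W x)"
  proof (rule supersol_const)
    show "0 \<le> (\<Sum>x\<in>K. \<bar>g x\<bar> / W x)" by (intro sum_nonneg) simp
    fix x assume "x \<in> K"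
    then have "\<bar>g x\<bar> / W x \<le> (\<Sum>x\<in>K. \<bar>g x\<bar> / W x)"
      using assms by (intro member_le_sum) auto
    then have "\<bar>g x\<bar> \<le> W x * (\<Sum>x\<in>K. \<bar>g x\<bar> / W x)" by (simp add: pos_divide_le_eq mult.commute)
    then show "g x \<le> W x * (\<Sum>x\<in>K. \<bar>g x\<bar> / W x)" by linarith
  qed
qed

text \<open>On a finite set the Euler-Lagrange equation and convexity give minimality directly.\<close>

lemma lsol_finite_minimal:
  assumes K: "finite K" and g: "\<And>x. 0 \<le> g x" and g0: "fin_kap g (\<lambda>_. 0)"
    and v: "\<And>x. x \<notin> K \<Longrightarrow> v x = 0"
  shows "en (lsol g K) + kap g (lsol g K) \<le> en v + kap g v"
proof -
  let ?u = "lsol g K"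
  define h where "h x = v x - ?u x" for x
  obtain c where c: "supersol g K (\<lambda>_. c)" using supersol_finite[OF K] by blast
  have u0: "?u x = 0" if "x \<notin> K" for x by (rule lsol_outside[OF c that])
  have fs: "?u \<in> fin_supp" "v \<in> fin_supp" "h \<in> fin_supp"
    by (rule fin_suppI[OF K], use u0 v in \<open>simp add: h_def\<close>)+
  have v_eq: "v = (\<lambda>x. ?u x + h x)" by (simp add: h_def fun_eq_iff)
  have "en v = en ?u + 2 * energy_form b ?u h + en h"
    unfolding v_eq by (intro en_add fin_supp_fin_en fs)
  also have "energy_form b ?u h = (\<Sum>\<^sub>\<infinity>x. h x * (m x * \<phi> (g x - W x * ?u x)))"
    unfolding green_formula[OF fin_supp_linf[OF fs(1)] fs(3)]
  proof (intro infsum_cong)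
    fix x
    show "h x * (deg x * ?u x - (\<Sum>\<^sub>\<infinity>y. b x y * ?u y)) = h x * (m x * \<phi> (g x - W x * ?u x))"
      using lsol_solves(2)[OF c, of x] g u0[of x] v[of x] by (cases "x \<in> K") (auto simp: balance_def h_def)
  qed
  finally have en: "en v \<ge> en ?u + 2 * (\<Sum>\<^sub>\<infinity>x. h x * (m x * \<phi> (g x - W x * ?u x)))"
    using en_nonneg[of h] by linarith
  have ks: "fin_kap g ?u" "fin_kap g v" by (rule fin_kap_fin_supp[OF g0 fs(1)], rule fin_kap_fin_supp[OF g0 fs(2)])
  have hs: "(\<lambda>x. h x * (m x * \<phi> (g x - W x * ?u x))) summable_on UNIV"
    by (rule fin_supp_summable) (use fs(3) in \<open>auto simp: fin_supp_def elim!: finite_subset[rotated]\<close>)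
  \<comment> \<open>The weight \<open>m x / W x\<close> cancels the factor \<open>W x\<close>
    produced by the inner derivative. The linear term is then exactly the negative of the one from
    Green's formula, and both disappear on addition.\<close>
  have "kterm g ?u x + - 2 * (h x * (m x * \<phi> (g x - W x * ?u x))) \<le> kterm g v x" for x
  proof -
    have "\<Phi> (g x - W x * ?u x) + 2 * \<phi> (g x - W x * ?u x) * (- W x * h x) \<le> \<Phi> (g x - W x * v x)"
      using prim_tangent[of "g x - W x * ?u x" "g x - W x * v x"] by (simp add: h_def algebra_simps)
    then have "(\<Phi> (g x - W x * ?u x) + 2 * \<phi> (g x - W x * ?u x) * (- W x * h x)) * (m x / W x) \<le> kterm g v x"
      unfolding kterm_def by (rule mult_right_mono) simp
    then show ?thesis by (simp add: kterm_def algebra_simps)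
  qed
  then have "infsum (\<lambda>x. kterm g ?u x + - 2 * (h x * (m x * \<phi> (g x - W x * ?u x)))) UNIV \<le> kap g v"
    unfolding kap_def using ks hs
    by (intro infsum_mono summable_on_add summable_on_cmult_right) (auto simp: fin_kap_def)
  also have "infsum (\<lambda>x. kterm g ?u x + - 2 * (h x * (m x * \<phi> (g x - W x * ?u x)))) UNIV =
      kap g ?u + - 2 * (\<Sum>\<^sub>\<infinity>x. h x * (m x * \<phi> (g x - W x * ?u x)))"
    by (subst infsum_add[OF ks(1)[unfolded fin_kap_def] summable_on_cmult_right[OF hs]])
      (simp only: kap_def infsum_cmult_right')
  finally show ?thesis using en by linarith
qed

text \<open>Approximants in energy need not control \<open>kap\<close>, so \<open>F n\<close> is
  replaced by the minimum of its positive part with that of \<open>w\<close>. Lying between 0 and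
  the positive part of \<open>w\<close>, these have dominated terms in \<open>kap\<close>. Their
  energy is controlled by submodularity together with lower semicontinuity along the corresponding
  maxima.\<close>

lemma fin_supp_approx:
  assumes g: "\<And>x. 0 \<le> g x" and g0: "fin_kap g (\<lambda>_. 0)" and w: "w \<in> energy0 b" "fin_kap g w" and e: "0 < e"
  obtains v where "v \<in> fin_supp" "en v + kap g v \<le> en w + kap g w + e"
proof -
  obtain F where F: "\<And>n. F n \<in> fin_supp" "\<And>x. (\<lambda>n. F n x) \<longlonglongrightarrow> w x" "(\<lambda>n. en (\<lambda>x. w x - F n x)) \<longlonglongrightarrow> 0"
    using w(1) unfolding energy0_iff by blast
  have fw: "fin_en w" by (rule energy0_fin_en[OF w(1)])
  let ?wp = "\<lambda>x. max (w x) 0"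
  let ?Fp = "\<lambda>n x. max (F n x) 0"
  define v where "v n = (\<lambda>x. min (?wp x) (?Fp n x))" for n
  have fF: "fin_en (F n)" for n by (rule fin_supp_fin_en[OF F(1)])
  note fwp = en_pos_part[OF fw] and fFp = en_pos_part[OF fF]
  have v_fs: "v n \<in> fin_supp" for n
    using F(1)[of n] by (auto simp: fin_supp_def v_def elim!: finite_subset[rotated])
  have limp: "(\<lambda>n. ?Fp n x) \<longlonglongrightarrow> ?wp x" for x by (intro tendsto_intros F)
  have limv: "(\<lambda>n. v n x) \<longlonglongrightarrow> ?wp x" for x
    unfolding v_def using tendsto_min[OF tendsto_const[of "?wp x"] limp[of x]] by simp
  have limmax: "(\<lambda>n. max (?wp x) (?Fp n x)) \<longlonglongrightarrow> ?wp x" for x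
    using tendsto_max[OF tendsto_const[of "?wp x"] limp[of x]] by simp
  have ev1: "eventually (\<lambda>n. en (F n) \<le> en w + e / 4) sequentially"
  proof -
    \<comment> \<open>A strictly positive bound for \<open>en w\<close>, so that \<open>d\<close>
      below can be chosen with \<open>d * en w \<le> e / 8\<close> even if
      \<open>en w = 0\<close>.\<close>
    define z where "z = en w + 1"
    have z: "0 < z" "en w \<le> z" using en_nonneg[of w] unfolding z_def by linarith+
    define d where "d = e / (8 * z)"
    have d: "0 < d" using e z by (simp add: d_def)
    have "(\<lambda>n. (1 + 1 / d) * en (\<lambda>x. F n x - w x)) \<longlonglongrightarrow> (1 + 1 / d) * 0"
      using F(3) by (intro tendsto_mult tendsto_const) (simp add: en_diff_commute)
    then have "eventually (\<lambda>n. (1 + 1 / d) * en (\<lambda>x. F n x - w x) < e / 8) sequentially"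
      by (rule order_tendstoD) (use e in simp)
    then show ?thesis
    proof (rule eventually_mono)
      fix n assume n: "(1 + 1 / d) * en (\<lambda>x. F n x - w x) < e / 8"
      have "en (\<lambda>x. w x + (F n x - w x)) \<le> (1 + d) * en w + (1 + 1 / d) * en (\<lambda>x. F n x - w x)"
        by (rule en_add_weighted(2)[OF fw fin_en_diff[OF fF fw] d])
      moreover have "d * en w \<le> e / 8"
      proof -
        have "d * en w \<le> d * z" using z d by (intro mult_left_mono) auto
        also have "\<dots> = e / 8" using z by (simp add: d_def)
        finally show ?thesis .
      qed
      moreover have "a \<le> c + e / 4" if "a \<le> (1 + d) * c + y" "d * c \<le> e / 8" "y < e / 8" for a c y :: real
        using that by (simp add: distrib_right)
      ultimately show "en (F n) \<le> en w + e / 4" using n by simp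
    qed
  qed
  have ev2: "eventually (\<lambda>n. en (\<lambda>x. max (?wp x) (?Fp n x)) \<ge> en ?wp - e / 4) sequentially"
    by (rule en_eventually_ge[OF fwp(1) en_min_max(2)[OF fwp(1) fFp(1)] limmax]) (use e in simp)
  let ?D = "\<lambda>x. kterm g (\<lambda>_. 0) x + kterm g ?wp x"
  \<comment> \<open>Since \<open>0 \<le> g x\<close>, a negative value of \<open>w\<close> pushes
    the argument of the increasing branch of the primitive further up; replacing it by 0 does not
    increase the term.\<close>
  have kwp: "kterm g ?wp x \<le> kterm g w x" for x
  proof (cases "0 \<le> w x")
    case False
    have "\<Phi> (g x) \<le> \<Phi> (g x - W x * w x)"
      using False g[of x] by (intro prim_mono) (auto simp: mult_le_0_iff)
    then have "\<Phi> (g x) * (m x / W x) \<le> \<Phi> (g x - W x * w x) * (m x / W x)" by (rule mult_right_mono) simp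
    then show ?thesis using False by (simp add: kterm_def)
  qed (simp add: kterm_def)
  have fk: "fin_kap g ?wp"
    unfolding fin_kap_def
    by (rule summable_on_comparison_test[OF _ kwp]) (use w in \<open>auto simp: fin_kap_def\<close>)
  have D: "?D summable_on UNIV" using g0 fk by (auto intro: summable_on_add simp: fin_kap_def)
  have kv: "kterm g (v n) x \<le> ?D x" for n x
  proof -
    have v01: "0 \<le> v n x" "v n x \<le> ?wp x" by (auto simp: v_def)
    have "\<Phi> (g x - W x * v n x) \<le> \<Phi> (g x - W x * ?wp x) + \<Phi> (g x)"
      using v01 by (intro prim_between) (simp_all add: mult_left_mono)
    then have "\<Phi> (g x - W x * v n x) * (m x / W x) \<le> (\<Phi> (g x - W x * ?wp x) + \<Phi> (g x)) * (m x / W x)"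
      by (intro mult_right_mono) simp_all
    then show ?thesis unfolding kterm_def by (simp only: distrib_right) simp
  qed
  have fkv: "fin_kap g (v n)" for n by (rule fin_kap_fin_supp[OF g0 v_fs])
  \<comment> \<open>Dominated convergence in the direction needed: Fatou's lemma for the dominating
    function minus the terms.\<close>
  have ev3: "eventually (\<lambda>n. infsum (\<lambda>x. ?D x - kterm g (v n) x) UNIV \<ge> infsum (\<lambda>x. ?D x - kterm g ?wp x) UNIV - e / 4) sequentially"
  proof (rule infsum_eventually_ge)
    show "(\<lambda>n. ?D x - kterm g (v n) x) \<longlonglongrightarrow> ?D x - kterm g ?wp x" for x
      by (intro tendsto_diff tendsto_const kterm_tendsto limv)
    show "(\<lambda>x. ?D x - kterm g ?wp x) summable_on UNIV" using g0 by (simp add: fin_kap_def)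
    show "(\<lambda>x. ?D x - kterm g (v n) x) summable_on UNIV" for n
      using summable_on_add[OF D summable_on_uminus[THEN iffD2, OF fkv[unfolded fin_kap_def]]] by simp
    show "0 \<le> ?D x - kterm g (v n) x" for n x by (simp only: diff_ge_0_iff_ge kv)
  qed (use e in simp)
  have idiff: "infsum (\<lambda>x. ?D x - kterm g z x) UNIV = infsum ?D UNIV - kap g z" if "fin_kap g z" for z
    using infsum_add[OF D summable_on_uminus[THEN iffD2, OF that[unfolded fin_kap_def]]]
    by (simp add: infsum_uminus kap_def)
  have kap_wp: "kap g ?wp \<le> kap g w"
    unfolding kap_def using fk w kwp by (intro infsum_mono) (auto simp: fin_kap_def)
  have "eventually (\<lambda>n. en (v n) + kap g (v n) \<le> en w + kap g w + e) sequentially"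
    using ev1 ev2 ev3
  proof eventually_elim
    case (elim n)
    have 1: "en (v n) + en (\<lambda>x. max (?wp x) (?Fp n x)) \<le> en ?wp + en (?Fp n)"
      unfolding v_def by (rule en_min_max(3)[OF fwp(1) fFp(1)])
    have arith: "ev + kv \<le> ew + kw + 4 * h"
      if "ev + em \<le> ep + ef" "ef \<le> en'" "en' \<le> ew + h" "em \<ge> ep - h" "D - kv \<ge> D - kp - h" "kp \<le> kw" "0 \<le> h"
      for ev em ep ef en' ew kv kp kw D h :: real
      using that by linarith
    have "en (v n) + kap g (v n) \<le> en w + kap g w + 4 * (e / 4)"
      by (rule arith[OF 1 fFp(2) elim(1) elim(2) elim(3)[unfolded idiff[OF fkv] idiff[OF fk]] kap_wp]) (use e in simp)
    then show ?case by simp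
  qed
  then obtain n where "en (v n) + kap g (v n) \<le> en w + kap g w + e"
    by (auto simp: eventually_sequentially)
  then show thesis using that v_fs by blast
qed

text \<open>The second assumption says that the zero function is admissible. It holds for finitely
  supported \<open>g\<close>, and for the identity with constant \<open>W\<close> it means
  \<open>g \<in> l2 m\<close>, the generality the resolvents of the form operator require.\<close>

context
  fixes g :: "'a \<Rightarrow> real"
  assumes g: "\<And>x. 0 \<le> g x" and g0: "fin_kap g (\<lambda>_. 0)"
begin

lemma lsol_exhaust_fin_supp: "lsol g (exhaust n) \<in> fin_supp"
proof -
  obtain c where c: "supersol g (exhaust n) (\<lambda>_. c)" using supersol_finite[OF finite_exhaust] by blast
  show ?thesis by (rule fin_suppI[OF finite_exhaust]) (rule lsol_outside[OF c])
qed

text \<open>No supersolution on the whole graph is available yet. Comparison with the competitor 0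
  bounds each single term of \<open>kap\<close> independently of \<open>n\<close>, and
  \<open>prim_sublevel_bound\<close> converts this into a bound at \<open>x\<close>.\<close>

lemma lsol_exhaust_bounded: "bdd_above (range (\<lambda>n. lsol g (exhaust n) x))"
proof -
  define D where "D = kap g (\<lambda>_. 0) * (W x / m x)"
  have "lsol g (exhaust n) x \<le> (g x + D / (- 2 * \<phi> (-1)) + 1) / W x" for n
  proof -
    let ?u = "lsol g (exhaust n)"
    have "kterm g ?u x \<le> kap g ?u"
      unfolding kap_def using finite_sum_le_infsum[of "kterm g ?u" UNIV "{x}"]
        fin_kap_fin_supp[OF g0 lsol_exhaust_fin_supp] by (simp add: fin_kap_def)
    also have "\<dots> \<le> en ?u + kap g ?u" by simp
    also have "\<dots> \<le> en (\<lambda>_. 0) + kap g (\<lambda>_. 0)"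
      by (rule lsol_finite_minimal) (use g g0 in auto)
    also have "en (\<lambda>_. 0) = 0" using en_cmult[of 0 "\<lambda>x. 0"] by simp
    finally have "\<Phi> (g x - W x * ?u x) * (m x / W x) \<le> kap g (\<lambda>_. 0)" by (simp add: kterm_def)
    then have "\<Phi> (g x - W x * ?u x) \<le> D"
      by (simp add: D_def field_simps)
    from prim_sublevel_bound[OF this] have "W x * ?u x \<le> g x + D / (- 2 * \<phi> (-1)) + 1" by linarith
    then show ?thesis by (simp add: pos_le_divide_eq mult.commute)
  qed
  then show ?thesis by (intro bdd_aboveI) auto
qed

lemma lsol_exhaust_tendsto: "(\<lambda>n. lsol g (exhaust n) x) \<longlonglongrightarrow> lsol g UNIV x"
  and lsol_supersol: "supersol g UNIV (lsol g UNIV)"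
proof -
  have "\<exists>c. supersol g (exhaust n) (\<lambda>_. c)" for n using supersol_finite[OF finite_exhaust] by metis
  then obtain c where c: "\<And>n. supersol g (exhaust n) (\<lambda>_. c n)" by metis
  have un: "(\<Union>n. exhaust n) = (UNIV :: 'a set)"
    using eventually_in_exhaust by (fastforce simp: eventually_sequentially)
  note L = lsol_seq_limit[where K = exhaust and g = "\<lambda>_. g" and g' = g and v = "\<lambda>n _. c n",
      OF _ un _ _ c lsol_exhaust_bounded]
  show "(\<lambda>n. lsol g (exhaust n) x) \<longlonglongrightarrow> lsol g UNIV x" "supersol g UNIV (lsol g UNIV)"
    using L by (auto simp: incseq_def exhaust_mono)
qed

lemma lsol_energy0: "lsol g UNIV \<in> energy0 b"
proof (rule energy0_limit[OF lsol_exhaust_fin_supp lsol_exhaust_tendsto])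
  let ?u = "\<lambda>n. lsol g (exhaust n)"
  define E where "E n = en (?u n) + kap g (?u n)" for n
  have fe: "fin_en (?u n)" for n by (rule fin_supp_fin_en[OF lsol_exhaust_fin_supp])
  have fk: "fin_kap g (?u n)" for n by (rule fin_kap_fin_supp[OF g0 lsol_exhaust_fin_supp])
  have u0: "?u n x = 0" if "x \<notin> exhaust n" for n x
    using supersol_finite[OF finite_exhaust] lsol_outside that by metis
  have u0': "?u n x = 0" if "x \<notin> exhaust k" "n \<le> k" for n k x
    using u0 that exhaust_mono by blast
  have min: "E n \<le> en v + kap g v" if "\<And>x. x \<notin> exhaust n \<Longrightarrow> v x = 0" for n v
    unfolding E_def by (rule lsol_finite_minimal[OF finite_exhaust g g0 that])
  have dec: "E j \<le> E i" if "i \<le> j" for i j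
    unfolding E_def[of i] by (rule min) (use u0' that in auto)
  have bb: "bdd_below (range E)" by (rule bdd_belowI[where m = 0]) (auto simp: E_def)
  define I where "I = (INF n. E n)"
  have I: "I \<le> E n" for n unfolding I_def by (rule cINF_lower[OF bb]) simp
  have "E \<longlonglongrightarrow> I" unfolding I_def by (rule LIMSEQ_decseq_INF[OF bb]) (use dec in \<open>auto simp: decseq_def\<close>)
  fix e :: real assume e: "0 < e"
  have "eventually (\<lambda>n. E n < I + e / 4) sequentially"
    using \<open>E \<longlonglongrightarrow> I\<close> by (rule order_tendstoD) (use e in simp)
  then obtain N where N: "\<And>n. n \<ge> N \<Longrightarrow> E n < I + e / 4" by (auto simp: eventually_sequentially)
  have "en (\<lambda>x. ?u j x - ?u i x) \<le> e" if "i \<ge> N" "j \<ge> N" for i j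
  proof -
    \<comment> \<open>The midpoint vanishes outside the larger of the two finite sets, so its value
      is at least \<open>I\<close>. Both endpoints lie below \<open>I + e / 4\<close>, which leaves
      less than \<open>e / 4\<close> for a quarter of the energy of the difference.\<close>
    let ?v = "\<lambda>x. (?u j x + ?u i x) / 2"
    have "I \<le> en ?v + kap g ?v"
      by (rule order_trans[OF I[of "max i j"]], rule min) (use u0'[of _ "max i j"] in simp)
    moreover have "d \<le> e" if "I \<le> em + km" "em = (ej + ei) / 2 - d / 4" "km \<le> (kj + ki) / 2"
      "ei + ki < I + e / 4" "ej + kj < I + e / 4" for em km ej ei kj ki d :: real
      using that by argo
    ultimately show ?thesis
      using en_parallelogram[OF fe[of j] fe[of i]] kap_midpoint(2)[OF fk[of j] fk[of i]] N[OF that(1)] N[OF that(2)]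
      unfolding E_def by blast
  qed
  then show "\<exists>N. \<forall>i\<ge>N. \<forall>j\<ge>N. en (\<lambda>x. ?u j x - ?u i x) \<le> e" by blast
qed

text \<open>A nearly optimal finitely supported competitor is admissible on every sufficiently large
  finite set. The bound obtained there passes to the limit by lower semicontinuity.\<close>

lemma lsol_minimal:
  assumes w: "w \<in> energy0 b" "fin_kap g w"
  shows "en (lsol g UNIV) + kap g (lsol g UNIV) \<le> en w + kap g w" and lsol_fin_kap: "fin_kap g (lsol g UNIV)"
proof -
  let ?u = "\<lambda>n. lsol g (exhaust n)"
  have bound: "fin_kap g (lsol g UNIV) \<and> en (lsol g UNIV) + kap g (lsol g UNIV) \<le> en w + kap g w + e" if e: "0 < e" for e
  proof -
    obtain v where v: "v \<in> fin_supp" "en v + kap g v \<le> en w + kap g w + e"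
      using fin_supp_approx[OF g g0 w e] by blast
    have "eventually (\<lambda>n. \<forall>x\<in>{x. v x \<noteq> 0}. x \<in> exhaust n) sequentially"
      using v(1) eventually_in_exhaust by (subst eventually_ball_finite_distrib) (auto simp: fin_supp_def)
    then have "eventually (\<lambda>n. en (?u n) + kap g (?u n) \<le> en w + kap g w + e) sequentially"
    proof (rule eventually_mono)
      fix n assume "\<forall>x\<in>{x. v x \<noteq> 0}. x \<in> exhaust n"
      then have "en (?u n) + kap g (?u n) \<le> en v + kap g v"
        by (intro lsol_finite_minimal finite_exhaust g g0) auto
      then show "en (?u n) + kap g (?u n) \<le> en w + kap g w + e" using v(2) by linarith
    qed
    from kap_limit[OF fin_kap_fin_supp[OF g0 lsol_exhaust_fin_supp] fin_supp_fin_en[OF lsol_exhaust_fin_supp] lsol_exhaust_tendsto this]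
    show ?thesis by blast
  qed
  show "fin_kap g (lsol g UNIV)" using bound[of 1] by simp
  show "en (lsol g UNIV) + kap g (lsol g UNIV) \<le> en w + kap g w"
    by (rule field_le_epsilon) (simp add: bound)
qed

text \<open>Strict convexity has to come from \<open>kap\<close>, since the energy does not see
  additive constants.\<close>

lemma lsol_minimizer_unique:
  assumes v: "v \<in> energy0 b" "fin_kap g v" and le: "en v + kap g v \<le> en (lsol g UNIV) + kap g (lsol g UNIV)"
  shows "v = lsol g UNIV"
proof (rule ccontr)
  assume ne: "v \<noteq> lsol g UNIV"
  let ?u = "lsol g UNIV" let ?w = "\<lambda>x. (v x + lsol g UNIV x) / 2"
  have k: "fin_kap g ?u" by (rule lsol_fin_kap[OF v])
  have "?w \<in> energy0 b"
    using energy0_cmult[OF energy0_add[OF v(1) lsol_energy0], of "1/2"] by simp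
  then have "en ?u + kap g ?u \<le> en ?w + kap g ?w"
    by (rule lsol_minimal) (rule kap_midpoint(1)[OF v(2) k])
  moreover have False if "eu + ku \<le> em + km" "em = (ev + eu) / 2 - d / 4" "km < (kv + ku) / 2" "0 \<le> d"
    "ev + kv \<le> eu + ku" for eu ku em km ev kv d :: real
    using that by argo
  ultimately show False
    using en_parallelogram[OF energy0_fin_en[OF v(1)] energy0_fin_en[OF lsol_energy0]]
      kap_midpoint(3)[OF v(2) k ne] en_nonneg[of "\<lambda>x. v x - ?u x"] le by blast
qed

end

text \<open>Existence and uniqueness of the minimizer together identify the description in
  \<open>resolvent\<close>; afterwards \<open>resolvent\<close> enters only through
  \<open>lsol\<close>.\<close>

lemma resolvent_eq_lsol:
  assumes g: "\<And>x. 0 \<le> g x" and gs: "g \<in> fin_supp"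
  shows "resolvent b m \<phi> W g = lsol g UNIV"
proof -
  let ?u = "lsol g UNIV"
  have g0: "fin_kap g (\<lambda>_. 0)"
    unfolding fin_kap_def
    by (rule fin_supp_summable) (use gs in \<open>auto simp: fin_supp_def kterm_def elim!: finite_subset[rotated]\<close>)
  have dom: "v \<in> functional_dom b m \<phi> W g \<longleftrightarrow> v \<in> energy0 b \<and> fin_kap g v" for v
    unfolding functional_dom_def mem_Collect_eq kappa_finite_iff ..
  have zero: "(\<lambda>_. 0) \<in> energy0 b" by (rule fin_supp_energy0) (simp add: fin_supp_def)
  have u: "?u \<in> functional_dom b m \<phi> W g"
    unfolding dom using lsol_energy0[OF g g0] lsol_fin_kap[OF g g0 zero g0] by blast
  have fn: "functional b m \<phi> W g v = ennreal (en v + kap g v)" if "v \<in> functional_dom b m \<phi> W g" for v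
    using that unfolding dom functional_def by (simp add: energy_en energy0_fin_en kappa_kap)
  show ?thesis
    unfolding resolvent_def
  proof (rule the_equality)
    have "functional b m \<phi> W g ?u \<le> functional b m \<phi> W g v" if v: "v \<in> functional_dom b m \<phi> W g" for v
      unfolding fn[OF u] fn[OF v] using v[unfolded dom] by (intro ennreal_leI lsol_minimal g g0) auto
    then show "is_arg_min (functional b m \<phi> W g) (\<lambda>v. v \<in> functional_dom b m \<phi> W g) ?u"
      unfolding is_arg_min_def using u leD by blast
    fix v assume "is_arg_min (functional b m \<phi> W g) (\<lambda>v. v \<in> functional_dom b m \<phi> W g) v"
    then have v: "v \<in> functional_dom b m \<phi> W g" "\<not> functional b m \<phi> W g ?u < functional b m \<phi> W g v"
      using u by (auto simp: is_arg_min_def)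
    then have "en v + kap g v \<le> en ?u + kap g ?u"
      unfolding fn[OF u] fn[OF v(1)] by (simp add: ennreal_less_iff not_less del: ennreal_plus)
    then show "v = ?u" using v(1) unfolding dom by (intro lsol_minimizer_unique g g0) auto
  qed
qed

end

section \<open>The heat semigroup\<close>

context wgraph
begin

text \<open>Multiplication by \<open>sqrt (m x)\<close> is an isometry of \<open>l2 m\<close> onto
  the unweighted space. Outside \<open>l2 m\<close> the value is unspecified.\<close>

definition emb :: "('a \<Rightarrow> real) \<Rightarrow> 'a ell2" where
  "emb f = Ell2 (\<lambda>x. f x * sqrt (m x))"

definition unemb :: "'a ell2 \<Rightarrow> 'a \<Rightarrow> real" where
  "unemb v = (\<lambda>x. coord v x / sqrt (m x))"

lemma coord_emb: "f \<in> l2 m \<Longrightarrow> coord (emb f) x = f x * sqrt (m x)"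
  unfolding emb_def by (subst Ell2_inverse) (simp_all add: l2_def power_mult_distrib)

lemma unemb_emb: "f \<in> l2 m \<Longrightarrow> unemb (emb f) = f"
  by (simp add: unemb_def coord_emb)

lemma unemb_l2 [simp]: "unemb v \<in> l2 m"
  using coord_summable[of v] by (simp add: l2_def unemb_def power_divide)

lemma coord_eqI: "(\<And>x. coord v x = coord w x) \<Longrightarrow> v = w"
  by transfer (auto simp: fun_eq_iff)

lemma emb_unemb [simp]: "emb (unemb v) = v"
  by (rule coord_eqI) (simp add: coord_emb, simp add: unemb_def)

lemma unemb_simps: "unemb (v + w) = (\<lambda>x. unemb v x + unemb w x)"
  "unemb (v - w) = (\<lambda>x. unemb v x - unemb w x)" "unemb (r *\<^sub>R v) = (\<lambda>x. r * unemb v x)"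
  "unemb (- v) = (\<lambda>x. - unemb v x)" "unemb 0 = (\<lambda>_. 0)"
  by (simp_all add: unemb_def add_divide_distrib diff_divide_distrib)

lemma emb_eqI: "unemb v = f \<Longrightarrow> emb f = v" by auto

lemma emb_simps:
  assumes "f \<in> l2 m" "g \<in> l2 m"
  shows "emb (\<lambda>x. f x + g x) = emb f + emb g" "emb (\<lambda>x. f x - g x) = emb f - emb g"
    "emb (\<lambda>x. r * f x) = r *\<^sub>R emb f" "emb (\<lambda>x. - f x) = - emb f"
  by (rule emb_eqI; simp add: unemb_simps unemb_emb assms)+

lemma l2_closed:
  assumes "f \<in> l2 m" "g \<in> l2 m"
  shows "(\<lambda>x. f x + g x) \<in> l2 m" "(\<lambda>x. f x - g x) \<in> l2 m"
    "(\<lambda>x. r * f x) \<in> l2 m" "(\<lambda>x. - f x) \<in> l2 m"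
  using unemb_l2[of "emb f + emb g"] unemb_l2[of "emb f - emb g"] unemb_l2[of "r *\<^sub>R emb f"] unemb_l2[of "- emb f"]
  by (simp_all only: unemb_simps unemb_emb assms)

lemma l2_inner_emb: "f \<in> l2 m \<Longrightarrow> g \<in> l2 m \<Longrightarrow> l2_inner m f g = inner (emb f) (emb g)"
  unfolding inner_ell2.rep_eq l2_inner_def
  by (intro infsum_cong) (simp add: coord_emb mult_ac flip: mult.assoc[of "sqrt _" "sqrt _"])

lemma l2_norm_emb: "f \<in> l2 m \<Longrightarrow> l2_norm m f = norm (emb f)"
  unfolding l2_norm_def by (simp add: l2_inner_emb norm_eq_sqrt_inner)

lemma fin_supp_l2: "f \<in> fin_supp \<Longrightarrow> f \<in> l2 m"
  unfolding l2_def mem_Collect_eq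
  by (rule fin_supp_summable) (auto simp: fin_supp_def elim!: finite_subset[rotated])

lemma l2_mono: "g \<in> l2 m \<Longrightarrow> (\<And>x. \<bar>f x\<bar> \<le> \<bar>g x\<bar>) \<Longrightarrow> f \<in> l2 m"
  unfolding l2_def mem_Collect_eq
  by (rule summable_on_comparison_test[where f = "\<lambda>x. (g x)\<^sup>2 * m x"])
    (auto intro!: mult_right_mono simp: abs_le_square_iff[symmetric])

definition cutoff :: "nat \<Rightarrow> ('a \<Rightarrow> real) \<Rightarrow> 'a \<Rightarrow> real" where
  "cutoff n f = (\<lambda>x. if x \<in> exhaust n then f x else 0)"

lemma cutoff_fin_supp [simp]: "cutoff n f \<in> fin_supp"
  by (rule fin_suppI[OF finite_exhaust[of n]]) (simp add: cutoff_def)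

lemma cutoff_eventually: "eventually (\<lambda>n. cutoff n f x = f x) sequentially"
  using eventually_in_exhaust[of x] by (rule eventually_mono) (simp add: cutoff_def)

text \<open>A cutoff is an orthogonal projection, so the squared distance is a difference of squared
  norms, and Fatou's lemma bounds the norms of the cutoffs from below.\<close>

lemma emb_cutoff_tendsto:
  assumes f: "f \<in> l2 m" shows "(\<lambda>n. emb (cutoff n f)) \<longlonglongrightarrow> emb f"
proof (rule metric_LIMSEQ_I)
  fix e :: real assume e: "0 < e"
  let ?v = "emb f" and ?c = "\<lambda>n. emb (cutoff n f)"
  have c: "coord (?c n) x = (if x \<in> exhaust n then coord ?v x else 0)" for n x
    by (simp add: coord_emb fin_supp_l2 f) (simp add: cutoff_def)
  have "(\<lambda>n. (coord (?c n) x)\<^sup>2) \<longlonglongrightarrow> (coord ?v x)\<^sup>2" for x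
    by (rule tendsto_eventually, rule eventually_mono[OF eventually_in_exhaust[of x]]) (simp add: c)
  then have "eventually (\<lambda>n. (\<Sum>\<^sub>\<infinity>x. (coord (?c n) x)\<^sup>2) \<ge> (\<Sum>\<^sub>\<infinity>x. (coord ?v x)\<^sup>2) - e\<^sup>2 / 2) sequentially"
    by (intro infsum_eventually_ge coord_summable) (use e in simp_all)
  then obtain N where N: "\<And>n. n \<ge> N \<Longrightarrow> (norm (?c n))\<^sup>2 \<ge> (norm ?v)\<^sup>2 - e\<^sup>2 / 2"
    by (auto simp: eventually_sequentially norm_ell2_square)
  have "dist (?c n) ?v < e" if "n \<ge> N" for n
  proof -
    have "inner (?c n) ?v = inner (?c n) (?c n)"
      unfolding inner_ell2.rep_eq by (intro infsum_cong) (simp add: c)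
    then have "(norm (?c n - ?v))\<^sup>2 = (norm ?v)\<^sup>2 - (norm (?c n))\<^sup>2"
      by (simp add: power2_norm_eq_inner inner_diff_left inner_diff_right inner_commute)
    also have "\<dots> < e\<^sup>2" using N[OF that] e zero_less_power[of e 2] by linarith
    finally show ?thesis using e by (simp add: dist_norm power2_less_imp_less)
  qed
  then show "\<exists>N. \<forall>n\<ge>N. dist (?c n) ?v < e" by blast
qed

subsection \<open>The linear resolvent\<close>

lemma nonlin_linear: assumes "0 < \<alpha>" shows "nonlin b m (\<lambda>s. s) (\<lambda>_. \<alpha>)"
proof
  show "(\<lambda>s. s) \<in> nonlinearities" by (simp add: nonlinearities_def strict_mono_def)
  show "(\<lambda>_. \<alpha>) \<in> weights" using assms by (simp add: weights_def)
qed

text \<open>The equation reads \<open>L u = f - \<alpha> * u\<close>, so this is the inverse of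
  \<open>L + \<alpha>\<close> applied to \<open>f\<close>, without a normalizing factor
  \<open>\<alpha>\<close>.\<close>

definition lres :: "real \<Rightarrow> ('a \<Rightarrow> real) \<Rightarrow> 'a \<Rightarrow> real" where
  "lres \<alpha> f = nonlin.lsol b m (\<lambda>s. s) (\<lambda>_. \<alpha>) f UNIV"

lemma quadratic_linear_coeff_zero:
  fixes B C :: real
  assumes "\<And>t. 0 \<le> 2 * t * B + t\<^sup>2 * C" "0 \<le> C" shows "B = 0"
proof -
  have C: "0 < C + 1" using assms(2) by simp
  \<comment> \<open>Near the minimizer of the quadratic; \<open>C + 1\<close> in place of
    \<open>C\<close> avoids a case distinction for \<open>C = 0\<close>.\<close>
  have "0 \<le> 2 * (- B / (C + 1)) * B + (- B / (C + 1))\<^sup>2 * C" by (rule assms(1))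
  also have "\<dots> = - (B\<^sup>2 * (C + 2)) / (C + 1)\<^sup>2"
    using C by (simp add: divide_simps power2_eq_square) (simp add: algebra_simps)
  finally have "B\<^sup>2 * (C + 2) \<le> 0" using C by (simp add: divide_le_0_iff)
  then show ?thesis using assms(2) by (auto simp: mult_le_0_iff)
qed

text \<open>For the identity the functional is quadratic. Perturbing the minimizer by
  \<open>t * h\<close> gives a quadratic in \<open>t\<close> that is never negative, and its
  vanishing linear coefficient is the weak equation tested with \<open>h\<close>.\<close>

lemma lres_form_operator:
  assumes a: "0 < \<alpha>" and f: "f \<in> l2 m" "\<And>x. 0 \<le> f x"
  shows "form_operator b m (lres \<alpha> f) (\<lambda>x. f x - \<alpha> * lres \<alpha> f x)"
proof -
  interpret L: nonlin b m "\<lambda>s. s" "\<lambda>_. \<alpha>" by (rule nonlin_linear[OF a])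
  note L.phi_0 [simp del] \<comment> \<open>reads \<open>0 = 0\<close> here and makes the simplifier loop\<close>
  let ?u = "lres \<alpha> f"
  have prim: "primitive (\<lambda>s. s) s = s\<^sup>2" for s
  proof -
    have sq: "((\<lambda>x. x\<^sup>2) has_real_derivative 2 * x) (at x)" for x :: real
      using DERIV_power[OF DERIV_ident, of 2 x] by simp
    have "((\<lambda>x. primitive (\<lambda>s. s) x - x\<^sup>2) has_real_derivative 2 * x - 2 * x) (at x)" for x
      by (rule DERIV_diff[OF L.prim_deriv sq])
    then have "((\<lambda>x. primitive (\<lambda>s. s) x - x\<^sup>2) has_real_derivative 0) (at x)" for x
      by (simp only: diff_self)
    from DERIV_isconst_all[OF allI[OF this], of s 0] show ?thesis by simp
  qed
  have kterm: "L.kterm f v x = (1 / \<alpha>) * ((f x - \<alpha> * v x)\<^sup>2 * m x)" for v x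
    by (simp add: L.kterm_def prim)
  have fin_kap: "L.fin_kap f v \<longleftrightarrow> (\<lambda>x. f x - \<alpha> * v x) \<in> l2 m" for v
    unfolding L.fin_kap_def kterm[abs_def] l2_def by (subst summable_on_cmult_right') (use a in simp_all)
  have kap: "L.kap f v = (norm (emb (\<lambda>x. f x - \<alpha> * v x)))\<^sup>2 / \<alpha>" if "(\<lambda>x. f x - \<alpha> * v x) \<in> l2 m" for v
    unfolding power2_norm_eq_inner l2_inner_emb[OF that that, symmetric] L.kap_def kterm[abs_def] l2_inner_def
    by (subst infsum_cmult_right') (simp add: power2_eq_square)
  have g0: "L.fin_kap f (\<lambda>_. 0)" using f(1) by (simp add: fin_kap)
  have ue: "?u \<in> energy0 b" unfolding lres_def by (rule L.lsol_energy0[OF f(2) g0])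
  have zero: "(\<lambda>_. 0) \<in> energy0 b" by (rule fin_supp_energy0) (simp add: fin_supp_def)
  have r: "(\<lambda>x. f x - \<alpha> * ?u x) \<in> l2 m"
    using L.lsol_fin_kap[OF f(2) g0 zero g0] by (simp add: fin_kap lres_def)
  have u: "?u \<in> l2 m"
    using l2_closed(3)[OF l2_closed(2)[OF f(1) r] f(1), of "1 / \<alpha>"] a by simp
  let ?r = "\<lambda>x. f x - \<alpha> * ?u x"
  have "energy_form b ?u h = l2_inner m ?r h" if h: "h \<in> form_dom b m" for h
  proof -
    have he: "h \<in> energy0 b" and hl: "h \<in> l2 m" using h by (auto simp: form_dom_def)
    have "0 \<le> 2 * t * (energy_form b ?u h - inner (emb ?r) (emb h)) + t\<^sup>2 * (en h + \<alpha> * (norm (emb h))\<^sup>2)" for t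
    proof -
      let ?w = "\<lambda>x. ?u x + t * h x"
      have we: "?w \<in> energy0 b" by (intro energy0_add ue energy0_cmult he)
      have rw: "(\<lambda>x. f x - \<alpha> * ?w x) = (\<lambda>x. ?r x - (\<alpha> * t) * h x)" by (simp add: fun_eq_iff algebra_simps)
      have rwl: "(\<lambda>x. f x - \<alpha> * ?w x) \<in> l2 m" unfolding rw by (rule l2_closed(2)[OF r l2_closed(3)[OF hl hl]])
      have nrm: "(norm (x - c *\<^sub>R y))\<^sup>2 = (norm x)\<^sup>2 - 2 * c * inner x y + c\<^sup>2 * (norm y)\<^sup>2" for x y :: "'a ell2" and c
        unfolding power2_norm_eq_inner by (simp add: inner_diff_left inner_diff_right inner_commute power2_eq_square algebra_simps)
      have eq: "emb (\<lambda>x. f x - \<alpha> * ?w x) = emb ?r - (\<alpha> * t) *\<^sub>R emb h"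
        unfolding rw using emb_simps(2)[OF r l2_closed(3)[OF hl hl]] emb_simps(3)[OF hl hl] by simp
      have "L.kap f ?w = ((norm (emb ?r))\<^sup>2 - 2 * (\<alpha> * t) * inner (emb ?r) (emb h) + (\<alpha> * t)\<^sup>2 * (norm (emb h))\<^sup>2) / \<alpha>"
        unfolding kap[OF rwl] eq nrm ..
      also have "\<dots> = L.kap f ?u - 2 * t * inner (emb ?r) (emb h) + t\<^sup>2 * \<alpha> * (norm (emb h))\<^sup>2"
        using a by (simp add: kap[OF r] field_simps power2_eq_square)
      finally have k: "L.kap f ?w = L.kap f ?u - 2 * t * inner (emb ?r) (emb h) + t\<^sup>2 * \<alpha> * (norm (emb h))\<^sup>2" .
      have e: "en ?w = en ?u + 2 * t * energy_form b ?u h + t\<^sup>2 * en h"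
        using en_add[OF energy0_fin_en[OF ue] fin_en_cmult[OF energy0_fin_en[OF he], of t]]
          energy_form_cmult[of t h ?u] en_cmult[of t h]
        by (simp add: energy_form_commute[of ?u])
      have "en ?u + L.kap f ?u \<le> en ?w + L.kap f ?w"
        using L.lsol_minimal[OF f(2) g0 we] rwl by (simp add: fin_kap lres_def)
      then show ?thesis unfolding k e by (simp add: algebra_simps)
    qed
    then have "energy_form b ?u h - inner (emb ?r) (emb h) = 0"
      by (rule quadratic_linear_coeff_zero) (use a in simp)
    then show ?thesis by (simp add: l2_inner_emb r hl)
  qed
  then show ?thesis unfolding form_operator_def using r u ue by (simp add: form_dom_def)
qed

lemma form_domD: "f \<in> form_dom b m \<Longrightarrow> f \<in> l2 m" "f \<in> form_dom b m \<Longrightarrow> f \<in> energy0 b"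
  "f \<in> form_dom b m \<Longrightarrow> fin_en f"
  by (auto simp: form_dom_def energy0_fin_en)

lemma form_operator_l2: "form_operator b m f g \<Longrightarrow> f \<in> l2 m" "form_operator b m f g \<Longrightarrow> g \<in> l2 m"
  by (auto simp: form_operator_def form_dom_def)

lemma form_operator_add:
  assumes A: "form_operator b m f g" and B: "form_operator b m f' g'"
  shows "form_operator b m (\<lambda>x. f x + f' x) (\<lambda>x. g x + g' x)"
  unfolding form_operator_def
proof (intro conjI ballI)
  have d: "f \<in> form_dom b m" "f' \<in> form_dom b m" and l: "g \<in> l2 m" "g' \<in> l2 m"
    using A B by (auto simp: form_operator_def)
  show "(\<lambda>x. f x + f' x) \<in> form_dom b m"
    using d by (auto simp: form_dom_def intro: energy0_add l2_closed)
  show gl: "(\<lambda>x. g x + g' x) \<in> l2 m" by (rule l2_closed(1)[OF l])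
  fix h assume h: "h \<in> form_dom b m"
  have "energy_form b (\<lambda>x. f x + f' x) h = l2_inner m g h + l2_inner m g' h"
    using A B h d by (simp add: energy_form_add form_domD form_operator_def)
  then show "energy_form b (\<lambda>x. f x + f' x) h = l2_inner m (\<lambda>x. g x + g' x) h"
    using l gl form_domD(1)[OF h] by (simp add: l2_inner_emb emb_simps inner_add_left)
qed

lemma form_operator_cmult:
  assumes A: "form_operator b m f g" shows "form_operator b m (\<lambda>x. c * f x) (\<lambda>x. c * g x)"
  unfolding form_operator_def
proof (intro conjI ballI)
  have d: "f \<in> form_dom b m" and l: "g \<in> l2 m" using A by (auto simp: form_operator_def)
  show "(\<lambda>x. c * f x) \<in> form_dom b m"
    using d by (auto simp: form_dom_def intro: energy0_cmult l2_closed)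
  show gl: "(\<lambda>x. c * g x) \<in> l2 m" by (rule l2_closed(3)[OF l l])
  fix h assume h: "h \<in> form_dom b m"
  have "energy_form b (\<lambda>x. c * f x) h = c * l2_inner m g h"
    using A h by (simp add: energy_form_cmult form_operator_def)
  then show "energy_form b (\<lambda>x. c * f x) h = l2_inner m (\<lambda>x. c * g x) h"
    using l gl form_domD(1)[OF h] by (simp add: l2_inner_emb emb_simps(3)[OF l l])
qed

text \<open>Least solutions were treated for nonnegative data, so the positive and negative parts
  are solved separately.\<close>

lemma form_operator_resolvent:
  assumes a: "0 < \<alpha>" and f: "f \<in> l2 m"
  shows "\<exists>u. form_operator b m u (\<lambda>x. f x - \<alpha> * u x)"
proof -
  let ?p = "\<lambda>x. max (f x) 0" and ?q = "\<lambda>x. max (- f x) 0"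
  have p: "?p \<in> l2 m" and q: "?q \<in> l2 m" by (rule l2_mono[OF f]; simp add: max_def)+
  let ?u = "\<lambda>x. lres \<alpha> ?p x + - 1 * lres \<alpha> ?q x"
  have "form_operator b m ?u (\<lambda>x. (?p x - \<alpha> * lres \<alpha> ?p x) + - 1 * (?q x - \<alpha> * lres \<alpha> ?q x))"
    by (rule form_operator_add[OF lres_form_operator[OF a p] form_operator_cmult[OF lres_form_operator[OF a q]]]) auto
  moreover have "(\<lambda>x. (?p x - \<alpha> * lres \<alpha> ?p x) + - 1 * (?q x - \<alpha> * lres \<alpha> ?q x)) = (\<lambda>x. f x - \<alpha> * ?u x)"
    by (auto simp: fun_eq_iff max_def algebra_simps)
  ultimately have u: "form_operator b m ?u (\<lambda>x. f x - \<alpha> * ?u x)" by simp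
  show ?thesis
  proof
    show "form_operator b m ?u (\<lambda>x. f x - \<alpha> * ?u x)" by (rule u)
  qed
qed

text \<open>The operator \<open>- L\<close> carried over to the unweighted space; the sign makes it
  dissipative.\<close>

definition opA :: "('a ell2 \<times> 'a ell2) set" where
  "opA = {(emb f, - emb g) | f g. form_operator b m f g}"

lemma opA_iff: "(v, w) \<in> opA \<longleftrightarrow> form_operator b m (unemb v) (\<lambda>x. - unemb w x)"
proof
  assume "(v, w) \<in> opA"
  then obtain f g where fg: "form_operator b m f g" "v = emb f" "w = - emb g" by (auto simp: opA_def)
  then show "form_operator b m (unemb v) (\<lambda>x. - unemb w x)"
    by (simp add: unemb_emb unemb_simps form_operator_l2)
next
  assume "form_operator b m (unemb v) (\<lambda>x. - unemb w x)"
  moreover have "emb (\<lambda>x. - unemb w x) = - w" using emb_simps(4)[OF unemb_l2 unemb_l2, of w] by simp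
  ultimately show "(v, w) \<in> opA" unfolding opA_def by force
qed

lemma opA_emb:
  assumes f: "f \<in> l2 m" and g: "g \<in> l2 m"
  shows "(emb f, emb (\<lambda>x. - g x)) \<in> opA \<longleftrightarrow> form_operator b m f g"
proof -
  have "unemb (emb f) = f" by (rule unemb_emb[OF f])
  moreover have "unemb (emb (\<lambda>x. - g x)) = (\<lambda>x. - g x)" by (rule unemb_emb) (use g in \<open>simp add: l2_def\<close>)
  ultimately show ?thesis by (simp only: opA_iff minus_minus)
qed

sublocale heat: mdissipative opA
proof
  show "subspace opA"
    unfolding subspace_def
  proof (intro conjI ballI allI)
    have z: "form_operator b m (\<lambda>_. 0) (\<lambda>_. 0)"
    proof -
      have "form_operator b m (lres 1 (\<lambda>_. 0)) (\<lambda>x. 0 - 1 * lres 1 (\<lambda>_. 0) x)"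
        by (rule lres_form_operator) (auto simp: l2_def)
      from form_operator_cmult[OF this, of 0] show ?thesis by simp
    qed
    then show "0 \<in> opA" by (simp add: zero_prod_def opA_iff unemb_simps)
    fix p assume p: "p \<in> opA"
    obtain v w where vw: "p = (v, w)" by (cases p)
    then have fo: "form_operator b m (unemb v) (\<lambda>x. - unemb w x)" using p by (simp add: opA_iff)
    show "c *\<^sub>R p \<in> opA" for c using form_operator_cmult[OF fo, of c] by (simp add: vw opA_iff unemb_simps)
    fix q assume q: "q \<in> opA"
    obtain v' w' where vw': "q = (v', w')" by (cases q)
    then have fo': "form_operator b m (unemb v') (\<lambda>x. - unemb w' x)" using q by (simp add: opA_iff)
    show "p + q \<in> opA" using form_operator_add[OF fo fo'] by (simp add: vw vw' opA_iff unemb_simps)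
  qed
next
  fix v w :: "'a ell2" and l :: real assume vw: "(v, w) \<in> opA" and l: "0 < l"
  have fo: "form_operator b m (unemb v) (\<lambda>x. - unemb w x)" using vw by (simp add: opA_iff)
  \<comment> \<open>Testing the form with \<open>v\<close> itself shows that
    \<open>inner w v\<close> is minus an energy; Cauchy-Schwarz then yields dissipativity.\<close>
  then have "en (unemb v) = l2_inner m (\<lambda>x. - unemb w x) (unemb v)"
    unfolding form_operator_def energy_form_self[symmetric] by blast
  also have "\<dots> = - inner w v"
    using emb_simps(4)[OF unemb_l2 unemb_l2, of w] by (simp add: l2_inner_emb l2_closed[OF unemb_l2 unemb_l2])
  finally have "inner w v \<le> 0" using en_nonneg[of "unemb v"] by simp
  then have "(norm v)\<^sup>2 \<le> inner (v - l *\<^sub>R w) v"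
    using l by (simp add: power2_norm_eq_inner inner_diff_left mult_nonneg_nonpos)
  also have "\<dots> \<le> norm (v - l *\<^sub>R w) * norm v" by (rule norm_cauchy_schwarz)
  finally have "norm v * norm v \<le> norm (v - l *\<^sub>R w) * norm v" by (simp add: power2_eq_square)
  then show "norm v \<le> norm (v - l *\<^sub>R w)"
    by (cases "norm v = 0") (auto dest: mult_right_le_imp_le)
next
  fix w :: "'a ell2" and l :: real assume l: "0 < l"
  have l': "0 < 1 / l" using l by simp
  obtain u where u: "form_operator b m u (\<lambda>x. unemb ((1 / l) *\<^sub>R w) x - (1 / l) * u x)"
    using form_operator_resolvent[OF l' unemb_l2] by blast
  have ul: "u \<in> l2 m" by (rule form_operator_l2[OF u])
  have "(emb u, (1 / l) *\<^sub>R (emb u - w)) \<in> opA"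
    using u by (simp add: opA_iff unemb_emb[OF ul] unemb_simps algebra_simps)
  moreover have "emb u - l *\<^sub>R ((1 / l) *\<^sub>R (emb u - w)) = w" using l by simp
  ultimately show "\<exists>x y. (x, y) \<in> opA \<and> x - l *\<^sub>R y = w" by blast
next
  have approx: "\<exists>u\<in>Domain opA. norm (u - emb f) < e" if f: "f \<in> fin_supp" and e: "0 < e" for f e
  proof -
    note fl = fin_supp_l2[OF f]
    \<comment> \<open>Chosen so that the estimate
      \<open>\<alpha> * (norm (emb u - emb f))\<^sup>2 < en f + 1\<close> reached below becomes
      distance less than \<open>e\<close>; the added 1 keeps \<open>\<alpha>\<close>
      positive.\<close>
    define \<alpha> where "\<alpha> = (en f + 1) / e\<^sup>2"
    have a: "0 < \<alpha>" using e en_nonneg[of f] by (simp add: \<alpha>_def add_nonneg_pos)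
    obtain u where u: "form_operator b m u (\<lambda>x. \<alpha> * f x - \<alpha> * u x)"
      using form_operator_resolvent[OF a, of "\<lambda>x. \<alpha> * f x"] l2_closed(3)[OF fl fl] by auto
    have ul: "u \<in> l2 m" and ue: "fin_en u" and ud: "u \<in> form_dom b m" using u by (auto simp: form_operator_def form_domD)
    note fe = fin_supp_fin_en[OF f]
    have fd: "f \<in> form_dom b m" using fl fin_supp_energy0[OF f] by (simp add: form_dom_def)
    have "(\<lambda>x. u x - f x) \<in> form_dom b m"
      using energy0_add[OF form_domD(2)[OF ud] energy0_cmult[OF form_domD(2)[OF fd], of "-1"]] l2_closed(2)[OF ul fl]
      by (simp add: form_dom_def)
    then have "energy_form b u (\<lambda>x. u x - f x) = l2_inner m (\<lambda>x. \<alpha> * f x - \<alpha> * u x) (\<lambda>x. u x - f x)"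
      using u by (simp add: form_operator_def)
    also have "(\<lambda>x. \<alpha> * f x - \<alpha> * u x) = (\<lambda>x. (- \<alpha>) * (u x - f x))" by (simp add: fun_eq_iff algebra_simps)
    also have "l2_inner m (\<lambda>x. (- \<alpha>) * (u x - f x)) (\<lambda>x. u x - f x) = - \<alpha> * (norm (emb u - emb f))\<^sup>2"
    proof -
      note d = l2_closed(2)[OF ul fl]
      show ?thesis
        unfolding l2_inner_emb[OF l2_closed(3)[OF d d] d] emb_simps(3)[OF d d] emb_simps(2)[OF ul fl]
        by (simp add: power2_norm_eq_inner)
    qed
    finally have 1: "energy_form b u (\<lambda>x. u x - f x) = - \<alpha> * (norm (emb u - emb f))\<^sup>2" .
    have 2: "energy_form b u (\<lambda>x. u x - f x) = en u - energy_form b u f"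
      using energy_form_add[OF ue fin_en_cmult[OF fe, of "-1"] ue] energy_form_cmult[of "-1" f u]
      by (simp add: energy_form_self energy_form_commute[of u])
    \<comment> \<open>Completing the square: \<open>energy_form b u f - en u\<close> is at most
      \<open>en f / 4\<close>, which removes the unknown \<open>u\<close> from the bound.\<close>
    have "0 \<le> en (\<lambda>x. u x + (- (1/2)) * f x)" by simp
    also have "\<dots> = en u - energy_form b u f + en f / 4"
      using en_add[OF ue fin_en_cmult[OF fe, of "- (1/2)"]] energy_form_cmult[of "- (1/2)" f u] en_cmult[of "- (1/2)" f]
      by (simp add: energy_form_commute[of u] power2_eq_square)
    finally have "\<alpha> * (norm (emb u - emb f))\<^sup>2 \<le> en f / 4" using 1 2 by simp
    also have "\<dots> < en f + 1" using en_nonneg[of f] by linarith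
    also have "\<dots> = \<alpha> * e\<^sup>2" using e by (simp add: \<alpha>_def)
    finally have "norm (emb u - emb f) < e" using a e by (simp add: power2_less_imp_less)
    moreover have "emb u \<in> Domain opA" using u unfolding opA_def by blast
    ultimately show ?thesis by blast
  qed
  show "closure (Domain opA) = UNIV"
  proof (intro set_eqI iffI UNIV_I)
    fix v :: "'a ell2"
    show "v \<in> closure (Domain opA)"
      unfolding closure_approachable
    proof (intro allI impI)
      fix e :: real assume e: "0 < e"
      obtain n where n: "dist (emb (cutoff n (unemb v))) v < e / 2"
        using metric_LIMSEQ_D[OF emb_cutoff_tendsto[OF unemb_l2], of "e/2" v] e by auto
      obtain u where "u \<in> Domain opA" "norm (u - emb (cutoff n (unemb v))) < e / 2"
        using approx[OF cutoff_fin_supp, of "e/2" n "unemb v"] e by auto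
      then show "\<exists>u\<in>Domain opA. dist u v < e"
        using n dist_triangle[of u v "emb (cutoff n (unemb v))"] by (intro bexI[of _ u]) (auto simp: dist_norm)
    qed
  qed
qed

abbreviation heat_op :: "real \<Rightarrow> ('a \<Rightarrow> real) \<Rightarrow> 'a \<Rightarrow> real" where
  "heat_op t f \<equiv> unemb (heat.sg t (emb f))"

section \<open>Identification of \<open>heat_semigroup\<close> with the constructed
  semigroup\<close>

lemma generator_iff:
  assumes T: "\<And>t f. 0 \<le> t \<Longrightarrow> f \<in> l2 m \<Longrightarrow> T t f \<in> l2 m"
  shows "generator m T f g \<longleftrightarrow> f \<in> l2 m \<and> g \<in> l2 m \<and> (emb f, emb g) \<in> sg_gen (\<lambda>t v. emb (T t (unemb v)))"
proof -
  have "((\<lambda>t. l2_norm m (\<lambda>x. (T t f x - f x) / t - g x)) \<longlongrightarrow> 0) (at_right 0) \<longleftrightarrow>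
      ((\<lambda>t. (emb (T t f) - emb f) /\<^sub>R t) \<longlongrightarrow> emb g) (at_right 0)" if f: "f \<in> l2 m" and g: "g \<in> l2 m"
  proof -
    have "l2_norm m (\<lambda>x. (T t f x - f x) / t - g x) = norm ((emb (T t f) - emb f) /\<^sub>R t - emb g)" if t: "0 < t" for t
    proof -
      have Tf: "T t f \<in> l2 m" by (rule T) (use t f in auto)
      let ?v = "(emb (T t f) - emb f) /\<^sub>R t - emb g"
      have eq: "unemb ?v = (\<lambda>x. (T t f x - f x) / t - g x)"
        by (simp add: unemb_simps unemb_emb Tf f g divide_inverse mult.commute)
      show ?thesis unfolding eq[symmetric] l2_norm_emb[OF unemb_l2] emb_unemb ..
    qed
    then have "eventually (\<lambda>t. l2_norm m (\<lambda>x. (T t f x - f x) / t - g x) = norm ((emb (T t f) - emb f) /\<^sub>R t - emb g)) (at_right 0)"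
      by (auto intro: eventually_mono[OF eventually_at_right_less])
    then have "((\<lambda>t. l2_norm m (\<lambda>x. (T t f x - f x) / t - g x)) \<longlongrightarrow> 0) (at_right 0) \<longleftrightarrow>
        ((\<lambda>t. norm ((emb (T t f) - emb f) /\<^sub>R t - emb g)) \<longlongrightarrow> 0) (at_right 0)"
      by (rule tendsto_cong)
    then show ?thesis by (simp add: tendsto_norm_zero_iff LIM_zero_iff)
  qed
  then show ?thesis unfolding generator_def sg_gen_def by (auto simp: unemb_emb)
qed

lemma generator_opA_iff:
  assumes "\<And>t f. 0 \<le> t \<Longrightarrow> f \<in> l2 m \<Longrightarrow> T t f \<in> l2 m"
  shows "(\<forall>f g. generator m T f (\<lambda>x. - g x) \<longleftrightarrow> form_operator b m f g) \<longleftrightarrow>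
    sg_gen (\<lambda>t v. emb (T t (unemb v))) = opA" (is "?L \<longleftrightarrow> ?G = opA")
proof
  assume L: ?L
  show "?G = opA"
  proof (intro set_eqI)
    fix p :: "'a ell2 \<times> 'a ell2"
    obtain v w where p: "p = (v, w)" by (cases p)
    have "p \<in> ?G \<longleftrightarrow> generator m T (unemb v) (unemb w)"
      by (simp add: generator_iff[OF assms] p)
    also have "\<dots> \<longleftrightarrow> form_operator b m (unemb v) (\<lambda>x. - unemb w x)"
      using L[rule_format, of "unemb v" "\<lambda>x. - unemb w x"] by simp
    finally show "p \<in> ?G \<longleftrightarrow> p \<in> opA" by (simp add: p opA_iff)
  qed
next
  assume G: "?G = opA"
  show ?L
  proof (intro allI)
    fix f g
    have "(\<lambda>x. - g x) \<in> l2 m \<longleftrightarrow> g \<in> l2 m" by (simp add: l2_def)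
    moreover have "generator m T f (\<lambda>x. - g x) \<longleftrightarrow> f \<in> l2 m \<and> (\<lambda>x. - g x) \<in> l2 m \<and> (emb f, emb (\<lambda>x. - g x)) \<in> opA"
      unfolding G[symmetric] by (rule generator_iff[OF assms])
    ultimately show "generator m T f (\<lambda>x. - g x) \<longleftrightarrow> form_operator b m f g"
      using opA_emb[of f g] form_operator_l2[of f g] by auto
  qed
qed

lemma c0_semigroup_heat: "c0_semigroup m heat_op"
proof -
  note bl = heat.sg_bounded_linear
  have "l2_norm m (\<lambda>x. heat_op t f x - f x) = norm (heat.sg t (emb f) - emb f)" if f: "f \<in> l2 m" for t f
  proof -
    have "(\<lambda>x. heat_op t f x - f x) = unemb (heat.sg t (emb f) - emb f)"
      by (simp add: unemb_simps unemb_emb f)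
    then show ?thesis by (simp add: l2_norm_emb)
  qed
  moreover have "((\<lambda>t. norm (heat.sg t v - v)) \<longlongrightarrow> 0) (at_right 0)" for v
    using heat.sg_tendsto[of v] by (simp add: tendsto_norm_zero_iff LIM_zero_iff)
  moreover have "heat.sg 0 v = v" for v using heat.c0_sg by (simp add: c0_sg_def)
  moreover have "\<exists>C. \<forall>f\<in>l2 m. l2_norm m (heat_op t f) \<le> C * l2_norm m f" if "0 \<le> t" for t
    by (rule exI[of _ 1]) (simp add: l2_norm_emb heat.norm_sg that)
  ultimately show ?thesis
    unfolding c0_semigroup_def
    by (simp add: emb_simps unemb_emb heat.sg_add linear_add[OF bounded_linear.linear[OF bl]]
        linear_scale[OF bounded_linear.linear[OF bl]] unemb_simps)
qed

lemma c0_semigroupD: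
  assumes "c0_semigroup m T"
  shows "\<And>t f. 0 \<le> t \<Longrightarrow> f \<in> l2 m \<Longrightarrow> T t f \<in> l2 m"
    "\<And>t f g. 0 \<le> t \<Longrightarrow> f \<in> l2 m \<Longrightarrow> g \<in> l2 m \<Longrightarrow> T t (\<lambda>x. f x + g x) = (\<lambda>x. T t f x + T t g x)"
    "\<And>t f c. 0 \<le> t \<Longrightarrow> f \<in> l2 m \<Longrightarrow> T t (\<lambda>x. c * f x) = (\<lambda>x. c * T t f x)"
    "\<And>t. 0 \<le> t \<Longrightarrow> \<exists>C. \<forall>f\<in>l2 m. l2_norm m (T t f) \<le> C * l2_norm m f"
    "\<And>f. f \<in> l2 m \<Longrightarrow> T 0 f = f"
    "\<And>s t f. 0 \<le> s \<Longrightarrow> 0 \<le> t \<Longrightarrow> f \<in> l2 m \<Longrightarrow> T (s + t) f = T s (T t f)"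
    "\<And>f. f \<in> l2 m \<Longrightarrow> ((\<lambda>t. l2_norm m (\<lambda>x. T t f x - f x)) \<longlongrightarrow> 0) (at_right 0)"
proof -
  note c = assms[unfolded c0_semigroup_def]
  note c1 = conjunct2[OF c] and c2 = conjunct2[OF conjunct2[OF c]]
  note c3 = conjunct2[OF c2] note c4 = conjunct2[OF c3] note c5 = conjunct2[OF c4] note c6 = conjunct2[OF c5]
  show "\<And>t f. 0 \<le> t \<Longrightarrow> f \<in> l2 m \<Longrightarrow> T t f \<in> l2 m" by (rule conjunct1[OF c, rule_format])
  show "\<And>t f g. 0 \<le> t \<Longrightarrow> f \<in> l2 m \<Longrightarrow> g \<in> l2 m \<Longrightarrow> T t (\<lambda>x. f x + g x) = (\<lambda>x. T t f x + T t g x)"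
    by (rule conjunct1[OF c1, rule_format])
  show "\<And>t f c. 0 \<le> t \<Longrightarrow> f \<in> l2 m \<Longrightarrow> T t (\<lambda>x. c * f x) = (\<lambda>x. c * T t f x)"
    by (rule conjunct1[OF c2, rule_format])
  show "\<And>t. 0 \<le> t \<Longrightarrow> \<exists>C. \<forall>f\<in>l2 m. l2_norm m (T t f) \<le> C * l2_norm m f"
    by (rule conjunct1[OF c3, rule_format])
  show "\<And>f. f \<in> l2 m \<Longrightarrow> T 0 f = f" by (rule conjunct1[OF c4, rule_format])
  show "\<And>s t f. 0 \<le> s \<Longrightarrow> 0 \<le> t \<Longrightarrow> f \<in> l2 m \<Longrightarrow> T (s + t) f = T s (T t f)"
    by (rule conjunct1[OF c5, rule_format])
  show "\<And>f. f \<in> l2 m \<Longrightarrow> ((\<lambda>t. l2_norm m (\<lambda>x. T t f x - f x)) \<longlongrightarrow> 0) (at_right 0)"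
    by (rule c6[rule_format])
qed

lemma c0_sg_push:
  assumes "c0_semigroup m T" shows "c0_sg (\<lambda>t v. emb (T t (unemb v)))"
proof -
  note c0 = c0_semigroupD[OF assms]
  note l2 = c0(1)
  have "bounded_linear (\<lambda>v. emb (T t (unemb v)))" if t: "0 \<le> t" for t
  proof -
    obtain C where C: "\<And>f. f \<in> l2 m \<Longrightarrow> l2_norm m (T t f) \<le> C * l2_norm m f"
      using c0(4)[OF t] by blast
    show ?thesis
    proof (rule bounded_linear_intro[where K = C])
      fix v w :: "'a ell2" and r :: real
      have "T t (unemb (v + w)) = (\<lambda>x. T t (unemb v) x + T t (unemb w) x)"
        unfolding unemb_simps by (rule c0(2)[OF t unemb_l2 unemb_l2])
      then show "emb (T t (unemb (v + w))) = emb (T t (unemb v)) + emb (T t (unemb w))"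
        by (simp add: emb_simps l2 t)
      have "T t (unemb (r *\<^sub>R v)) = (\<lambda>x. r * T t (unemb v) x)"
        unfolding unemb_simps by (rule c0(3)[OF t unemb_l2])
      then show "emb (T t (unemb (r *\<^sub>R v))) = r *\<^sub>R emb (T t (unemb v))"
        using emb_simps(3)[OF l2[OF t unemb_l2] l2[OF t unemb_l2]] by simp
      show "norm (emb (T t (unemb v))) \<le> norm v * C"
        using C[of "unemb v"] by (simp add: l2_norm_emb l2 t mult.commute)
    qed
  qed
  moreover have "((\<lambda>t. emb (T t (unemb v))) \<longlongrightarrow> v) (at_right 0)" for v
  proof -
    have "eventually (\<lambda>t. l2_norm m (\<lambda>x. T t (unemb v) x - unemb v x) = norm (emb (T t (unemb v)) - v)) (at_right 0)"
    proof (rule eventually_mono[OF eventually_at_right_less])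
      fix t :: real assume t: "0 < t"
      have "l2_norm m (\<lambda>x. T t (unemb v) x - unemb v x) = norm (emb (\<lambda>x. T t (unemb v) x - unemb v x))"
        by (rule l2_norm_emb[OF l2_closed(2)[OF l2 unemb_l2]]) (use t in simp_all)
      also have "emb (\<lambda>x. T t (unemb v) x - unemb v x) = emb (T t (unemb v)) - v"
        using emb_simps(2)[OF l2[of t "unemb v"] unemb_l2] t by simp
      finally show "l2_norm m (\<lambda>x. T t (unemb v) x - unemb v x) = norm (emb (T t (unemb v)) - v)" .
    qed
    moreover have "((\<lambda>t. l2_norm m (\<lambda>x. T t (unemb v) x - unemb v x)) \<longlongrightarrow> 0) (at_right 0)"
      by (rule c0(7)[OF unemb_l2])
    ultimately have "((\<lambda>t. norm (emb (T t (unemb v)) - v)) \<longlongrightarrow> 0) (at_right 0)"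
      by (simp add: tendsto_cong)
    then show ?thesis by (simp add: tendsto_norm_zero_iff LIM_zero_iff)
  qed
  ultimately show ?thesis unfolding c0_sg_def by (simp add: unemb_emb l2 c0)
qed

text \<open>The constructed semigroup shows that the choice in \<open>heat_semigroup\<close> has a
  witness, and \<open>heat.sg_unique\<close> shows that every admissible choice agrees with it for
  nonnegative times on \<open>l2 m\<close>.\<close>

lemma heat_semigroup_eq:
  assumes t: "0 \<le> t" and f: "f \<in> l2 m"
  shows "heat_semigroup b m t f = heat_op t f"
proof -
  let ?P = "\<lambda>T. c0_semigroup m T \<and> (\<forall>f g. generator m T f (\<lambda>x. - g x) \<longleftrightarrow> form_operator b m f g)"
  have "?P heat_op"
  proof (rule conjI[OF c0_semigroup_heat])
    have "sg_gen (\<lambda>t v. emb (heat_op t (unemb v))) = opA"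
      unfolding emb_unemb by (rule heat.sg_gen_sg)
    then show "\<forall>f g. generator m heat_op f (\<lambda>x. - g x) \<longleftrightarrow> form_operator b m f g"
      using generator_opA_iff[of "heat_op", OF unemb_l2] by blast
  qed
  then have P: "?P (heat_semigroup b m)"
    unfolding heat_semigroup_def by (rule someI[of ?P "heat_op"])
  have l2: "heat_semigroup b m t f \<in> l2 m" if "0 \<le> t" "f \<in> l2 m" for t f
    by (rule c0_semigroupD(1)[OF conjunct1[OF P]]) (use that in auto)
  have "sg_gen (\<lambda>t v. emb (heat_semigroup b m t (unemb v))) = opA"
    by (rule generator_opA_iff[THEN iffD1, OF l2 conjunct2[OF P]])
  from heat.sg_unique[OF c0_sg_push[OF conjunct1[OF P]] this t, of "emb f"]
  have "emb (heat_semigroup b m t f) = heat.sg t (emb f)" by (simp add: unemb_emb f)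
  then show ?thesis using unemb_emb[OF l2[OF t f]] by simp
qed

end

text \<open>Formally the integrand is the derivative of \<open>exp (- s) * h (sg s x)\<close>. This
  is the fundamental theorem of calculus for the bounded approximations, followed by dominated
  convergence; the functional \<open>h\<close> keeps all integrals real-valued.\<close>

lemma (in mdissipative) sg_exp_integral:
  assumes xy: "(x, y) \<in> A" and h: "bounded_linear (h :: 'b \<Rightarrow> real)" and t: "0 \<le> t"
  shows "((\<lambda>s. exp (- s) * h (sg s (y - x))) has_integral (exp (- t) * h (sg t x) - h x)) {0..t}"
proof -
  interpret h: bounded_linear h by (rule h)
  let ?f = "\<lambda>n s. exp (- s) * h (ysg n s (bapp (yosida n) x - x))"
  obtain C where C: "0 < C" "\<And>z. norm (h z) \<le> norm z * C" using h.pos_bounded by blast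
  have I: "(?f n has_integral (exp (- t) * h (ysg n t x) - h x)) {0..t}" for n
  proof -
    have der: "((\<lambda>s. exp (- s) * h (ysg n s x)) has_vector_derivative ?f n s) (at s within {0..t})" for s
    proof -
      have "bounded_linear (\<lambda>B. h (bapp B x))" by (rule bounded_linear_compose[OF h bapp_bounded_linear_left])
      from bounded_linear.has_vector_derivative[OF this exp_scaleR_has_vector_derivative_right]
      have d: "((\<lambda>s. h (ysg n s x)) has_real_derivative h (ysg n s (bapp (yosida n) x))) (at s within {0..t})"
        by (simp add: ysg_def has_real_derivative_iff_has_vector_derivative)
      have e: "((\<lambda>s. exp (- s)) has_real_derivative - exp (- s)) (at s within {0..t})"
        by (auto intro!: derivative_eq_intros)
      have "((\<lambda>s. exp (- s) * h (ysg n s x)) has_real_derivative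
          - exp (- s) * h (ysg n s x) + h (ysg n s (bapp (yosida n) x)) * exp (- s)) (at s within {0..t})"
        by (rule DERIV_mult[OF e d])
      moreover have "- exp (- s) * h (ysg n s x) + h (ysg n s (bapp (yosida n) x)) * exp (- s) = ?f n s"
        by (simp add: ysg_def bapp_right_simps h.diff algebra_simps)
      ultimately show ?thesis by (simp add: has_real_derivative_iff_has_vector_derivative)
    qed
    from fundamental_theorem_of_calculus[OF t der] show ?thesis by (simp add: ysg_def)
  qed
  obtain B where B: "\<And>n. norm (bapp (yosida n) x - x) \<le> B"
  proof -
    have "Bseq (\<lambda>n. bapp (yosida n) x - x)"
      by (rule convergent_imp_Bseq[OF convergentI[OF tendsto_diff[OF yosida_tendsto[OF xy] tendsto_const]]])
    then show ?thesis using that by (auto simp: Bseq_def)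
  qed
  have lim: "(\<lambda>n. ?f n s) \<longlonglongrightarrow> exp (- s) * h (sg s (y - x))" if s: "0 \<le> s" for s
  proof -
    have "(\<lambda>n. ysg n s ((bapp (yosida n) x - x) - (y - x))) \<longlonglongrightarrow> 0"
    proof (rule Lim_null_comparison)
      show "eventually (\<lambda>n. norm (ysg n s ((bapp (yosida n) x - x) - (y - x))) \<le> norm (bapp (yosida n) x - y)) sequentially"
        using norm_ysg[OF s] by (intro always_eventually allI) (metis diff_diff_eq2 diff_add_cancel)
      show "(\<lambda>n. norm (bapp (yosida n) x - y)) \<longlonglongrightarrow> 0"
        using yosida_tendsto[OF xy] by (simp add: LIM_zero_iff tendsto_norm_zero_iff)
    qed
    then have "(\<lambda>n. ysg n s ((bapp (yosida n) x - x) - (y - x)) + ysg n s (y - x)) \<longlonglongrightarrow> 0 + sg s (y - x)"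
      by (intro tendsto_add ysg_tendsto s)
    moreover have "ysg n s ((bapp (yosida n) x - x) - (y - x)) + ysg n s (y - x) = ysg n s (bapp (yosida n) x - x)" for n
      unfolding ysg_def bounded_bilinear.diff_right[OF bounded_bilinear_bapp] by simp
    ultimately have "(\<lambda>n. ysg n s (bapp (yosida n) x - x)) \<longlonglongrightarrow> sg s (y - x)" by simp
    then show ?thesis by (intro tendsto_mult tendsto_const h.tendsto)
  qed
  have bd: "norm (?f n s) \<le> B * C" if s: "s \<in> {0..t}" for n s
  proof -
    have "norm (h (ysg n s (bapp (yosida n) x - x))) \<le> norm (ysg n s (bapp (yosida n) x - x)) * C" by (rule C(2))
    also have "\<dots> \<le> B * C" using norm_ysg[of s n] B[of n] s C(1) by (intro mult_right_mono) (auto intro: order_trans)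
    finally have 1: "norm (h (ysg n s (bapp (yosida n) x - x))) \<le> B * C" .
    have "norm (?f n s) \<le> 1 * norm (h (ysg n s (bapp (yosida n) x - x)))"
      unfolding norm_mult using s by (intro mult_right_mono) auto
    then show ?thesis using 1 by simp
  qed
  have D: "(\<lambda>s. exp (- s) * h (sg s (y - x))) integrable_on {0..t}"
    "(\<lambda>n. integral {0..t} (?f n)) \<longlonglongrightarrow> integral {0..t} (\<lambda>s. exp (- s) * h (sg s (y - x)))"
    by (rule dominated_convergence[of ?f "{0..t}" "\<lambda>_. B * C"]; use I bd lim in \<open>auto simp: integrable_on_def\<close>)+
  have "(\<lambda>n. exp (- t) * h (ysg n t x) - h x) \<longlonglongrightarrow> exp (- t) * h (sg t x) - h x"
    by (intro tendsto_diff tendsto_mult tendsto_const h.tendsto ysg_tendsto t)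
  then have "integral {0..t} (\<lambda>s. exp (- s) * h (sg s (y - x))) = exp (- t) * h (sg t x) - h x"
    using D(2) I[THEN integral_unique] LIMSEQ_unique by simp
  then show ?thesis using D(1) by (simp add: has_integral_integrable_integral)
qed

section \<open>Stochastic completeness and the linear resolvent\<close>

context wgraph
begin

abbreviation unit_fun :: "('a \<Rightarrow> real) \<Rightarrow> bool" where
  "unit_fun f \<equiv> f \<in> l2 m \<and> (\<forall>x. 0 \<le> f x \<and> f x \<le> 1)"

lemma unemb_bounded_linear: "bounded_linear (\<lambda>v. unemb v x)"
  unfolding unemb_def using bounded_linear_compose[OF bounded_linear_divide bounded_linear_coord] .

text \<open>The constant 1 is a supersolution as soon as the data stay below
  \<open>\<alpha>\<close>: the Markov property of the form, read off from leastness.\<close>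

lemma lres_bounds:
  assumes a: "0 < \<alpha>" and f: "f \<in> l2 m" "\<And>x. 0 \<le> f x" "\<And>x. f x \<le> \<alpha>"
  shows "0 \<le> lres \<alpha> f x" "lres \<alpha> f x \<le> 1"
proof -
  interpret L: nonlin b m "\<lambda>s. s" "\<lambda>_. \<alpha>" by (rule nonlin_linear[OF a])
  note L.phi_0 [simp del]
  have s: "L.supersol f UNIV (\<lambda>_. 1)" by (rule L.supersol_const) (use f in simp_all)
  show "0 \<le> lres \<alpha> f x" unfolding lres_def by (rule L.lsol_nonneg[OF s])
  show "lres \<alpha> f x \<le> 1" unfolding lres_def by (rule L.lsol_le[OF s])
qed

lemma lres_unit_fun:
  assumes "0 < \<alpha>" "f \<in> l2 m" "\<And>x. 0 \<le> f x" "\<And>x. f x \<le> \<alpha>" shows "unit_fun (lres \<alpha> f)"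
  using lres_bounds[OF assms] form_operator_l2(1)[OF lres_form_operator[OF assms(1-3)]] by auto

text \<open>Rescaling: the inverse of \<open>1 + l * L\<close> equals the inverse of
  \<open>L + 1 / l\<close> applied to data divided by \<open>l\<close>.\<close>

lemma heat_res_lres:
  assumes l: "0 < l" and f: "f \<in> l2 m" "\<And>x. 0 \<le> f x"
  shows "heat.res l (emb f) = emb (lres (1 / l) (\<lambda>x. (1 / l) * f x))"
proof -
  let ?g = "\<lambda>x. (1 / l) * f x" let ?u = "lres (1 / l) ?g"
  have l': "0 < 1 / l" using l by simp
  have g: "?g \<in> l2 m" by (rule l2_closed(3)[OF f(1) f(1)])
  have g0: "0 \<le> ?g x" for x using l f(2) by simp
  note fo = lres_form_operator[OF l' g g0]
  note ul = form_operator_l2(1)[OF fo] and rl = form_operator_l2(2)[OF fo]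
  have "(emb ?u, emb (\<lambda>x. - (?g x - 1 / l * ?u x))) \<in> opA" unfolding opA_emb[OF ul rl] by (rule fo)
  from heat.res_eq[OF this l]
  have "heat.res l (emb ?u - l *\<^sub>R emb (\<lambda>x. - (?g x - 1 / l * ?u x))) = emb ?u" .
  also have "emb ?u - l *\<^sub>R emb (\<lambda>x. - (?g x - 1 / l * ?u x)) = emb f"
  proof (rule emb_eqI[symmetric])
    have "unemb (emb (\<lambda>x. - (?g x - 1 / l * ?u x))) = (\<lambda>x. - (?g x - 1 / l * ?u x))"
      by (rule unemb_emb[OF l2_closed(4)[OF rl rl]])
    then show "unemb (emb ?u - l *\<^sub>R emb (\<lambda>x. - (?g x - 1 / l * ?u x))) = f"
      using l by (simp only: unemb_simps unemb_emb[OF ul]) (simp add: fun_eq_iff field_simps)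
  qed
  finally show ?thesis .
qed

text \<open>The resolvents preserve values between 0 and 1, hence so do their powers, the Poisson
  averages of these powers, and the limit.\<close>

lemma heat_bounds:
  assumes f: "unit_fun f" and t: "0 \<le> t"
  shows "0 \<le> heat_op t f x" "heat_op t f x \<le> 1"
proof -
  have J: "unit_fun (unemb (heat.res l (emb g)))" if l: "0 < l" and g: "unit_fun g" for l g
  proof -
    have "unit_fun (lres (1 / l) (\<lambda>x. (1 / l) * g x))"
      by (rule lres_unit_fun) (use l g l2_closed(3)[of g g "1 / l"] in \<open>simp_all add: divide_right_mono\<close>)
    then show ?thesis using g by (simp add: heat_res_lres[OF l] unemb_emb)
  qed
  have pow: "unit_fun (unemb (bapp (heat.J l ^ k) (emb f)))" if l: "0 < l" for l k
  proof (induction k)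
    case 0 show ?case using f by (simp add: unemb_emb)
  next
    case (Suc k)
    show ?case using J[OF l Suc] by (simp add: heat.bapp_J l)
  qed
  have y: "0 \<le> unemb (heat.ysg n t (emb f)) x \<and> unemb (heat.ysg n t (emb f)) x \<le> 1" for n
    unfolding heat.ysg_def heat.exp_yosida
    using exp_dissipative_functional_bounds[OF unemb_bounded_linear, of "t * real (Suc n)" "heat.J (1 / real (Suc n))" "emb f" x]
      pow[of "1 / real (Suc n)"] t by (simp del: of_nat_Suc)
  have lim: "(\<lambda>n. unemb (heat.ysg n t (emb f)) x) \<longlonglongrightarrow> heat_op t f x"
    by (rule bounded_linear.tendsto[OF unemb_bounded_linear heat.ysg_tendsto[OF t]])
  show "0 \<le> heat_op t f x" by (rule LIMSEQ_le_const[OF lim]) (use y in blast)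
  show "heat_op t f x \<le> 1" by (rule LIMSEQ_le_const2[OF lim]) (use y in blast)
qed

lemma heat_mono:
  assumes f: "unit_fun f" and g: "unit_fun g" and le: "\<And>x. f x \<le> g x" and t: "0 \<le> t"
  shows "heat_op t f x \<le> heat_op t g x"
proof -
  have d: "unit_fun (\<lambda>x. g x - f x)"
  proof (intro conjI allI)
    show "(\<lambda>x. g x - f x) \<in> l2 m" using f g by (intro l2_closed(2)) auto
    show "0 \<le> g x - f x" for x using le by simp
    have "g x \<le> 1" "0 \<le> f x" for x using f g by auto
    then show "g x - f x \<le> 1" for x by (smt (verit))
  qed
  have "emb (\<lambda>x. g x - f x) = emb g - emb f" using f g by (intro emb_simps(2)) auto
  then have "unemb (heat.sg t (emb g) - heat.sg t (emb f)) x \<ge> 0"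
    using heat_bounds(1)[OF d t, of x] linear_diff[OF bounded_linear.linear[OF heat.sg_bounded_linear[OF t]]] by simp
  then show ?thesis by (simp add: unemb_simps)
qed

text \<open>The constant 1 may fail to be square-summable. \<open>lres\<close> still makes sense as
  a least supersolution, and \<open>lres_cutoff_one\<close> recovers it as a limit of resolvents of
  cutoffs.\<close>

definition linear_resolvent_conservative :: bool where
  "linear_resolvent_conservative \<longleftrightarrow> (\<forall>x. lres 1 (\<lambda>_. 1) x = 1)"

lemma cutoff_unit_fun: "(\<And>x. 0 \<le> f x \<and> f x \<le> 1) \<Longrightarrow> unit_fun (cutoff n f)"
  using fin_supp_l2[OF cutoff_fin_supp] by (auto simp: cutoff_def)

lemma lres_cutoff_one:
  shows "(\<lambda>n. lres 1 (cutoff n (\<lambda>_. 1)) x) \<longlonglongrightarrow> lres 1 (\<lambda>_. 1) x"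
    "lres 1 (cutoff n (\<lambda>_. 1)) x \<le> lres 1 (\<lambda>_. 1) x" "lres 1 (\<lambda>_. 1) x \<le> 1"
proof -
  interpret L: nonlin b m "\<lambda>s. s" "\<lambda>_. 1" by (rule nonlin_linear) simp
  note L.phi_0 [simp del]
  have v: "L.supersol (cutoff n (\<lambda>_. 1)) UNIV (\<lambda>_. 1)" for n
    by (rule L.supersol_const) (simp_all add: cutoff_def)
  have v1: "L.supersol (\<lambda>_. 1) UNIV (\<lambda>_. 1)" by (rule L.supersol_const) simp_all
  have inc: "incseq (\<lambda>n. cutoff n (\<lambda>_. 1) x)" for x :: 'a
    unfolding incseq_def cutoff_def using exhaust_mono by fastforce
  have bdd: "bdd_above (range (\<lambda>n. L.lsol (cutoff n (\<lambda>_. 1)) UNIV x))" for x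
    by (rule bdd_aboveI[where M = 1]) (use L.lsol_le[OF v] in auto)
  note lim = L.lsol_seq_limit[where K = "\<lambda>_. UNIV" and g = "\<lambda>n. cutoff n (\<lambda>_. 1)" and g' = "\<lambda>_. 1" and v = "\<lambda>_ _. 1",
      OF _ _ inc cutoff_eventually v bdd]
  show "(\<lambda>n. lres 1 (cutoff n (\<lambda>_. 1)) x) \<longlonglongrightarrow> lres 1 (\<lambda>_. 1) x"
    "lres 1 (cutoff n (\<lambda>_. 1)) x \<le> lres 1 (\<lambda>_. 1) x"
    unfolding lres_def using lim by (auto simp: incseq_def)
  show "lres 1 (\<lambda>_. 1) x \<le> 1" unfolding lres_def by (rule L.lsol_le[OF v1])
qed

text \<open>For \<open>u = lres 1 f\<close> the generator gives \<open>- L u - u = - f\<close>,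
  which makes \<open>f\<close> the integrand of \<open>heat.sg_exp_integral\<close>.\<close>

lemma lres_exp_integral:
  assumes f: "unit_fun f" and t: "0 \<le> t"
  shows "((\<lambda>s. exp (- s) * heat_op s f x) has_integral
    (lres 1 f x - exp (- t) * heat_op t (lres 1 f) x)) {0..t}"
proof -
  let ?u = "lres 1 f"
  have fo: "form_operator b m ?u (\<lambda>x. f x - 1 * ?u x)" by (rule lres_form_operator) (use f in auto)
  note ul = form_operator_l2(1)[OF fo] and rl = form_operator_l2(2)[OF fo]
  have A: "(emb ?u, emb (\<lambda>x. - (f x - 1 * ?u x))) \<in> opA" unfolding opA_emb[OF ul rl] by (rule fo)
  have fl: "f \<in> l2 m" using f by blast
  have "emb (\<lambda>x. - (f x - 1 * ?u x)) - emb ?u = - emb f"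
    using emb_simps(4)[OF rl rl] emb_simps(2)[OF fl ul] by simp
  moreover have "heat.sg s (- emb f) = - heat.sg s (emb f)" if "0 \<le> s" for s
    by (rule linear_neg[OF bounded_linear.linear[OF heat.sg_bounded_linear[OF that]]])
  ultimately have "((\<lambda>s. exp (- s) * unemb (- heat.sg s (emb f)) x) has_integral
      (exp (- t) * heat_op t ?u x - unemb (emb ?u) x)) {0..t}"
    using heat.sg_exp_integral[OF A unemb_bounded_linear[of x] t]
    by (elim has_integral_eq[rotated]) simp
  from has_integral_neg[OF this] show ?thesis by (simp add: unemb_simps unemb_emb[OF ul])
qed

lemma exp_integral: "0 \<le> t \<Longrightarrow> ((\<lambda>s. exp (- s)) has_integral (1 - exp (- t))) {0..t :: real}"
proof -
  assume t: "0 \<le> t"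
  have "((\<lambda>s. exp (- s)) has_integral (- exp (- t) - - exp (- 0))) {0..t}"
    by (rule fundamental_theorem_of_calculus[OF t])
      (auto intro!: derivative_eq_intros simp flip: has_real_derivative_iff_has_vector_derivative)
  then show ?thesis by simp
qed

text \<open>The supremum never exceeds 1 by \<open>heat_bounds\<close>, so equality with 1 is an
  approximation property about real numbers.\<close>

lemma stochastically_complete_iff_heat:
  "stochastically_complete b m \<longleftrightarrow>
    (\<forall>t>0. \<forall>x. \<forall>e>0. \<exists>g. unit_fun g \<and> 1 - e < heat_op t g x)"
proof -
  have "heat_semigroup_ext b m t (\<lambda>_. 1) x = 1 \<longleftrightarrow> (\<forall>e>0. \<exists>g. unit_fun g \<and> 1 - e < heat_op t g x)"
    if t: "0 < t" for t x
  proof -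
    have eq: "heat_semigroup_ext b m t (\<lambda>_. 1) x = (SUP g\<in>Collect unit_fun. ereal (heat_op t g x))"
      unfolding heat_semigroup_ext_def by (intro SUP_cong) (use t in \<open>auto simp: heat_semigroup_eq\<close>)
    have le: "heat_semigroup_ext b m t (\<lambda>_. 1) x \<le> 1"
      unfolding eq by (rule SUP_least) (use heat_bounds(2) t in auto)
    show ?thesis
    proof
      assume h: "heat_semigroup_ext b m t (\<lambda>_. 1) x = 1"
      show "\<forall>e>0. \<exists>g. unit_fun g \<and> 1 - e < heat_op t g x"
      proof (intro allI impI)
        fix e :: real assume "0 < e"
        then have "ereal (1 - e) < (SUP g\<in>Collect unit_fun. ereal (heat_op t g x))"
          using h unfolding eq by (simp add: one_ereal_def)
        then obtain g where "g \<in> Collect unit_fun" "ereal (1 - e) < ereal (heat_op t g x)"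
          by (auto simp only: less_SUP_iff)
        then show "\<exists>g. unit_fun g \<and> 1 - e < heat_op t g x" by auto
      qed
    next
      assume h: "\<forall>e>0. \<exists>g. unit_fun g \<and> 1 - e < heat_op t g x"
      have "1 \<le> heat_semigroup_ext b m t (\<lambda>_. 1) x"
      proof (rule ereal_le_epsilon2)
        fix e :: real assume "0 < e"
        then obtain g where g: "unit_fun g" "1 - e < heat_op t g x" using h by blast
        have "ereal (heat_op t g x) \<le> heat_semigroup_ext b m t (\<lambda>_. 1) x"
          unfolding eq by (rule SUP_upper) (use g in simp)
        moreover have "ereal 1 \<le> ereal (heat_op t g x) + ereal e" using g(2) by simp
        ultimately show "1 \<le> heat_semigroup_ext b m t (\<lambda>_. 1) x + ereal e"
          by (metis add_right_mono one_ereal_def order_trans)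
      qed
      then show "heat_semigroup_ext b m t (\<lambda>_. 1) x = 1" using le by (rule antisym[rotated])
    qed
  qed
  then show ?thesis unfolding stochastically_complete_def by blast
qed

text \<open>The witnesses are the resolvents \<open>u\<close> of cutoffs of 1. The time integral up
  to \<open>t\<close> is at most \<open>1 - exp (- t)\<close>, so a value of \<open>u\<close> near 1
  forces \<open>heat_op t u\<close> near 1.\<close>

lemma stochastically_complete_if_linear:
  assumes N: linear_resolvent_conservative shows "stochastically_complete b m"
  unfolding stochastically_complete_iff_heat
proof (intro allI impI)
  fix t :: real and x e assume t: "0 < t" and e: "0 < (e :: real)"
  let ?g = "\<lambda>n. cutoff n (\<lambda>_. 1 :: real)" let ?u = "\<lambda>n. lres 1 (?g n)"
  have g: "unit_fun (?g n)" for n by (rule cutoff_unit_fun) simp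
  have u: "unit_fun (?u n)" for n by (rule lres_unit_fun) (use g in auto)
  have "(\<lambda>n. ?u n x) \<longlonglongrightarrow> 1"
    using lres_cutoff_one(1)[of x] N by (simp add: linear_resolvent_conservative_def)
  \<comment> \<open>The factor \<open>exp (- t)\<close> in the tolerance is lost again in the final
    division.\<close>
  then have "eventually (\<lambda>n. ?u n x > 1 - e * exp (- t)) sequentially"
    by (rule order_tendstoD) (use e in simp)
  then obtain n where n: "?u n x > 1 - e * exp (- t)" by (auto simp: eventually_sequentially)
  have "?u n x - exp (- t) * heat_op t (?u n) x \<le> 1 - exp (- t)"
    by (rule has_integral_le[OF lres_exp_integral[OF g] exp_integral])
      (use t heat_bounds(2)[OF g] in \<open>auto intro: mult_left_le\<close>)
  then have "exp (- t) * (1 - e) < exp (- t) * heat_op t (?u n) x"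
    using n by (simp add: algebra_simps)
  then have "1 - e < heat_op t (?u n) x" by simp
  then show "\<exists>g. unit_fun g \<and> 1 - e < heat_op t g x" using u by blast
qed

text \<open>Completeness makes the semigroup on cutoffs of 1 converge to 1 at every time.
  Integration bounds the resolvent of 1 below by \<open>1 - exp (- t)\<close>, and \<open>t\<close>
  is arbitrary.\<close>

lemma linear_if_stochastically_complete:
  assumes sc: "stochastically_complete b m" shows linear_resolvent_conservative
  unfolding linear_resolvent_conservative_def
proof
  fix x
  let ?g = "\<lambda>n. cutoff n (\<lambda>_. 1 :: real)"
  have g: "unit_fun (?g n)" for n by (rule cutoff_unit_fun) simp
  have conv: "(\<lambda>n. heat_op s (?g n) x) \<longlonglongrightarrow> 1" if s: "0 \<le> s" for s
  proof (cases "s = 0")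
    case True
    have "heat_op 0 (?g n) x = ?g n x" for n
      using heat.c0_sg g by (simp add: c0_sg_def unemb_emb)
    then show ?thesis using True tendsto_eventually[OF cutoff_eventually[of "\<lambda>_. 1 :: real" x]] by simp
  next
    case False
    show ?thesis
    proof (rule order_tendstoI)
      fix a :: real assume "1 < a"
      then show "eventually (\<lambda>n. heat_op s (?g n) x < a) sequentially"
        using heat_bounds(2)[OF g s] by (intro always_eventually allI) (meson le_less_trans)
    next
      fix a :: real assume a: "a < 1"
      \<comment> \<open>Completeness supplies only some square-summable \<open>f\<close>. A late
        cutoff of \<open>f\<close> does almost as well and lies below the cutoff of the constant
        1.\<close>
      obtain f where f: "unit_fun f" "1 - (1 - a) < heat_op s f x"
        using sc[unfolded stochastically_complete_iff_heat, rule_format, of s "1 - a" x] False s a by auto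
      have fl: "f \<in> l2 m" using f by blast
      have "(\<lambda>n. heat_op s (cutoff n f) x) \<longlonglongrightarrow> heat_op s f x"
        by (intro bounded_linear.tendsto[OF unemb_bounded_linear] bounded_linear.tendsto[OF heat.sg_bounded_linear[OF s]]
            emb_cutoff_tendsto fl)
      then have "eventually (\<lambda>n. a < heat_op s (cutoff n f) x) sequentially"
        by (rule order_tendstoD) (use f(2) in simp)
      then show "eventually (\<lambda>n. a < heat_op s (?g n) x) sequentially"
      proof (rule eventually_mono)
        fix n assume n: "a < heat_op s (cutoff n f) x"
        have "heat_op s (cutoff n f) x \<le> heat_op s (?g n) x"
          by (rule heat_mono[OF cutoff_unit_fun g _ s]) (use f in \<open>auto simp: cutoff_def\<close>)
        then show "a < heat_op s (?g n) x" using n by simp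
      qed
    qed
  qed
  have "1 - exp (- t) \<le> lres 1 (\<lambda>_. 1) x" if t: "0 \<le> t" for t
  proof -
    let ?f = "\<lambda>n s. exp (- s) * heat_op s (?g n) x"
    have I: "(?f n has_integral (lres 1 (?g n) x - exp (- t) * heat_op t (lres 1 (?g n)) x)) {0..t}" for n
      by (rule lres_exp_integral[OF g t])
    have D: "(\<lambda>n. integral {0..t} (?f n)) \<longlonglongrightarrow> integral {0..t} (\<lambda>s. exp (- s) * 1)"
    proof (rule dominated_convergence(2)[where h = "\<lambda>_. 1"])
      show "?f n integrable_on {0..t}" for n using I by (auto simp: integrable_on_def)
      show "norm (?f n s) \<le> 1" if "s \<in> {0..t}" for n s
        using heat_bounds[OF g, of s] that by (auto simp: abs_mult intro!: mult_le_one)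
      show "(\<lambda>n. ?f n s) \<longlonglongrightarrow> exp (- s) * 1" if "s \<in> {0..t}" for s
        by (intro tendsto_mult tendsto_const conv) (use that in simp)
    qed auto
    have "integral {0..t} (?f n) \<le> lres 1 (\<lambda>_. 1) x" for n
    proof -
      have u: "unit_fun (lres 1 (?g n))" by (rule lres_unit_fun) (use g[of n] in auto)
      have "integral {0..t} (?f n) = lres 1 (?g n) x - exp (- t) * heat_op t (lres 1 (?g n)) x"
        by (rule integral_unique[OF I])
      also have "\<dots> \<le> lres 1 (?g n) x" using heat_bounds(1)[OF u t] by simp
      also have "\<dots> \<le> lres 1 (\<lambda>_. 1) x" by (rule lres_cutoff_one(2))
      finally show ?thesis .
    qed
    then have "integral {0..t} (\<lambda>s. exp (- s) * 1) \<le> lres 1 (\<lambda>_. 1) x"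
      by (intro LIMSEQ_le_const2[OF D]) auto
    then show ?thesis using integral_unique[OF exp_integral[OF t]] by simp
  qed
  then have le: "1 - exp (- real n) \<le> lres 1 (\<lambda>_. 1) x" for n by simp
  have "(\<lambda>n. 1 - exp (- real n)) \<longlonglongrightarrow> 1 - 0"
    by (intro tendsto_diff tendsto_const filterlim_compose[OF exp_at_bot]
        filterlim_compose[OF filterlim_uminus_at_bot_at_top filterlim_real_sequentially])
  then have "1 - 0 \<le> lres 1 (\<lambda>_. 1) x" by (rule LIMSEQ_le_const2) (use le in blast)
  then show "lres 1 (\<lambda>_. 1) x = 1" using lres_cutoff_one(3)[of x] by simp
qed

end

section \<open>Liouville properties\<close>

context wgraph
begin

section \<open>Truncation and the linear Liouville property\<close>

definition flow :: "('a \<Rightarrow> real) \<Rightarrow> 'a \<Rightarrow> real" where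
  "flow g x = (\<Sum>\<^sub>\<infinity>y. b x y * g y) - deg x * g x"

lemma laplacian_flow: "g \<in> linf \<Longrightarrow> m x * laplacian b m g x = - flow g x"
  by (simp add: laplacian_linf flow_def)

lemma flow_cmult: "flow (\<lambda>x. c * g x) x = c * flow g x"
proof -
  have "(\<Sum>\<^sub>\<infinity>y. b x y * (c * g y)) = (\<Sum>\<^sub>\<infinity>y. c * (b x y * g y))" by (simp add: mult_ac)
  then show ?thesis by (simp add: flow_def infsum_cmult_right' algebra_simps)
qed

lemma flow_const_diff:
  assumes "g \<in> linf" shows "flow (\<lambda>x. c - g x) x = - flow g x"
proof -
  have "(\<Sum>\<^sub>\<infinity>y. b x y * (c - g y)) = (\<Sum>\<^sub>\<infinity>y. b x y * c + - (b x y * g y))"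
    by (simp add: algebra_simps)
  also have "\<dots> = deg x * c + - (\<Sum>\<^sub>\<infinity>y. b x y * g y)"
    using infsum_add[OF summable_on_cmult_left[OF b_summable] summable_on_uminus[THEN iffD2, OF summable_b_linf[OF assms]]]
    by (simp add: infsum_uminus deg_def infsum_cmult_left[OF b_summable])
  finally show ?thesis by (simp add: flow_def algebra_simps)
qed

lemma linf_cut:
  assumes "g \<in> linf" shows "(\<lambda>x. max (g x - c) 0) \<in> linf"
proof -
  obtain C where C: "0 < C" "\<And>y. \<bar>g y\<bar> \<le> C" using linfD[OF assms] by blast
  have "\<bar>max (g y - c) 0\<bar> \<le> C + \<bar>c\<bar>" for y using C(1) C(2)[of y] by (simp add: max_def abs_if split: if_splits)
  then show ?thesis by (rule linfI)
qed

text \<open>Where the truncation vanishes it attains its minimum, so its flow there is nonnegative.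
  Where it is positive, only values at neighbours are raised compared with \<open>g - c\<close>, and
  constants have no flow.\<close>

lemma flow_cut:
  assumes g: "g \<in> linf"
  shows "0 \<le> flow (\<lambda>x. max (g x - c) 0) x \<or> c < g x"
    "c < g x \<Longrightarrow> flow g x \<le> flow (\<lambda>x. max (g x - c) 0) x"
proof -
  let ?u = "\<lambda>x. max (g x - c) 0"
  note u = linf_cut[OF g, of c]
  show "0 \<le> flow ?u x \<or> c < g x"
  proof (cases "c < g x")
    case False
    then have "?u x = 0" by simp
    then have "flow ?u x = (\<Sum>\<^sub>\<infinity>y. b x y * ?u y)" by (simp add: flow_def)
    also have "0 \<le> \<dots>" by (rule infsum_nonneg) simp
    finally show ?thesis by simp
  qed simp
  assume c: "c < g x"
  have gc: "(\<lambda>y. g y - c) \<in> linf"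
  proof -
    obtain C where C: "\<And>y. \<bar>g y\<bar> \<le> C" using linfD[OF g] by blast
    have "\<bar>g y - c\<bar> \<le> C + \<bar>c\<bar>" for y using C[of y] by linarith
    then show ?thesis by (rule linfI)
  qed
  have "(\<Sum>\<^sub>\<infinity>y. b x y * (g y - c)) \<le> (\<Sum>\<^sub>\<infinity>y. b x y * ?u y)"
    by (rule infsum_mono[OF summable_b_linf[OF gc] summable_b_linf[OF u]]) (simp add: mult_left_mono)
  then have "flow (\<lambda>y. g y - c) x \<le> flow ?u x" using c by (simp add: flow_def)
  moreover have "flow (\<lambda>y. g y - c) x = flow g x"
    using flow_const_diff[OF g, of c x] flow_cmult[of "-1" "\<lambda>y. c - g y" x] by simp
  ultimately show "flow g x \<le> flow ?u x" by simp
qed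

text \<open>Stated for subsolutions of \<open>- L h = h\<close> rather than for solutions, because
  truncation produces only subsolutions.\<close>

definition liouville :: bool where
  "liouville \<longleftrightarrow> (\<forall>h\<in>linf. (\<forall>x. 0 \<le> h x) \<and> (\<forall>x. m x * h x \<le> flow h x) \<longrightarrow> (\<forall>x. h x = 0))"

lemma liouvilleD:
  assumes "liouville" "h \<in> linf" "\<And>x. 0 \<le> h x" "\<And>x. m x * h x \<le> flow h x" shows "h x = 0"
  using assms unfolding liouville_def by blast

lemma linf_uminus: "g \<in> linf \<Longrightarrow> (\<lambda>x. - g x) \<in> linf"
  by (simp add: linf_def bounded_iff)

text \<open>If the supremum of \<open>g\<close> exceeded \<open>c\<close>, truncating \<open>g\<close> at most \<open>d\<close> below the supremum would give
  a nonzero bounded subsolution of the linear equation.\<close>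

lemma liouville_maximum_principle:
  assumes L: liouville and g: "g \<in> linf" and d: "0 < d"
    and sub: "\<And>x. c < g x \<Longrightarrow> m x * d \<le> flow g x"
  shows "g x \<le> c"
proof (rule ccontr)
  assume "\<not> g x \<le> c"
  then have x: "c < g x" by simp
  obtain C where C: "\<And>y. \<bar>g y\<bar> \<le> C" using linfD[OF g] by blast
  have bdd: "bdd_above (range g)" by (rule bdd_aboveI[where M = C]) (use C in \<open>auto simp: abs_le_iff\<close>)
  define s where "s = (SUP y. g y)"
  have s: "g y \<le> s" for y unfolding s_def by (rule cSUP_upper[OF _ bdd]) simp
  define c' where "c' = max c (s - d)"
  have "g y \<le> c'" for y
  proof -
    let ?u = "\<lambda>x. max (g x - c') 0"
    have "m z * ?u z \<le> flow ?u z" for z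
    proof (cases "c' < g z")
      case True
      have "?u z \<le> d" using s[of z] d by (auto simp: c'_def)
      then have "m z * ?u z \<le> m z * d" by (intro mult_left_mono) simp_all
      also have "\<dots> \<le> flow g z" using True by (intro sub) (simp add: c'_def)
      also have "\<dots> \<le> flow ?u z" by (rule flow_cut(2)[OF g True])
      finally show ?thesis .
    next
      case False
      then show ?thesis using flow_cut(1)[OF g, of c' z] by simp
    qed
    then have "?u y = 0" by (intro liouvilleD[OF L linf_cut[OF g, of c']]) simp_all
    then show ?thesis by (simp add: max_def split: if_splits)
  qed
  then have "s \<le> c'" unfolding s_def by (intro cSUP_least) auto
  moreover have "c < s" using x s[of x] by simp
  ultimately show False using d by (auto simp: c'_def)
qed

end

context nonlin
begin

section \<open>The nonlinear properties in terms of least solutions and the Liouville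
  property\<close>

abbreviation wsol :: "real \<Rightarrow> 'a \<Rightarrow> real" where
  "wsol \<beta> \<equiv> lsol (\<lambda>y. \<beta> * W y) UNIV"

lemma lsol_weight:
  assumes "0 \<le> \<beta>"
  shows "supersol (\<lambda>y. \<beta> * W y) UNIV (\<lambda>_. \<beta>)" "0 \<le> wsol \<beta> x" "wsol \<beta> x \<le> \<beta>"
proof -
  show s: "supersol (\<lambda>y. \<beta> * W y) UNIV (\<lambda>_. \<beta>)" by (rule supersol_const) (use assms in simp_all)
  show "0 \<le> wsol \<beta> x" by (rule lsol_nonneg[OF s])
  show "wsol \<beta> x \<le> \<beta>" by (rule lsol_le[OF s])
qed

text \<open>The reflection \<open>\<beta> - f\<close> exchanges subsolutions and supersolutions,
  because \<open>\<beta> * W x - W x * (\<beta> - f x)\<close> is \<open>W x * f x\<close>.\<close>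

lemma supersol_subsolution:
  assumes f: "\<And>x. 0 \<le> f x" "\<And>x. f x \<le> \<beta>" and sub: "\<And>x. m x * \<phi> (W x * f x) \<le> flow f x"
  shows "supersol (\<lambda>y. \<beta> * W y) UNIV (\<lambda>x. \<beta> - f x)"
  unfolding supersol_def
proof (intro conjI allI ballI impI)
  show "0 \<le> \<beta> - f x" for x using f(2) by simp
  fix x and F :: "'a set" assume F: "finite F"
  have fl: "f \<in> linf" by (rule linfI[where C = \<beta>]) (use f in simp)
  have "(\<lambda>x. \<beta> - f x) \<in> linf" by (rule linfI[where C = \<beta>]) (use f in \<open>simp add: abs_le_iff order_trans\<close>)
  then have "(\<Sum>y\<in>F. b x y * (\<beta> - f y)) \<le> (\<Sum>\<^sub>\<infinity>y. b x y * (\<beta> - f y))"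
    by (intro finite_sum_le_infsum summable_b_linf) (use F f in auto)
  also have "\<dots> = deg x * (\<beta> - f x) - flow f x"
    using flow_const_diff[OF fl, of \<beta> x] by (simp add: flow_def)
  also have "\<dots> \<le> deg x * (\<beta> - f x) - m x * \<phi> (W x * f x)" using sub by simp
  also have "\<dots> = balance (\<lambda>y. \<beta> * W y) x (\<beta> - f x)" by (simp add: balance_def algebra_simps)
  finally show "(\<Sum>y\<in>F. b x y * (\<beta> - f y)) \<le> balance (\<lambda>y. \<beta> * W y) x (\<beta> - f x)" .
qed

lemma lsol_weight_defect:
  assumes b: "0 \<le> \<beta>" defines "f \<equiv> \<lambda>x. \<beta> - wsol \<beta> x"
  shows "f \<in> linf" "flow f x = m x * \<phi> (W x * f x)"
proof -
  let ?u = "wsol \<beta>"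
  have u: "0 \<le> ?u x" "?u x \<le> \<beta>" for x by (rule lsol_weight(2,3)[OF b])+
  have ul: "?u \<in> linf" by (rule linfI[where C = \<beta>]) (use u in simp)
  show "f \<in> linf" unfolding f_def by (rule linfI[where C = \<beta>]) (use u in \<open>simp add: abs_le_iff order_trans\<close>)
  have "(\<Sum>\<^sub>\<infinity>y. b x y * ?u y) = balance (\<lambda>y. \<beta> * W y) x (?u x)"
    by (rule lsol_solves(2)[OF lsol_weight(1)[OF b]]) (use b in simp_all)
  then show "flow f x = m x * \<phi> (W x * f x)"
    unfolding f_def flow_const_diff[OF ul] by (simp add: flow_def balance_def algebra_simps)
qed

lemma nonneg_solutions_trivial_flow:
  "nonneg_solutions_trivial b m W \<phi> \<longleftrightarrow>
    (\<forall>f\<in>linf. (\<forall>x. 0 \<le> f x) \<and> (\<forall>x. flow f x = m x * \<phi> (W x * f x)) \<longrightarrow> (\<forall>x. f x = 0))"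
proof -
  have "- laplacian b m f x = \<phi> (W x * f x) \<longleftrightarrow> flow f x = m x * \<phi> (W x * f x)" if "f \<in> linf" for f x
  proof -
    have "- laplacian b m f x = \<phi> (W x * f x) \<longleftrightarrow> m x * (- laplacian b m f x) = m x * \<phi> (W x * f x)"
      by (metis m_nonzero mult_cancel_left)
    then show ?thesis using laplacian_flow[OF that, of x] by simp
  qed
  then show ?thesis unfolding nonneg_solutions_trivial_def by auto
qed

text \<open>The defect \<open>\<beta> - wsol \<beta>\<close> is itself a bounded nonnegative
  solution. Conversely, a solution bounded by \<open>C\<close> yields the supersolution
  \<open>C - f\<close> above \<open>wsol C = C\<close>; all \<open>\<beta>\<close> occur because
  solutions may have any bound.\<close>

lemma nonneg_solutions_trivial_iff_lsol:
  "nonneg_solutions_trivial b m W \<phi> \<longleftrightarrow> (\<forall>\<beta>>0. \<forall>x. wsol \<beta> x = \<beta>)" (is "?L \<longleftrightarrow> ?R")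
proof
  assume L: ?L
  show ?R
  proof (intro allI impI)
    fix \<beta> :: real and x assume "0 < \<beta>"
    then have b: "0 \<le> \<beta>" by simp
    have "\<beta> - wsol \<beta> x = 0"
      by (rule L[unfolded nonneg_solutions_trivial_flow, rule_format, OF lsol_weight_defect(1)[OF b]])
        (use lsol_weight_defect(2)[OF b] lsol_weight(3)[OF b] in simp)
    then show "wsol \<beta> x = \<beta>" by simp
  qed
next
  assume R: ?R
  show ?L
    unfolding nonneg_solutions_trivial_flow
  proof (intro ballI impI allI)
    fix f x assume f: "f \<in> linf" "(\<forall>x. 0 \<le> f x) \<and> (\<forall>x. flow f x = m x * \<phi> (W x * f x))"
    obtain C where C: "0 < C" "\<And>y. \<bar>f y\<bar> \<le> C" using linfD[OF f(1)] by blast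
    have "supersol (\<lambda>y. C * W y) UNIV (\<lambda>x. C - f x)"
      by (rule supersol_subsolution) (use f C in \<open>auto simp: abs_le_iff\<close>)
    then have "C \<le> C - f x" using lsol_le R C(1) by metis
    then show "f x = 0" using f(2) by (simp add: antisym)
  qed
qed

text \<open>One inequality is monotonicity in the data. For the other, the least solution on
  \<open>exhaust n\<close> lies below the one on the whole graph for the data cut off to
  \<open>exhaust n\<close>, which are finitely supported.\<close>

lemma resolvent_ext_weight:
  assumes b: "0 < \<beta>"
  shows "resolvent_ext b m \<phi> W (\<lambda>y. \<beta> * W y) x = ereal (wsol \<beta> x)"
proof -
  let ?g = "\<lambda>y. \<beta> * W y"
  let ?G = "{g \<in> fin_supp. \<forall>y. 0 \<le> g y \<and> g y \<le> ?g y}"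
  have b': "0 \<le> \<beta>" using b by simp
  note v = lsol_weight(1)[OF b']
  have eq: "resolvent_ext b m \<phi> W ?g x = (SUP g\<in>?G. ereal (lsol g UNIV x))"
    unfolding resolvent_ext_def by (intro SUP_cong) (auto simp: resolvent_eq_lsol)
  have "(SUP g\<in>?G. ereal (lsol g UNIV x)) = ereal (lsol ?g UNIV x)"
  proof (rule antisym)
    show "(SUP g\<in>?G. ereal (lsol g UNIV x)) \<le> ereal (lsol ?g UNIV x)"
      by (rule SUP_least) (auto intro: lsol_mono[OF v])
    have vn: "supersol ?g (exhaust n) (\<lambda>_. \<beta>)" for n by (rule supersol_antimono[OF v]) simp_all
    have bdd: "bdd_above (range (\<lambda>n. lsol ?g (exhaust n) x))" for x
      by (rule bdd_aboveI[where M = \<beta>]) (use lsol_le[OF vn] in auto)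
    have un: "(\<Union>n. exhaust n) = (UNIV :: 'a set)"
      using eventually_in_exhaust by (fastforce simp: eventually_sequentially)
    have "(\<lambda>n. lsol ?g (exhaust n) x) \<longlonglongrightarrow> lsol ?g UNIV x"
      by (rule lsol_seq_limit(1)[where g = "\<lambda>_. ?g", OF _ un _ _ vn bdd]) (auto simp: incseq_def exhaust_mono)
    then have "(\<lambda>n. ereal (lsol ?g (exhaust n) x)) \<longlonglongrightarrow> ereal (lsol ?g UNIV x)" by simp
    then show "ereal (lsol ?g UNIV x) \<le> (SUP g\<in>?G. ereal (lsol g UNIV x))"
    proof (rule LIMSEQ_le_const2, intro exI allI impI)
      fix n
      have s: "supersol (cutoff n ?g) UNIV (\<lambda>_. \<beta>)"
        by (rule supersol_antimono[OF v]) (use b in \<open>simp_all add: cutoff_def\<close>)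
      have "lsol ?g (exhaust n) x \<le> lsol (cutoff n ?g) UNIV x"
        by (rule lsol_mono[OF s]) (simp_all add: cutoff_def)
      moreover have "ereal (lsol (cutoff n ?g) UNIV x) \<le> (SUP g\<in>?G. ereal (lsol g UNIV x))"
        by (rule SUP_upper) (use b in \<open>simp add: cutoff_def[of n ?g] cutoff_fin_supp[of n ?g, unfolded cutoff_def]\<close>)
      ultimately show "ereal (lsol ?g (exhaust n) x) \<le> (SUP g\<in>?G. ereal (lsol g UNIV x))"
        by (meson ereal_less_eq(3) order_trans)
    qed
  qed
  then show ?thesis unfolding eq .
qed

lemma resolvent_conservative_iff:
  "resolvent_conservative b m W \<phi> \<longleftrightarrow> nonneg_solutions_trivial b m W \<phi>"
  unfolding nonneg_solutions_trivial_iff_lsol resolvent_conservative_def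
  by (simp add: resolvent_ext_weight)

lemma inv_phi: "inv \<phi> (\<phi> s) = s"
  by (rule inv_f_f[OF phi_inj])

text \<open>Where \<open>- g\<close> exceeds \<open>c > 0\<close>, the positive lower bound
  \<open>w\<close> of the weight makes its flow at least \<open>m y * \<phi> (w * c)\<close>. The
  maximum principle excludes such points, and \<open>c\<close> is arbitrary.\<close>

lemma supersolutions_nonneg_if_liouville:
  assumes L: liouville shows "supersolutions_nonneg b m W \<phi>"
  unfolding supersolutions_nonneg_def
proof (intro ballI impI allI)
  fix g x
  assume g: "g \<in> linf \<inter> lap_dom_range b m \<phi>" and sup: "\<forall>x. 0 \<le> inv \<phi> (laplacian b m g x) + W x * g x"
  have gl: "g \<in> linf" and ran: "laplacian b m g x \<in> range \<phi>" for x using g by (auto simp: lap_dom_range_def)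
  have fl: "(\<lambda>x. - g x) \<in> linf" by (rule linf_uminus[OF gl])
  obtain w where w: "0 < w" "\<And>x. w \<le> W x" using W_lower by blast
  have fx: "flow (\<lambda>x. - g x) y \<ge> m y * \<phi> (W y * - g y)" for y
  proof -
    obtain s where s: "laplacian b m g y = \<phi> s" using ran[of y] by blast
    have "W y * - g y \<le> s" using sup[rule_format, of y] by (simp add: s inv_phi)
    then have "m y * \<phi> (W y * - g y) \<le> m y * laplacian b m g y"
      unfolding s using phi_mono_iff by (simp add: mult_left_mono)
    also have "\<dots> = flow (\<lambda>x. - g x) y"
      unfolding laplacian_flow[OF gl] using flow_cmult[of "-1" g y] by simp
    finally show ?thesis .
  qed
  have "- g x \<le> c" if c: "0 < c" for c
  proof (rule liouville_maximum_principle[OF L fl, of "\<phi> (w * c)"])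
    show "0 < \<phi> (w * c)" using phi_strict[of 0 "w * c"] w c by simp
    fix y assume y: "c < - g y"
    have "w * c \<le> W y * - g y" using w(2)[of y] w(1) y c by (intro mult_mono) auto
    then have "m y * \<phi> (w * c) \<le> m y * \<phi> (W y * - g y)" using phi_mono_iff by (simp add: mult_left_mono)
    then show "m y * \<phi> (w * c) \<le> flow (\<lambda>x. - g x) y" using fx[of y] by linarith
  qed
  then have "- g x \<le> 0" by (rule field_le_epsilon) simp
  then show "0 \<le> g x" by simp
qed

lemma supersolutions_nonneg_imp:
  "supersolutions_nonneg b m W \<phi> \<Longrightarrow> nonpos_supersolutions_trivial b m W \<phi>"
  unfolding supersolutions_nonneg_def nonpos_supersolutions_trivial_def by (blast intro: antisym)

lemma nonpos_supersolutions_trivial_imp: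
  "nonpos_supersolutions_trivial b m W \<phi> \<Longrightarrow> nonpos_solutions_trivial b m W \<phi>"
  unfolding nonpos_supersolutions_trivial_def nonpos_solutions_trivial_def by (auto simp del: split_paired_All)

text \<open>Negating a solution puts its Laplacian into the range of \<open>\<phi>\<close>
  automatically, with \<open>W x * f x\<close> as preimage.\<close>

lemma nonpos_solutions_trivial_imp:
  assumes P: "nonpos_solutions_trivial b m W \<phi>" shows "nonneg_solutions_trivial b m W \<phi>"
  unfolding nonneg_solutions_trivial_def
proof (intro ballI impI allI)
  fix f x assume f: "f \<in> linf" "(\<forall>x. 0 \<le> f x) \<and> (\<forall>x. - laplacian b m f x = \<phi> (W x * f x))"
  let ?g = "\<lambda>x. - f x"
  have gl: "?g \<in> linf" by (rule linf_uminus[OF f(1)])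
  have lap: "laplacian b m ?g x = \<phi> (W x * f x)" for x
  proof -
    have "m x * laplacian b m ?g x = m x * - laplacian b m f x"
      using laplacian_flow[OF gl, of x] laplacian_flow[OF f(1), of x] flow_cmult[of "-1" f x] by simp
    then show ?thesis using f(2) by simp
  qed
  have "\<forall>x. ?g x = 0"
  proof (rule P[unfolded nonpos_solutions_trivial_def, THEN bspec, THEN mp])
    show "?g \<in> linf \<inter> lap_dom_range b m \<phi>" using gl linf_lap_dom[OF gl] by (simp add: lap_dom_range_def lap)
    show "(\<forall>x. ?g x \<le> 0) \<and> (\<forall>x. inv \<phi> (laplacian b m ?g x) + W x * ?g x = 0)"
      using f(2) by (simp add: lap inv_phi)
  qed
  then show "f x = 0" by simp
qed

text \<open>A nonzero bounded subsolution \<open>h\<close> of the linear equation, cut off just below its supremum \<open>s\<close>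
  and rescaled to height \<open>1\<close>, has arbitrarily large flow where it is positive and is thus a
  subsolution of the nonlinear equation.\<close>

lemma liouville_if_nonneg_solutions_trivial:
  assumes P: "nonneg_solutions_trivial b m W \<phi>" and Wb: "W \<in> linf" shows liouville
  unfolding liouville_def
proof (intro ballI impI allI, rule ccontr)
  fix h x assume h: "h \<in> linf" "(\<forall>x. 0 \<le> h x) \<and> (\<forall>x. m x * h x \<le> flow h x)" and hx: "h x \<noteq> 0"
  obtain C where C: "0 < C" "\<And>y. \<bar>W y\<bar> \<le> C" using linfD[OF Wb] by blast
  obtain B where B: "\<And>y. \<bar>h y\<bar> \<le> B" using linfD[OF h(1)] by blast
  have bdd: "bdd_above (range h)" by (rule bdd_aboveI[where M = B]) (use B in \<open>auto simp: abs_le_iff\<close>)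
  define s where "s = (SUP y. h y)"
  have s: "h y \<le> s" for y unfolding s_def by (rule cSUP_upper[OF _ bdd]) simp
  have s0: "0 < s" using s[of x] h(2) hx by (metis less_le_trans order_le_less)
  have p: "0 < \<phi> C" using phi_strict[OF C(1)] by simp
  \<comment> \<open>The cut \<open>c\<close> and the scale \<open>k\<close> solve
    \<open>k * (s - c) = 1\<close> and \<open>k * c = \<phi> C\<close>: the rescaled truncation has
    height 1, and above the cut the linear source beats the largest value \<open>\<phi>\<close> can
    take there.\<close>
  define k where "k = (1 + \<phi> C) / s"
  define c where "c = s - 1 / k"
  have k: "0 < k" using s0 p by (simp add: k_def)
  have ks: "k * s = 1 + \<phi> C" using s0 by (simp add: k_def)
  have kc: "k * c = \<phi> C" using k ks by (simp add: c_def right_diff_distrib)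
  define f where "f y = k * max (h y - c) 0" for y
  have f0: "0 \<le> f y" for y using k by (simp add: f_def)
  have f1: "f y \<le> 1" for y
  proof -
    have "k * (h y - c) \<le> k * (s - c)" using k s[of y] by (intro mult_left_mono) auto
    also have "\<dots> = 1" using k by (simp add: c_def)
    finally show ?thesis by (simp add: f_def max_def)
  qed
  have "m y * \<phi> (W y * f y) \<le> flow f y" for y
  proof (cases "c < h y")
    case True
    have "W y * f y \<le> C * 1" using C(1) C(2)[of y] f0 f1 by (intro mult_mono) auto
    then have "m y * \<phi> (W y * f y) \<le> m y * (k * c)"
      unfolding kc using phi_mono_iff by (simp add: mult_left_mono)
    also have "\<dots> \<le> k * (m y * h y)" using True k by (simp add: mult_left_mono)
    also have "\<dots> \<le> k * flow h y" using h(2) k by (simp add: mult_left_mono)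
    also have "\<dots> \<le> k * flow (\<lambda>x. max (h x - c) 0) y"
      using flow_cut(2)[OF h(1) True] k by (simp add: mult_left_mono)
    also have "\<dots> = flow f y" unfolding f_def flow_cmult ..
    finally show ?thesis .
  next
    case False
    then have "f y = 0" by (simp add: f_def)
    moreover have "0 \<le> flow f y" unfolding f_def flow_cmult using flow_cut(1)[OF h(1), of c y] False k by simp
    ultimately show ?thesis by simp
  qed
  then have sup: "supersol (\<lambda>y. 1 * W y) UNIV (\<lambda>y. 1 - f y)" by (rule supersol_subsolution[OF f0 f1])
  have "h y \<le> c" for y
  proof (rule ccontr)
    assume "\<not> h y \<le> c"
    then have "0 < k * (h y - c)" "f y = k * (h y - c)" using k by (simp_all add: f_def max_def)
    \<comment> \<open>By triviality the least solution for \<open>\<beta> = 1\<close> is the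
      constant 1, and the supersolution \<open>1 - f\<close> lies above it.\<close>
    moreover have "1 \<le> 1 - f y"
      using lsol_le[OF sup, of y] P[unfolded nonneg_solutions_trivial_iff_lsol, rule_format, of 1 y] by simp
    ultimately show False by linarith
  qed
  then have "s \<le> c" unfolding s_def by (intro cSUP_least) auto
  then show False using k by (simp add: c_def)
qed

end

context wgraph
begin

text \<open>The defect \<open>1 - lres 1\<close> of the constant 1 is a bounded solution of the
  linear equation. Conversely, only \<open>\<beta> = 1\<close> is available, so a bounded
  subsolution is scaled by linearity to lie below 1 before it is compared.\<close>

lemma linear_resolvent_conservative_iff: "linear_resolvent_conservative \<longleftrightarrow> liouville"
proof -
  interpret L: nonlin b m "\<lambda>s. s" "\<lambda>_. 1" by (rule nonlin_linear) simp
  note L.phi_0 [simp del]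
  have one: "(\<lambda>y :: 'a. 1 * 1) = (\<lambda>_. 1 :: real)" by simp
  show ?thesis
  proof
    assume N: linear_resolvent_conservative
    show liouville
      unfolding liouville_def
    proof (intro ballI impI allI)
      fix h x assume h: "h \<in> linf" "(\<forall>x. 0 \<le> h x) \<and> (\<forall>x. m x * h x \<le> flow h x)"
      obtain C where C: "0 < C" "\<And>y. \<bar>h y\<bar> \<le> C" using linfD[OF h(1)] by blast
      let ?f = "\<lambda>x. (1 / C) * h x"
      have "L.supersol (\<lambda>y. 1 * 1) UNIV (\<lambda>x. 1 - ?f x)"
      proof (rule L.supersol_subsolution)
        fix y
        show "0 \<le> ?f y" "?f y \<le> 1" using C(1) C(2)[of y] h(2) by (simp_all add: abs_le_iff)
        have "(1 / C) * (m y * h y) \<le> (1 / C) * flow h y" using C(1) h(2) by (intro mult_left_mono) auto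
        then show "m y * (1 * ?f y) \<le> flow ?f y" unfolding flow_cmult by (simp add: mult_ac)
      qed
      then have "lres 1 (\<lambda>_. 1) x \<le> 1 - ?f x" unfolding lres_def one by (rule L.lsol_le)
      then have "?f x \<le> 0" using N by (simp add: linear_resolvent_conservative_def)
      then show "h x = 0" using C(1) h(2) by (simp add: divide_le_0_iff antisym)
    qed
  next
    assume L: liouville
    show linear_resolvent_conservative
      unfolding linear_resolvent_conservative_def
    proof
      fix x
      let ?f = "\<lambda>x. 1 - L.lsol (\<lambda>y. 1 * 1) UNIV x"
      have d: "?f \<in> linf" "flow ?f y = m y * (1 * ?f y)" for y
        by (rule L.lsol_weight_defect; simp)+
      have nn: "0 \<le> ?f y" for y using L.lsol_weight(3)[of 1 y] by simp
      have "m y * ?f y \<le> flow ?f y" for y unfolding d(2) by (simp only: mult_1 order_refl)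
      from liouvilleD[OF L d(1) nn this] have "?f x = 0" .
      then show "lres 1 (\<lambda>_. 1) x = 1" unfolding lres_def by simp
    qed
  qed
qed

lemma stochastically_complete_iff_liouville: "stochastically_complete b m \<longleftrightarrow> liouville"
  using stochastically_complete_if_linear linear_if_stochastically_complete linear_resolvent_conservative_iff
  by blast

end

text \<open>The last of the four conditions implies the others, and each of them implies the first,
  by specializing to \<open>W = 1\<close> and to the identity. It remains to derive the last from
  completeness and to recover completeness from a single pair with bounded weight.\<close>

theorem theorem5p1:
  fixes b :: "'a::countable \<Rightarrow> 'a \<Rightarrow> real" and m :: "'a \<Rightarrow> real"
  assumes graph: "weighted_graph b"
    and measure_pos: "\<forall>x. 0 < m x"
  shows "\<forall>P \<in> {resolvent_conservative b m, nonpos_solutions_trivial b m,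
               supersolutions_nonneg b m, nonpos_supersolutions_trivial b m,
               nonneg_solutions_trivial b m}.
     (stochastically_complete b m \<longleftrightarrow>
        (\<exists>W \<in> weights \<inter> linf. \<exists>\<phi> \<in> nonlinearities. P W \<phi>)) \<and>
     (stochastically_complete b m \<longleftrightarrow>
        (\<exists>W \<in> weights \<inter> linf. \<forall>\<phi> \<in> nonlinearities. P W \<phi>)) \<and>
     (stochastically_complete b m \<longleftrightarrow>
        (\<forall>W \<in> weights. \<exists>\<phi> \<in> nonlinearities. P W \<phi>)) \<and>
     (stochastically_complete b m \<longleftrightarrow>
        (\<forall>W \<in> weights. \<forall>\<phi> \<in> nonlinearities. P W \<phi>))"
proof
  fix P
  assume P: "P \<in> {resolvent_conservative b m, nonpos_solutions_trivial b m, supersolutions_nonneg b m,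
      nonpos_supersolutions_trivial b m, nonneg_solutions_trivial b m}"
  interpret wgraph b m by unfold_locales (rule graph measure_pos)+
  have nl: "nonlin b m \<phi> W" if "\<phi> \<in> nonlinearities" "W \<in> weights" for \<phi> W
    by unfold_locales (rule that)+
  have fwd: "P W \<phi>" if sc: "stochastically_complete b m" and "\<phi> \<in> nonlinearities" "W \<in> weights" for W \<phi>
  proof -
    interpret N: nonlin b m \<phi> W by (rule nl[OF that(2,3)])
    have "supersolutions_nonneg b m W \<phi>"
      using N.supersolutions_nonneg_if_liouville sc stochastically_complete_iff_liouville by blast
    then have "supersolutions_nonneg b m W \<phi>" "nonpos_supersolutions_trivial b m W \<phi>"
        "nonpos_solutions_trivial b m W \<phi>" "nonneg_solutions_trivial b m W \<phi>" "resolvent_conservative b m W \<phi>"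
      using N.supersolutions_nonneg_imp N.nonpos_supersolutions_trivial_imp N.nonpos_solutions_trivial_imp
        N.resolvent_conservative_iff by blast+
    then show ?thesis using P by blast
  qed
  have bwd: "stochastically_complete b m"
    if "P W \<phi>" "\<phi> \<in> nonlinearities" "W \<in> weights" "W \<in> linf" for W \<phi>
  proof -
    interpret N: nonlin b m \<phi> W by (rule nl[OF that(2,3)])
    have "nonneg_solutions_trivial b m W \<phi>"
      using P that(1) N.supersolutions_nonneg_imp N.nonpos_supersolutions_trivial_imp N.nonpos_solutions_trivial_imp
        N.resolvent_conservative_iff by blast
    then have liouville using that(4) by (rule N.liouville_if_nonneg_solutions_trivial)
    then show ?thesis by (simp add: stochastically_complete_iff_liouville)
  qed
  have one: "(\<lambda>_. 1) \<in> weights" "(\<lambda>_. 1) \<in> linf" and id: "(\<lambda>s. s) \<in> nonlinearities"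
    by (simp_all add: weights_def linf_def nonlinearities_def strict_mono_def)
  show "(stochastically_complete b m \<longleftrightarrow> (\<exists>W \<in> weights \<inter> linf. \<exists>\<phi> \<in> nonlinearities. P W \<phi>)) \<and>
     (stochastically_complete b m \<longleftrightarrow> (\<exists>W \<in> weights \<inter> linf. \<forall>\<phi> \<in> nonlinearities. P W \<phi>)) \<and>
     (stochastically_complete b m \<longleftrightarrow> (\<forall>W \<in> weights. \<exists>\<phi> \<in> nonlinearities. P W \<phi>)) \<and>
     (stochastically_complete b m \<longleftrightarrow> (\<forall>W \<in> weights. \<forall>\<phi> \<in> nonlinearities. P W \<phi>))"
    (is "(?S \<longleftrightarrow> ?i) \<and> (?S \<longleftrightarrow> ?ii) \<and> (?S \<longleftrightarrow> ?iii) \<and> (?S \<longleftrightarrow> ?iv)")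
  proof -
    have "?S \<Longrightarrow> ?iv" using fwd by blast
    moreover have "?iv \<Longrightarrow> ?iii" using id by blast
    moreover have "?iii \<Longrightarrow> ?i" using one by blast
    moreover have "?iv \<Longrightarrow> ?ii" using one by blast
    moreover have "?ii \<Longrightarrow> ?i" using id by blast
    moreover have "?i \<Longrightarrow> ?S" using bwd by blast
    ultimately show ?thesis by argo
  qed
qed

end
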